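(* In the finite-difference inverse medium problem described in the context, let $N=N_n\to\infty$ as $n\to\infty$, $d=d_n=(N-1)^2$, $\mathcal F=[q_{\min},q_{\max}]^d$ with $0\le q_{\min}<q_{\max}<\infty$ fixed, and let the data be $\mathbf Y_n=G(\mathbf q_0)+n^{-1/2}\eta$ with $\eta\sim N(0,\mathbf I_d)$, where the truth $\mathbf q_0$ lies strictly inside $\mathcal F$. Let the prior be the product prior $\Pi(d\mathbf q)=\prod_{i=1}^d\pi_i(\mathbf q_i)\,d\mathbf q_i$ where the densities $\pi_i$ satisfy, with constants independent of $i$, $d$ and $n$: (i) each $\pi_i$ is supported in $[q_{\min},q_{\max}]$; (ii) there is $C>0$ with $|\log\pi_i(q_1)-\log\pi_i(q_2)|\le C$ for all $q_1,q_2\in[q_{\min},q_{\max}]$; (iii) given $\delta>0$ there is $C_\delta>0$ with $|\log\pi_i(q_1)-\log\pi_i(q_2)|\le C_\delta|q_1-q_2|$ for all $q_1,q_2\in[q_{\min},q_{\max}]$ with $|q_1-q_2|\le\delta$. Let $\Pi_n$ be the posterior, $\Pi_n(d\mathbf q)\propto\exp\big(-\frac n2|\mathbf Y_n-G(\mathbf q)|^2\big)\,\Pi(d\mathbf q)$, let $\boldsymbol\Sigma=(\nabla G(\mathbf q_0)^T\nabla G(\mathbf q_0))^{-1}$ and $\Delta_n=\mathbf q_0+n^{-1/2}\boldsymbol\Sigma\nabla G(\mathbf q_0)^T\eta$. If $\delta_n:=n^{-1/2}d^{3}\log d\to0$ as $n\to\infty$, then $$d_{TV}\big(\Pi_n,N(\Delta_n,n^{-1}\boldsymbol\Sigma)\big)=\mathcal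 O_p(\delta_n)\quad\text{as } n\to\infty.$$
   Context: Let $\Omega=[0,1]^2$, and let $f\in C(\overline\Omega)$, $g\in C(\partial\Omega)$ be fixed and strictly positive. For an integer $N\ge2$ let $h=1/N$, $(x_i,y_j)=(ih,jh)$, $f_{i,j}=f(x_i,y_j)$, $g_{i,j}=g(x_i,y_j)$ at boundary grid points, and $d=(N-1)^2$. Vectors in $\mathbf R^d$ are indexed by the interior grid points $(i,j)$, $1\le i,j\le N-1$, in row-wise ordering. For $\mathbf q=(q_{i,j})\in\mathcal F:=[q_{\min},q_{\max}]^d$, $G(\mathbf q)=\mathbf u=(u_{i,j})\in\mathbf R^d$ is the unique solution of the finite difference scheme $$-\frac{u_{i-1,j}+u_{i+1,j}-4u_{i,j}+u_{i,j-1}+u_{i,j+1}}{h^2}+q_{i,j}u_{i,j}=f_{i,j},\quad 1\le i,j\le N-1,$$ with $u=g$ at boundary grid points. Equivalently $G(\mathbf q)=(h^{-2}\mathbf A+\mathbf Q)^{-1}(\mathbf f+h^{-2}\mathbf g)$, where $\mathbf A$ is the $d\times d$ block tridiagonal matrix with diagonal blocks $\mathbf B$ and off-diagonal blocks $-\mathbf I$ ($\mathbf B$ is the $(N-1)\times(N-1)$ tridiagonal matrix with $4$ on the diagonal and $-1$ on the off-diagonals), $\mathbf Q=\mathrm{diag}(\mathbf q)$, $\mathbf f=(f_{i,j})$, and the $(i,j)$ entry of $\mathbf g$ is the sum of the values of $g$ at those of the four neighbours of $(i,j)$ that are boundary points. $\nabla G(\mathbf q)$ denotes the derivative matrix of $G$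 at $\mathbf q$. $X_n=\mathcal O_p(\delta_n)$ means $X_n/\delta_n$ is bounded in probability (with respect to the law of $\eta$). $d_{TV}(\Pi_n,N(m,\mathbf S))$ is understood as $\int_{\mathcal F}|\pi_n(\mathbf q)-\phi(\mathbf q;m,\mathbf S)|\,d\mathbf q$, where $\pi_n$ is the density of $\Pi_n$ and $\phi(\cdot;m,\mathbf S)$ that of $N(m,\mathbf S)$.
   Formalization: "q_0 lies strictly inside F" is taken with a margin r>0 independent of n (q_min+r ≤ q_{0,i} ≤ q_max−r); with mere interiority for each n the claim fails, e.g. for q_{0,1}=q_min+e^{-n}. *)

theory Defs
  imports
    "HOL-Probability.Probability"
    "Jordan_Normal_Form.Determinant"
    "Jordan_Normal_Form.Gauss_Jordan_Elimination"
begin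

text \<open>Since the dimension \<open>d\<close> varies with \<open>n\<close>, vectors and matrices are those of
  \<open>Jordan_Normal_Form\<close>. The clashing names and notations of \<open>HOL-Analysis\<close> are hidden.\<close>

hide_const (open) Finite_Cartesian_Product.vec Finite_Cartesian_Product.mat
  Finite_Cartesian_Product.row Finite_Cartesian_Product.column
  Finite_Cartesian_Product.transpose Determinants.det
hide_type (open) Finite_Cartesian_Product.vec
unbundle no vec_syntax
no_notation inner (infixl \<open>\<bullet>\<close> 70)


section \<open>The finite difference forward map\<close>

text \<open>Position of the interior grid point \<open>(i, j)\<close>, \<open>1 \<le> i, j \<le> N - 1\<close>, in the row-wise
  ordering (a row is a set of points with the same \<open>y\<^sub>j\<close>); positions start at \<open>0\<close>.\<close>

definition grid_pos :: "nat \<Rightarrow> nat \<Rightarrow> nat \<Rightarrow> nat" where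
  "grid_pos N i j = (j - 1) * (N - 1) + (i - 1)"

definition grid_fun :: "(real \<times> real \<Rightarrow> real) \<Rightarrow> nat \<Rightarrow> real vec \<Rightarrow> nat \<Rightarrow> nat \<Rightarrow> real" where
  "grid_fun g N u i j =
     (if i \<in> {1..N - 1} \<and> j \<in> {1..N - 1} then u $ grid_pos N i j
      else g (real i / real N, real j / real N))"

definition solves_scheme ::
    "(real \<times> real \<Rightarrow> real) \<Rightarrow> (real \<times> real \<Rightarrow> real) \<Rightarrow> nat \<Rightarrow> real vec \<Rightarrow> real vec \<Rightarrow> bool" where
  "solves_scheme f g N q u \<longleftrightarrow>
     u \<in> carrier_vec ((N - 1)\<^sup>2) \<and>
     (\<forall>i\<in>{1..N - 1}. \<forall>j\<in>{1..N - 1}.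
        (let U = grid_fun g N u; h = 1 / real N in
          - (U (i - 1) j + U (i + 1) j - 4 * U i j + U i (j - 1) + U i (j + 1)) / h\<^sup>2
            + q $ grid_pos N i j * U i j
          = f (real i * h, real j * h)))"

definition forward_map ::
    "(real \<times> real \<Rightarrow> real) \<Rightarrow> (real \<times> real \<Rightarrow> real) \<Rightarrow> nat \<Rightarrow> real vec \<Rightarrow> real vec" where
  "forward_map f g N q = (THE u. solves_scheme f g N q u)"

text \<open>The derivative matrix: entry \<open>(k, l)\<close> is \<open>\<partial>G\<^sub>k / \<partial>q\<^sub>l\<close>.\<close>

definition jacobian :: "nat \<Rightarrow> (real vec \<Rightarrow> real vec) \<Rightarrow> real vec \<Rightarrow> real mat" where
  "jacobian d G q = mat d d (\<lambda>(k, l). deriv (\<lambda>t. G (q |\<^sub>v l \<mapsto> t) $ k) (q $ l))"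


section \<open>Measures and densities on \<open>\<real>\<^sup>d\<close>\<close>

text \<open>Measures on \<open>\<real>\<^sup>d\<close> live on the extensional functions on \<open>{..<d}\<close>; such a function \<open>x\<close>
  is turned into a vector by \<^term>\<open>vec d x\<close>.\<close>

abbreviation lborel_d :: "nat \<Rightarrow> (nat \<Rightarrow> real) measure" where
  "lborel_d d \<equiv> Pi\<^sub>M {..<d} (\<lambda>_. lborel)"

abbreviation std_normal_d :: "nat \<Rightarrow> (nat \<Rightarrow> real) measure" where
  "std_normal_d d \<equiv> Pi\<^sub>M {..<d} (\<lambda>_. density lborel (\<lambda>x. ennreal (std_normal_density x)))"

text \<open>\<^const>\<open>mat_inverse\<close> returns \<^const>\<open>None\<close> on singular matrices.\<close>

abbreviation inv_mat :: "real mat \<Rightarrow> real mat" where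
  "inv_mat A \<equiv> the (mat_inverse A)"

definition gaussian_pdf :: "nat \<Rightarrow> real vec \<Rightarrow> real mat \<Rightarrow> real vec \<Rightarrow> real" where
  "gaussian_pdf d m S x =
     exp (- ((x - m) \<bullet> (inv_mat S *\<^sub>v (x - m))) / 2) / sqrt ((2 * pi) ^ d * det S)"

definition prior_pdf :: "nat \<Rightarrow> (nat \<Rightarrow> real \<Rightarrow> real) \<Rightarrow> real vec \<Rightarrow> real" where
  "prior_pdf d p q = (\<Prod>i<d. p i (q $ i))"

definition likelihood :: "nat \<Rightarrow> (real vec \<Rightarrow> real vec) \<Rightarrow> real vec \<Rightarrow> real vec \<Rightarrow> real" where
  "likelihood n G Y q = exp (- (real n / 2) * ((Y - G q) \<bullet> (Y - G q)))"

definition posterior_pdf ::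
    "nat \<Rightarrow> nat \<Rightarrow> (real vec \<Rightarrow> real vec) \<Rightarrow> (nat \<Rightarrow> real \<Rightarrow> real) \<Rightarrow> real vec \<Rightarrow> real vec \<Rightarrow> real"
  where
  "posterior_pdf d n G p Y q =
     likelihood n G Y q * prior_pdf d p q /
     (\<integral>x. likelihood n G Y (vec d x) * prior_pdf d p (vec d x) \<partial>lborel_d d)"

text \<open>The distance \<open>d\<^sub>T\<^sub>V\<close> of two distributions given by their densities: an \<open>L\<^sup>1\<close> distance
  on the box \<open>\<F> = [a, b]\<^sup>d\<close> only, without the factor \<open>1/2\<close>.\<close>

definition dTV_box ::
    "nat \<Rightarrow> real \<Rightarrow> real \<Rightarrow> (real vec \<Rightarrow> real) \<Rightarrow> (real vec \<Rightarrow> real) \<Rightarrow> real" where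
  "dTV_box d a b \<pi> \<phi> =
     (LINT x : PiE {..<d} (\<lambda>_. {a..b}) | lborel_d d. \<bar>\<pi> (vec d x) - \<phi> (vec d x)\<bar>)"

text \<open>\<open>X\<^sub>n = O\<^sub>p(\<delta>\<^sub>n)\<close>, where \<open>X\<^sub>n\<close> is defined on the probability space \<open>P\<^sub>n\<close>. Measurability of
  the event is required because \<^const>\<open>measure\<close> is \<open>0\<close> on non-measurable sets.\<close>

definition bigO_p ::
    "(nat \<Rightarrow> 'a measure) \<Rightarrow> (nat \<Rightarrow> 'a \<Rightarrow> real) \<Rightarrow> (nat \<Rightarrow> real) \<Rightarrow> bool" where
  "bigO_p P X \<delta> \<longleftrightarrow>
     (\<forall>\<epsilon>>0. \<exists>M. \<forall>\<^sub>F n in sequentially.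
        {\<omega> \<in> space (P n). \<bar>X n \<omega>\<bar> > M * \<delta> n} \<in> sets (P n) \<and>
        measure (P n) {\<omega> \<in> space (P n). \<bar>X n \<omega>\<bar> > M * \<delta> n} \<le> \<epsilon>)"


section \<open>Data, limiting covariance and centring\<close>

definition data_vec ::
    "nat \<Rightarrow> (real vec \<Rightarrow> real vec) \<Rightarrow> real vec \<Rightarrow> real vec \<Rightarrow> real vec" where
  "data_vec n G q0 \<eta> = G q0 + (1 / sqrt (real n)) \<cdot>\<^sub>v \<eta>"

definition Sigma_mat :: "nat \<Rightarrow> (real vec \<Rightarrow> real vec) \<Rightarrow> real vec \<Rightarrow> real mat" where
  "Sigma_mat d G q0 = inv_mat (transpose_mat (jacobian d G q0) * jacobian d G q0)"

definition Delta_vec ::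
    "nat \<Rightarrow> nat \<Rightarrow> (real vec \<Rightarrow> real vec) \<Rightarrow> real vec \<Rightarrow> real vec \<Rightarrow> real vec" where
  "Delta_vec d n G q0 \<eta> =
     q0 + (1 / sqrt (real n)) \<cdot>\<^sub>v
            ((Sigma_mat d G q0 * transpose_mat (jacobian d G q0)) *\<^sub>v \<eta>)"

end

theory Submission
  imports Defs
begin

text \<open>With \<open>L\<^sub>q\<close> the matrix of the scheme, \<open>L\<^sub>q G(q)\<close> does not depend on \<open>q\<close>, so for
  \<open>w = q - q0\<close> and the Jacobian \<open>J\<close> at \<open>q0\<close> one gets the exact identities
  \<open>L\<^sub>q (G(q) - G(q0) - J w) = - w J w\<close> and \<open>L\<^bsub>q0\<^esub> (J w - (G(q) - G(q0))) = w (G(q) - G(q0))\<close>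
  (componentwise products). The discrete Poincare inequality gives \<open>|v| \<le> |L\<^sub>q v|\<close>, hence
  \<open>|G(q) - G(q0) - J w| \<le> |w|\<^sub>\<infinity> |J w|\<close> and \<open>|J w| \<le> (1 + |w|\<^sub>\<infinity>) |G(q) - G(q0)|\<close> on the whole
  box. The minimum principle bounds \<open>G(q0)\<close> from below, which yields \<open>|w|\<^sub>\<infinity> \<le> K d |J w|\<close>.

  Substitute \<open>J w = n\<^sup>-\<^sup>1\<^sup>/\<^sup>2 (\<eta> + \<zeta>)\<close>. The normal limit becomes the standard normal density of
  \<open>\<zeta>\<close>, and the unnormalized posterior is this density times \<open>exp R(\<zeta>)\<close>. Put
  \<open>e = n\<^sup>-\<^sup>1\<^sup>/\<^sup>2 d\<^sup>3\<close> and \<open>z = \<eta> + \<zeta>\<close>. As long as \<open>|w|\<^sub>\<infinity>\<close> is below a constant times \<open>1/d\<close>,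
  \<open>|exp R - 1|\<close> is at most \<open>O(e) exp (|\<zeta>|\<^sup>2 / 4d)\<close>, whose Gaussian mean is \<open>O(e)\<close>. Further out,
  \<open>|z|\<close> is of order at least \<open>d/e\<close>, and the global lower bound on \<open>|G(q) - G(q0)|\<close> makes the
  likelihood smaller than \<open>exp (- c |z|\<^sup>2)\<close>, which beats all factors exponential in \<open>d\<close>. All this
  holds on the event \<open>|\<eta>|\<^sup>2 \<le> M d\<close>, so the distance is even \<open>O\<^sub>p(n\<^sup>-\<^sup>1\<^sup>/\<^sup>2 d\<^sup>3)\<close>.\<close>

section \<open>Linear change of variables for \<open>lborel_d\<close>\<close>

text \<open>The posterior is known only up to its normalizing constant. An arbitrary multiple of the
  unnormalized density is compared with the normal one, and the error in the constant is charged to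
  the same integral, at the price of a factor 2 and of the normal mass outside the box.

  As the dimension grows, no constant may depend on \<open>d\<close>. Pointwise errors are therefore
  bounded by Gaussian kernels whose masses are explicit in \<open>d\<close>. One power of
  \<open>d\<close> in the rate comes from the entries of order \<open>N^2\<close> in the discrete
  Laplacian, which enter when \<open>w\<close> is recovered from \<open>J w\<close>. The other two
  come from bounding products of Euclidean norms, typically of order sqrt d, by squares of
  quantities of order \<open>d\<close>.

  Since \<open>J\<close> is square, \<Sigma> times its transpose is the inverse of \<open>J\<close>.
  That inverse is a negative definite diagonal matrix times the definite matrix of the scheme at
  \<open>q0\<close>. So linear substitution is needed only for definite matrices and their products,
  and there it reduces to substitutions in one variable.\<close>

lemma nn_integral_PiM_lborel_update_affine:
  fixes f :: "('i \<Rightarrow> real) \<Rightarrow> ennreal" and c :: real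
  assumes fin: "finite I" and k: "k \<in> I" and c: "c \<noteq> 0"
    and f: "f \<in> borel_measurable (PiM I (\<lambda>_. lborel))"
    and h: "h \<in> borel_measurable (PiM I (\<lambda>_. lborel))"
    and indep: "\<And>x y. h (x(k := y)) = h x"
  shows "(\<integral>\<^sup>+x. f x \<partial>PiM I (\<lambda>_. lborel))
       = \<bar>c\<bar> * (\<integral>\<^sup>+x. f (x(k := c * x k + h x)) \<partial>PiM I (\<lambda>_. lborel))"
proof -
  interpret product_sigma_finite "\<lambda>_::'i. lborel :: real measure"
    by standard
  define J where "J = I - {k}"
  have I: "I = insert k J" and finJ: "finite J" and kJ: "k \<notin> J"
    using k fin by (auto simp: J_def)
  have f' [measurable]: "f \<in> borel_measurable (PiM (insert k J) (\<lambda>_. lborel))"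
    and h' [measurable]: "h \<in> borel_measurable (PiM (insert k J) (\<lambda>_. lborel))"
    using f h by (simp_all add: I)
  have g: "(\<lambda>x. f (x(k := c * x k + h x))) \<in> borel_measurable (PiM (insert k J) (\<lambda>_. lborel))"
    by (rule measurable_compose[OF _ f'], rule measurable_fun_upd[where J = "insert k J"]) auto
  have upd: "(\<lambda>p. (fst p)(k := snd p)) \<in>
      PiM J (\<lambda>_. lborel) \<Otimes>\<^sub>M lborel \<rightarrow>\<^sub>M PiM (insert k J) (\<lambda>_. lborel)"
    by (rule measurable_fun_upd[where J = J]) auto
  have "(\<integral>\<^sup>+x. f x \<partial>PiM I (\<lambda>_. lborel)) =
      (\<integral>\<^sup>+x. \<integral>\<^sup>+y. f (x(k := y)) \<partial>lborel \<partial>PiM J (\<lambda>_. lborel))"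
    unfolding I by (rule product_nn_integral_insert[OF finJ kJ]) simp
  \<comment> \<open>With the other coordinates fixed, the map is affine in one real variable; by
    \<open>indep\<close> its shift is constant during the inner integration.\<close>
  also have "\<dots> = (\<integral>\<^sup>+x. \<bar>c\<bar> * (\<integral>\<^sup>+y. f (x(k := h x + c * y)) \<partial>lborel) \<partial>PiM J (\<lambda>_. lborel))"
  proof (intro nn_integral_cong)
    fix x :: "'i \<Rightarrow> real" assume x [measurable]: "x \<in> space (PiM J (\<lambda>_. lborel))"
    have m: "(\<lambda>y. f (x(k := y))) \<in> borel_measurable borel"
      using kJ by measurable
    show "(\<integral>\<^sup>+y. f (x(k := y)) \<partial>lborel) = \<bar>c\<bar> * (\<integral>\<^sup>+y. f (x(k := h x + c * y)) \<partial>lborel)"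
      by (rule nn_integral_real_affine[OF m c])
  qed
  also have "\<dots> = (\<integral>\<^sup>+x. \<bar>c\<bar> * (\<integral>\<^sup>+y. f ((x(k := y))(k := c * (x(k := y)) k + h (x(k := y)))) \<partial>lborel)
      \<partial>PiM J (\<lambda>_. lborel))"
    by (simp add: indep add.commute)
  also have "\<dots> = \<bar>c\<bar> * (\<integral>\<^sup>+x. (\<integral>\<^sup>+y. f ((x(k := y))(k := c * (x(k := y)) k + h (x(k := y)))) \<partial>lborel)
      \<partial>PiM J (\<lambda>_. lborel))"
    using measurable_compose[OF upd g]
    by (intro nn_integral_cmult lborel.borel_measurable_nn_integral) (simp add: case_prod_beta')
  also have "\<dots> = \<bar>c\<bar> * (\<integral>\<^sup>+x. f (x(k := c * x k + h x)) \<partial>PiM I (\<lambda>_. lborel))"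
    unfolding I by (subst product_nn_integral_insert[OF finJ kJ g]) simp
  finally show ?thesis .
qed

lemma nn_integral_lborel_d_translate:
  fixes f :: "(nat \<Rightarrow> real) \<Rightarrow> ennreal"
  assumes f: "f \<in> borel_measurable (lborel_d d)"
  shows "(\<integral>\<^sup>+x. f x \<partial>lborel_d d) = (\<integral>\<^sup>+x. f (\<lambda>i\<in>{..<d}. m i + x i) \<partial>lborel_d d)"
proof -
  have m [measurable]: "(\<lambda>x. \<lambda>i\<in>{..<d}. (if i < k then m i else 0) + x i) \<in> lborel_d d \<rightarrow>\<^sub>M lborel_d d"
    for k by (rule measurable_restrict) measurable
  note f [measurable]
  have "(\<integral>\<^sup>+x. f x \<partial>lborel_d d) =
      (\<integral>\<^sup>+x. f (\<lambda>i\<in>{..<d}. (if i < k then m i else 0) + x i) \<partial>lborel_d d)" if "k \<le> d" for k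
    using that
  proof (induction k)
    case 0
    show ?case
      by (intro nn_integral_cong arg_cong[of _ _ f])
        (auto simp: space_PiM PiE_def extensional_def fun_eq_iff)
  next
    case (Suc k)
    have "(\<integral>\<^sup>+x. f x \<partial>lborel_d d) =
        (\<integral>\<^sup>+x. f (\<lambda>i\<in>{..<d}. (if i < k then m i else 0) + x i) \<partial>lborel_d d)"
      using Suc.IH Suc.prems by (simp only: Suc_leD)
    also have "\<dots> = ennreal \<bar>1\<bar> * (\<integral>\<^sup>+x. f (\<lambda>i\<in>{..<d}. (if i < k then m i else 0)
        + (x(k := 1 * x k + m k)) i) \<partial>lborel_d d)"
      using Suc.prems
      by (intro nn_integral_PiM_lborel_update_affine[where f = "\<lambda>x. f (\<lambda>i\<in>{..<d}. (if i < k then m i else 0) + x i)"])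
        auto
    also have "\<dots> = (\<integral>\<^sup>+x. f (\<lambda>i\<in>{..<d}. (if i < Suc k then m i else 0) + x i) \<partial>lborel_d d)"
      unfolding abs_one ennreal_1 mult_1
      by (intro nn_integral_cong arg_cong[of _ _ f]) (auto simp: fun_eq_iff)
    finally show ?case .
  qed
  from this[of d] show ?thesis
    by (auto intro!: nn_integral_cong arg_cong[of _ _ f] simp: fun_eq_iff)
qed

definition lin_fun :: "nat \<Rightarrow> real mat \<Rightarrow> (nat \<Rightarrow> real) \<Rightarrow> nat \<Rightarrow> real" where
  "lin_fun d B x = (\<lambda>i\<in>{..<d}. (B *\<^sub>v vec d x) $ i)"

lemma lin_fun_eq_sum:
  assumes "B \<in> carrier_mat d d"
  shows "lin_fun d B x = (\<lambda>i\<in>{..<d}. \<Sum>j<d. B $$ (i, j) * x j)"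
  using assms by (auto simp: lin_fun_def fun_eq_iff scalar_prod_def lessThan_atLeast0)

lemma vec_lin_fun:
  assumes "B \<in> carrier_mat d d"
  shows "vec d (lin_fun d B x) = B *\<^sub>v vec d x"
  using assms by (auto simp: lin_fun_def intro!: eq_vecI)

lemma lin_fun_mult:
  assumes "A \<in> carrier_mat d d" "B \<in> carrier_mat d d"
  shows "lin_fun d (A * B) x = lin_fun d A (lin_fun d B x)"
  using assms unfolding lin_fun_def[of d A "lin_fun d B x"] lin_fun_def[of d "A * B"]
  by (simp add: vec_lin_fun assoc_mult_mat_vec[of _ d d _ d])

lemma measurable_lin_fun [measurable]:
  assumes "B \<in> carrier_mat d d"
  shows "lin_fun d B \<in> lborel_d d \<rightarrow>\<^sub>M lborel_d d"
  unfolding lin_fun_eq_sum[OF assms, abs_def] by measurable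

text \<open>As a predicate on \<open>B\<close>, the substitution rule is closed under products and
  can be assembled from factors that are easy to treat.\<close>

definition transforms_lborel :: "nat \<Rightarrow> real mat \<Rightarrow> bool" where
  "transforms_lborel d B \<longleftrightarrow> (\<forall>f\<in>borel_measurable (lborel_d d).
     (\<integral>\<^sup>+x. f x \<partial>lborel_d d) = \<bar>det B\<bar> * (\<integral>\<^sup>+x. f (lin_fun d B x) \<partial>lborel_d d))"

lemma transforms_lborel_mult:
  assumes A: "A \<in> carrier_mat d d" "transforms_lborel d A"
    and B: "B \<in> carrier_mat d d" "transforms_lborel d B"
  shows "transforms_lborel d (A * B)"
  unfolding transforms_lborel_def
proof
  fix f :: "(nat \<Rightarrow> real) \<Rightarrow> ennreal" assume f [measurable]: "f \<in> borel_measurable (lborel_d d)"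
  have fA: "(\<lambda>x. f (lin_fun d A x)) \<in> borel_measurable (lborel_d d)"
    using measurable_lin_fun[OF A(1)] by measurable
  have "(\<integral>\<^sup>+x. f x \<partial>lborel_d d) = \<bar>det A\<bar> * (\<integral>\<^sup>+x. f (lin_fun d A x) \<partial>lborel_d d)"
    using A(2) f unfolding transforms_lborel_def by blast
  also have "(\<integral>\<^sup>+x. f (lin_fun d A x) \<partial>lborel_d d)
      = \<bar>det B\<bar> * (\<integral>\<^sup>+x. f (lin_fun d A (lin_fun d B x)) \<partial>lborel_d d)"
    using B(2) fA unfolding transforms_lborel_def by (rule bspec)
  finally show "(\<integral>\<^sup>+x. f x \<partial>lborel_d d)
      = \<bar>det (A * B)\<bar> * (\<integral>\<^sup>+x. f (lin_fun d (A * B) x) \<partial>lborel_d d)"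
    using A B by (simp add: lin_fun_mult det_mult abs_mult ennreal_mult mult.assoc)
qed

text \<open>After transposition this is the identity with one column replaced, so Cramer's rule
  gives the determinant.\<close>

lemma det_replace_row_one:
  fixes e :: "nat \<Rightarrow> real"
  assumes k: "k < d"
  shows "det (mat d d (\<lambda>(i, j). if i = k then e j else if i = j then 1 else 0)) = e k"
proof -
  let ?E = "mat d d (\<lambda>(i, j). if i = k then e j else if i = j then 1 else 0)"
  have "transpose_mat ?E = replace_col (1\<^sub>m d) (1\<^sub>m d *\<^sub>v vec d e) k"
    by (rule eq_matI) (auto simp: replace_col_def)
  then have "det (transpose_mat ?E) = vec d e $ k * det (1\<^sub>m d)"
    using cramer_lemma_mat[of "1\<^sub>m d" d "vec d e" k] k by simp
  then show ?thesis
    using k det_transpose[of ?E d] by simp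
qed

text \<open>Only coordinate \<open>k\<close> moves: it is scaled by \<open>e k\<close> and shifted
  by a combination of the others, which is the affine substitution in one coordinate.\<close>

lemma transforms_lborel_replace_row_one:
  fixes e :: "nat \<Rightarrow> real"
  assumes k: "k < d" and e: "e k \<noteq> 0"
  shows "transforms_lborel d (mat d d (\<lambda>(i, j). if i = k then e j else if i = j then 1 else 0))"
    (is "transforms_lborel d ?E")
  unfolding transforms_lborel_def
proof
  fix f :: "(nat \<Rightarrow> real) \<Rightarrow> ennreal" assume f [measurable]: "f \<in> borel_measurable (lborel_d d)"
  let ?h = "\<lambda>x. \<Sum>j\<in>{..<d} - {k}. e j * x j"
  have "lin_fun d ?E x = x(k := e k * x k + ?h x)" if x: "x \<in> space (lborel_d d)" for x
  proof
    fix i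
    have "(\<Sum>j<d. ?E $$ (i, j) * x j) = (x(k := e k * x k + ?h x)) i" if i: "i < d"
    proof (cases "i = k")
      case True
      have "(\<Sum>j<d. ?E $$ (i, j) * x j) = (\<Sum>j<d. e j * x j)"
        using i True by (intro sum.cong) auto
      then show ?thesis
        using True k by (simp add: sum.remove[of "{..<d}" k])
    next
      case False
      have "(\<Sum>j<d. ?E $$ (i, j) * x j) = (\<Sum>j<d. if j = i then x j else 0)"
        using i False by (intro sum.cong) auto
      then show ?thesis
        using i False by simp
    qed
    then show "lin_fun d ?E x i = (x(k := e k * x k + ?h x)) i"
      using x k by (auto simp: lin_fun_eq_sum space_PiM PiE_def extensional_def)
  qed
  moreover have "(\<integral>\<^sup>+x. f x \<partial>lborel_d d)
      = \<bar>e k\<bar> * (\<integral>\<^sup>+x. f (x(k := e k * x k + ?h x)) \<partial>lborel_d d)"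
    using k e by (intro nn_integral_PiM_lborel_update_affine) (auto intro!: sum.cong)
  ultimately show "(\<integral>\<^sup>+x. f x \<partial>lborel_d d)
      = \<bar>det ?E\<bar> * (\<integral>\<^sup>+x. f (lin_fun d ?E x) \<partial>lborel_d d)"
    using det_replace_row_one[OF k, of e] by (simp cong: nn_integral_cong)
qed

lemma ex_inverse_of_injective:
  fixes A :: "real mat"
  assumes A: "A \<in> carrier_mat d d"
    and inj: "\<And>v. v \<in> carrier_vec d \<Longrightarrow> A *\<^sub>v v = 0\<^sub>v d \<Longrightarrow> v = 0\<^sub>v d"
  obtains C where "C \<in> carrier_mat d d" "A * C = 1\<^sub>m d" "C * A = 1\<^sub>m d" "det A \<noteq> 0"
proof -
  have det: "det A \<noteq> 0"
    using inj det_0_iff_vec_prod_zero_field[OF A] by auto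
  from det_non_zero_imp_unit[OF A this, of "()"]
  obtain C where "C \<in> carrier_mat d d" "A * C = 1\<^sub>m d" "C * A = 1\<^sub>m d"
    by (auto simp: Units_def ring_mat_def)
  with det show ?thesis
    by (rule that[rotated 3])
qed

text \<open>The rows of the identity matrix are replaced by those of \<open>B\<close> one at a time; definiteness
  keeps all the intermediate matrices invertible, and each step changes a single coordinate.\<close>

lemma transforms_lborel_definite:
  assumes B: "B \<in> carrier_mat d d"
    and definite: "\<And>v. v \<in> carrier_vec d \<Longrightarrow> v \<bullet> (B *\<^sub>v v) = 0 \<Longrightarrow> v = 0\<^sub>v d"
  shows "transforms_lborel d B"
proof -
  define S where "S k = mat d d (\<lambda>(i, j). if i < k then B $$ (i, j) else if i = j then 1 else 0)" for k
  have S: "S k \<in> carrier_mat d d" for k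
    by (simp add: S_def)
  have [simp]: "dim_row (S k) = d" "dim_col (S k) = d" for k
    by (simp_all add: S_def)
  \<comment> \<open>If \<open>S k\<close> kills \<open>v\<close>, then every product of
    \<open>v $ i\<close> and the entry \<open>i\<close> of \<open>B v\<close> is zero: the second
    factor vanishes for \<open>i < k\<close>, the first for all other \<open>i\<close>. Definiteness
    then applies.\<close>
  have inj: "v = 0\<^sub>v d" if v: "v \<in> carrier_vec d" and Sv: "S k *\<^sub>v v = 0\<^sub>v d" for k v
  proof (rule definite[OF v])
    have "v $ i * (B *\<^sub>v v) $ i = 0" if i: "i < d" for i
    proof -
      have *: "row (S k) i \<bullet> v = 0"
        using arg_cong[OF Sv, of "\<lambda>u. u $ i"] i S[of k] by simp
      show ?thesis
      proof (cases "i < k")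
        case True
        then have "row (S k) i = row B i"
          using i B by (intro eq_vecI) (auto simp: S_def)
        then show ?thesis
          using * B i by simp
      next
        case False
        then have "row (S k) i = unit_vec d i"
          using i by (intro eq_vecI) (auto simp: S_def unit_vec_def)
        then show ?thesis
          using * v i by simp
      qed
    qed
    then show "v \<bullet> (B *\<^sub>v v) = 0"
      using B v by (auto simp: scalar_prod_def[of v] intro!: sum.neutral)
  qed
  have "transforms_lborel d (S k)" if "k \<le> d" for k
    using that
  proof (induction k)
    case 0
    have "S 0 = 1\<^sub>m d"
      by (rule eq_matI) (auto simp: S_def)
    moreover have "lin_fun d (1\<^sub>m d) x = x" if "x \<in> space (lborel_d d)" for x
      using that by (auto simp: lin_fun_def space_PiM PiE_def extensional_def fun_eq_iff)
    ultimately show ?case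
      by (auto simp: transforms_lborel_def cong: nn_integral_cong)
  next
    case (Suc k)
    then have k: "k < d"
      by simp
    obtain C where C: "C \<in> carrier_mat d d" "S k * C = 1\<^sub>m d" "C * S k = 1\<^sub>m d"
      by (rule ex_inverse_of_injective[OF S inj, of k])
    have det: "det (S (Suc k)) \<noteq> 0"
      by (rule ex_inverse_of_injective[OF S inj, of "Suc k"])
    \<comment> \<open>\<open>E\<close> is \<open>S (Suc k)\<close> times the inverse of
      \<open>S k\<close>. The two matrices share all rows except row \<open>k\<close>, so
      \<open>E\<close> agrees with the identity outside row \<open>k\<close>.\<close>
    define E where "E = S (Suc k) * C"
    have E: "E \<in> carrier_mat d d"
      unfolding E_def by (rule mult_carrier_mat[OF S C(1)])
    have ES: "E * S k = S (Suc k)"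
      using C right_mult_one_mat[OF S] by (simp add: E_def assoc_mult_mat[OF S C(1) S])
    have "row E i = unit_vec d i" if "i < d" "i \<noteq> k" for i
    proof -
      have "row (S (Suc k)) i = row (S k) i"
        using that by (intro eq_vecI) (auto simp: S_def)
      moreover have "row E i = vec d (\<lambda>j. row (S (Suc k)) i \<bullet> col C j)"
        using C S that by (auto simp: E_def intro!: eq_vecI)
      moreover have "row (S k * C) i = vec d (\<lambda>j. row (S k) i \<bullet> col C j)"
        using C(1) S[of k] that by (intro eq_vecI) auto
      ultimately show ?thesis
        using C that by simp
    qed
    then have "E $$ (i, j) = (if i = j then 1 else 0)" if "i < d" "i \<noteq> k" "j < d" for i j
      using that E index_row(1)[of i E j] by (auto simp: unit_vec_def)
    then have E_eq: "E = mat d d (\<lambda>(i, j). if i = k then E $$ (k, j) else if i = j then 1 else 0)"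
      using E by (intro eq_matI) auto
    have "det E \<noteq> 0"
      using det E S[of k] unfolding ES[symmetric] by (simp add: det_mult)
    then have "E $$ (k, k) \<noteq> 0"
      using det_replace_row_one[OF k, of "\<lambda>j. E $$ (k, j)"] E_eq by simp
    then have "transforms_lborel d E"
      using transforms_lborel_replace_row_one[OF k, of "\<lambda>j. E $$ (k, j)"] E_eq by simp
    then show ?case
      using transforms_lborel_mult[OF E _ S Suc.IH] k by (simp add: ES)
  qed
  moreover have "S d = B"
    using B by (intro eq_matI) (auto simp: S_def)
  ultimately show ?thesis
    by fastforce
qed

section \<open>Perturbation of a standard Gaussian\<close>

text \<open>The normalization is that of \<open>b = 1\<close>, the standard normal density, for
  every \<open>b\<close>. Kernels with different \<open>b\<close> then differ pointwise by an
  exponential only, and the total mass is \<open>b\<close> to the power \<open>-d/2\<close>.\<close>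

definition gauss_kernel :: "nat \<Rightarrow> real \<Rightarrow> (nat \<Rightarrow> real) \<Rightarrow> real" where
  "gauss_kernel d b x = exp (- b * (\<Sum>i<d. (x i)\<^sup>2) / 2) / sqrt (2 * pi) ^ d"

lemma gauss_kernel_nonneg: "gauss_kernel d b x \<ge> 0"
  by (simp add: gauss_kernel_def)

lemma measurable_gauss_kernel [measurable]: "gauss_kernel d b \<in> borel_measurable (lborel_d d)"
  unfolding gauss_kernel_def by measurable

lemma nn_integral_gauss_1:
  fixes b :: real
  assumes b: "b > 0"
  shows "(\<integral>\<^sup>+x. ennreal (exp (- b * x\<^sup>2 / 2) / sqrt (2 * pi)) \<partial>lborel) = ennreal (1 / sqrt b)"
proof -
  have s: "1 / sqrt b > 0"
    using b by simp
  interpret prob_space "density lborel (normal_density 0 (1 / sqrt b))"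
    using s by (rule prob_space_normal_density)
  have "exp (- b * x\<^sup>2 / 2) / sqrt (2 * pi) = 1 / sqrt b * normal_density 0 (1 / sqrt b) x" for x
    using b by (simp add: normal_density_def real_sqrt_mult real_sqrt_divide power_divide field_simps)
  then have "(\<integral>\<^sup>+x. ennreal (exp (- b * x\<^sup>2 / 2) / sqrt (2 * pi)) \<partial>lborel)
      = ennreal (1 / sqrt b) * (\<integral>\<^sup>+x. ennreal (normal_density 0 (1 / sqrt b) x) \<partial>lborel)"
    using b by (subst nn_integral_cmult[symmetric]) (auto simp: ennreal_mult'[symmetric] s)
  moreover have "(\<integral>\<^sup>+x. ennreal (normal_density 0 (1 / sqrt b) x) \<partial>lborel) = 1"
    using emeasure_space_1 by (simp add: emeasure_density)
  ultimately show ?thesis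
    by simp
qed

lemma nn_integral_gauss_kernel:
  assumes b: "b > 0"
  shows "(\<integral>\<^sup>+x. ennreal (gauss_kernel d b x) \<partial>lborel_d d) = ennreal ((1 / sqrt b) ^ d)"
proof -
  interpret product_sigma_finite "\<lambda>_::nat. lborel :: real measure"
    by standard
  have "gauss_kernel d b x = (\<Prod>i<d. exp (- b * (x i)\<^sup>2 / 2) / sqrt (2 * pi))" for x
    by (simp add: gauss_kernel_def prod_dividef exp_sum sum_distrib_left sum_divide_distrib sum_negf[symmetric]
        flip: exp_sum)
  then have "(\<integral>\<^sup>+x. ennreal (gauss_kernel d b x) \<partial>lborel_d d)
      = (\<integral>\<^sup>+x. (\<Prod>i<d. ennreal (exp (- b * (x i)\<^sup>2 / 2) / sqrt (2 * pi))) \<partial>lborel_d d)"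
    by (simp add: prod_ennreal)
  also have "\<dots> = (\<Prod>i<d. \<integral>\<^sup>+x. ennreal (exp (- b * x\<^sup>2 / 2) / sqrt (2 * pi)) \<partial>lborel)"
    by (rule product_nn_integral_prod) auto
  finally show ?thesis
    using nn_integral_gauss_1[OF b] b by (simp add: ennreal_power)
qed

text \<open>The scale \<open>4 d\<close> fits the typical size \<open>d\<close> of the squared norm.
  The product is the kernel with \<open>b = 1 - 1/(2d)\<close>, and Bernoulli's inequality keeps the
  \<open>d\<close>-th power of \<open>b\<close> above 1/2, so the bound is the same in all
  dimensions.\<close>

lemma nn_integral_gauss_exp_moment:
  assumes d: "d \<ge> 1"
  shows "(\<integral>\<^sup>+x. ennreal (gauss_kernel d 1 x * exp ((\<Sum>i<d. (x i)\<^sup>2) / (4 * real d))) \<partial>lborel_d d) \<le> 2"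
proof -
  define b where "b = 1 - 1 / (2 * real d)"
  have b: "b > 0"
    using d by (simp add: b_def field_simps)
  have "gauss_kernel d 1 x * exp ((\<Sum>i<d. (x i)\<^sup>2) / (4 * real d)) = gauss_kernel d b x" for x
  proof -
    have "- 1 * (\<Sum>i<d. (x i)\<^sup>2) / 2 + (\<Sum>i<d. (x i)\<^sup>2) / (4 * real d) = - b * (\<Sum>i<d. (x i)\<^sup>2) / 2"
      using d by (simp add: b_def field_simps)
    then show ?thesis
      by (simp add: gauss_kernel_def flip: exp_add)
  qed
  moreover have "(1 / sqrt b) ^ d \<le> 2"
  proof -
    have "b ^ d \<ge> 1 + real d * (- 1 / (2 * real d))"
      using Bernoulli_inequality[of "- 1 / (2 * real d)" d] d by (simp add: b_def field_simps)
    then have "b ^ d \<ge> (1 / 2)\<^sup>2"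
      using d by (simp add: power2_eq_square)
    then have "sqrt (b ^ d) \<ge> 1 / 2"
      by (rule real_le_rsqrt)
    then show ?thesis
      using b by (simp add: power_divide real_sqrt_power field_simps)
  qed
  ultimately show ?thesis
    using nn_integral_gauss_kernel[OF b, of d] by (simp add: ennreal_le_iff2 flip: ennreal_numeral)
qed

section \<open>Pointwise estimates for the perturbed density\<close>

lemma abs_exp_minus_one_le: "\<bar>exp r - 1\<bar> \<le> \<bar>r\<bar> * exp \<bar>r\<bar>" for r :: real
proof (cases "r \<ge> 0")
  case True
  have "(1 - r) * exp r \<le> exp (- r) * exp r"
    using exp_ge_add_one_self[of "- r"] by (intro mult_right_mono) auto
  then have "exp r - 1 \<le> r * exp r"
    by (simp add: algebra_simps flip: exp_add)
  then show ?thesis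
    using True by simp
next
  case False
  have "1 - exp r \<le> \<bar>r\<bar> * 1"
    using exp_ge_add_one_self[of r] False by linarith
  also have "\<dots> \<le> \<bar>r\<bar> * exp \<bar>r\<bar>"
    by (intro mult_left_mono) auto
  finally show ?thesis
    using False by simp
qed

text \<open>Trades polynomial growth for a factor \<open>d\<close> and a mild exponential. The rate
  \<open>1/(16d)\<close> is chosen so that the square of the bound costs \<open>1/(8d)\<close> and
  leaves another \<open>1/(8d)\<close> before the limit \<open>1/(4d)\<close> of the exponential
  moment is reached. The constant 32 is 2 times 16.\<close>

lemma one_plus_square_sum_le:
  fixes d M X H :: real
  assumes d: "d \<ge> 1" and H: "H\<^sup>2 \<le> M * d"
  shows "1 + (X + H)\<^sup>2 \<le> d * ((32 + 2 * M) * exp (X\<^sup>2 / (16 * d)))"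
proof -
  have M: "M \<ge> 0"
    using H d by (smt (verit) mult_neg_pos zero_le_power2)
  have "(X + H)\<^sup>2 \<le> 2 * X\<^sup>2 + 2 * H\<^sup>2"
    using sum_squares_bound[of X H] by (simp add: power2_sum)
  also have "\<dots> \<le> 2 * X\<^sup>2 + 2 * (M * d)"
    using H by simp
  finally have "1 + (X + H)\<^sup>2 \<le> d * (1 + 2 * M + 2 * (X\<^sup>2 / d))"
    using d by (simp add: algebra_simps)
  also have "1 + 2 * M + 2 * (X\<^sup>2 / d) \<le> (32 + 2 * M) * (1 + X\<^sup>2 / (16 * d))"
  proof -
    have "(32 + 2 * M) * (1 + X\<^sup>2 / (16 * d)) = 32 + 2 * M + 2 * (X\<^sup>2 / d) + M * (X\<^sup>2 / (8 * d))"
      using d by (simp add: field_simps)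
    moreover have "M * (X\<^sup>2 / (8 * d)) \<ge> 0"
      using M d by simp
    ultimately show ?thesis
      by linarith
  qed
  also have "\<dots> \<le> (32 + 2 * M) * exp (X\<^sup>2 / (16 * d))"
    using M by (intro mult_left_mono) auto
  finally show ?thesis
    using d by simp
qed

lemma linear_growth_le:
  fixes d M X H Z :: real
  assumes d: "d \<ge> 1" and H: "H\<^sup>2 \<le> M * d" and XH: "X \<ge> 0" "H \<ge> 0" and Z: "Z \<le> X + H"
  shows "Z \<le> d * ((32 + 2 * M) * exp (X\<^sup>2 / (4 * d)))"
proof -
  have M: "M \<ge> 0"
    using H d by (smt (verit) mult_neg_pos zero_le_power2)
  have "Z \<le> 1 + (X + H)\<^sup>2"
    using Z XH sum_squares_bound[of 1 "X + H"] by auto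
  also have "\<dots> \<le> d * ((32 + 2 * M) * exp (X\<^sup>2 / (16 * d)))"
    by (rule one_plus_square_sum_le[OF d H])
  also have "\<dots> \<le> d * ((32 + 2 * M) * exp (X\<^sup>2 / (4 * d)))"
    using d M by (intro mult_left_mono) (auto simp: field_simps)
  finally show ?thesis .
qed

text \<open>Here \<open>X\<close>, \<open>H\<close>, \<open>Z\<close> are the norms of \<zeta>,
  \<eta> and their sum, \<omega> bounds the displacement coordinatewise, \<rho> is the linearization
  error, \<open>L\<close> the change of the log-likelihood and \<open>P\<close> that of the
  log-prior. Two bounds on \<open>L + P\<close> are combined: one without the small factor
  \<open>a\<close> that may be exponentiated, and one that carries \<open>a\<close> and serves as
  the linear factor.\<close>

lemma bulk_bound:
  fixes d a M C X H Z \<rho> \<omega> L P :: real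
  assumes d: "d \<ge> 1" and H: "H\<^sup>2 \<le> M * d" and nonneg: "X \<ge> 0" "H \<ge> 0" "Z \<ge> 0" "a \<ge> 0" "C \<ge> 0"
    and Z: "Z \<le> X + H"
    and L: "\<bar>L\<bar> \<le> X * \<rho> + \<rho>\<^sup>2 / 2"
    and \<rho>: "0 \<le> \<rho>" "\<rho> \<le> \<omega> * Z"
    and \<omega>: "0 \<le> \<omega>" "\<omega> \<le> a * Z"
    and P: "\<bar>P\<bar> \<le> C * d * \<omega>"
    and bulk: "20 * d * (a * Z) \<le> 1"
  shows "\<bar>exp (L + P) - 1\<bar> \<le>
    a * d\<^sup>2 * ((2 + C) * (32 + 2 * M)\<^sup>2 * exp (M / 10 + C / 20)) * exp (X\<^sup>2 / (4 * d))"
proof -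
  have M: "M \<ge> 0"
    using H d by (smt (verit) mult_neg_pos zero_le_power2)
  have aZ: "a * Z \<le> 1 / (20 * d)" "0 \<le> a * Z"
    using bulk d nonneg by (simp_all add: field_simps)
  then have aZ1: "a * Z \<le> 1"
    using d by (smt (verit) divide_le_eq_1)
  have \<rho>1: "\<rho> \<le> a * Z * Z"
    using \<rho>(2) mult_right_mono[OF \<omega>(2) nonneg(3)] by linarith
  then have \<rho>2: "\<rho> \<le> Z / (20 * d)"
    using mult_right_mono[OF aZ(1) nonneg(3)] by simp
  have \<rho>3: "\<rho> \<le> Z"
    using \<rho>1 mult_right_mono[OF aZ1 nonneg(3)] by simp
  have Z2: "Z\<^sup>2 \<le> 2 * X\<^sup>2 + 2 * H\<^sup>2"
    using power_mono[OF Z nonneg(3), of 2] sum_squares_bound[of X H] by (simp add: power2_sum)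
  have "X * \<rho> \<le> X * (Z / (20 * d))"
    using \<rho>2 nonneg by (intro mult_left_mono)
  also have "\<dots> \<le> (X\<^sup>2 + Z\<^sup>2) / (40 * d)"
    using sum_squares_bound[of X Z] d by (simp add: field_simps)
  finally have 1: "X * \<rho> \<le> (X\<^sup>2 + Z\<^sup>2) / (40 * d)" .
  have "\<rho>\<^sup>2 \<le> Z * (Z / (20 * d))"
    unfolding power2_eq_square using \<rho>2 \<rho>3 \<rho>(1) nonneg by (intro mult_mono)
  then have 2: "\<rho>\<^sup>2 / 2 \<le> Z\<^sup>2 / (40 * d)"
    by (simp add: power2_eq_square)
  \<comment> \<open>The constant 20 in \<open>bulk\<close> is tuned to this point: the coefficient
    of the square of \<open>X\<close> becomes 5/40, that is 1/8, half of the permitted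
    exponent.\<close>
  have "X\<^sup>2 + 2 * Z\<^sup>2 \<le> 5 * X\<^sup>2 + 4 * (M * d)"
    using Z2 H by linarith
  then have "(X\<^sup>2 + 2 * Z\<^sup>2) / (40 * d) \<le> (5 * X\<^sup>2 + 4 * (M * d)) / (40 * d)"
    using d by (intro divide_right_mono) auto
  also have "\<dots> = X\<^sup>2 / (8 * d) + M / 10"
    using d by (simp add: field_simps)
  finally have L1: "\<bar>L\<bar> \<le> X\<^sup>2 / (8 * d) + M / 10"
    using L 1 2 by (simp add: add_divide_distrib)
  have P1: "\<bar>P\<bar> \<le> C * d * (a * Z)"
    using P mult_left_mono[OF \<omega>(2), of "C * d"] nonneg d by simp
  also have "\<dots> \<le> C * d * (1 / (20 * d))"
    using aZ nonneg d by (intro mult_left_mono) auto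
  finally have P2: "\<bar>P\<bar> \<le> C / 20"
    using d by simp
  have r1: "\<bar>L + P\<bar> \<le> X\<^sup>2 / (8 * d) + (M / 10 + C / 20)"
    using L1 P2 by linarith

  \<comment> \<open>For the bound that is linear in \<open>a\<close>, one quantity of order
    \<open>d\<close> dominates \<open>X\<close>, \<open>Z\<close> and the square of
    \<open>Z\<close>, so both terms of \<open>L\<close> are at most \<open>a\<close> times its
    square.\<close>
  define y where "y = 1 + (X + H)\<^sup>2"
  have y: "X + H \<le> y" "1 \<le> y" "(X + H)\<^sup>2 \<le> y"
    using sum_squares_bound[of 1 "X + H"] nonneg by (auto simp: y_def)
  have Zy: "Z \<le> y" "Z\<^sup>2 \<le> y"
    using y Z power_mono[OF Z nonneg(3), of 2] by linarith+
  have y_le: "y \<le> d * ((32 + 2 * M) * exp (X\<^sup>2 / (16 * d)))"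
    unfolding y_def by (rule one_plus_square_sum_le[OF d H])
  have "X * \<rho> \<le> y * (a * Z * Z)"
    using \<rho>1 \<rho> y nonneg by (intro mult_mono) auto
  also have "\<dots> = a * (y * Z\<^sup>2)"
    by (simp add: power2_eq_square)
  also have "\<dots> \<le> a * (y * y)"
    using Zy y nonneg by (intro mult_left_mono) auto
  finally have 3: "X * \<rho> \<le> a * (y * y)" .
  have "\<rho>\<^sup>2 \<le> Z * (a * Z * Z)"
    unfolding power2_eq_square using \<rho>1 \<rho>3 \<rho>(1) nonneg by (intro mult_mono)
  also have "\<dots> = a * (Z * Z\<^sup>2)"
    by (simp add: power2_eq_square)
  also have "\<dots> \<le> a * (y * y)"
    using Zy y nonneg by (intro mult_left_mono mult_mono) auto
  finally have 4: "\<rho>\<^sup>2 \<le> a * (y * y)" .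
  have "\<bar>L + P\<bar> \<le> a * (y * y) + a * (y * y) + C * d * (a * Z)"
    using L P1 3 4 by (smt (verit) field_sum_of_halves zero_le_power2)
  also have "\<dots> = a * (2 * (y * y) + C * (d * Z))"
    by (simp add: algebra_simps)
  also have "\<dots> \<le> a * ((2 + C) * (d * ((32 + 2 * M) * exp (X\<^sup>2 / (16 * d))))\<^sup>2)"
  proof (intro mult_left_mono nonneg)
    let ?R = "d * ((32 + 2 * M) * exp (X\<^sup>2 / (16 * d)))"
    have R0: "0 \<le> ?R"
      using y_le y by linarith
    have "y * y \<le> ?R * ?R"
      using y_le y R0 by (intro mult_mono) auto
    then have "y * y \<le> ?R\<^sup>2"
      by (simp only: power2_eq_square)
    moreover have "d \<le> ?R"
    proof -
      have "1 * 1 \<le> (32 + 2 * M) * exp (X\<^sup>2 / (16 * d))"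
        using M d by (intro mult_mono) auto
      then show ?thesis
        using d by simp
    qed
    then have "d * Z \<le> ?R * ?R"
      using order_trans[OF Zy(1) y_le] R0 nonneg by (intro mult_mono) auto
    then have "C * (d * Z) \<le> C * ?R\<^sup>2"
      unfolding power2_eq_square[of ?R] using nonneg by (intro mult_left_mono) auto
    ultimately show "2 * (y * y) + C * (d * Z) \<le> (2 + C) * ?R\<^sup>2"
      by (simp add: distrib_right)
  qed
  also have "\<dots> = a * d\<^sup>2 * ((2 + C) * (32 + 2 * M)\<^sup>2) * exp (X\<^sup>2 / (8 * d))"
  proof -
    have "(exp (X\<^sup>2 / (16 * d)))\<^sup>2 = exp (X\<^sup>2 / (8 * d))"
      by (simp flip: exp_double)
    then show ?thesis
      by (simp only: power_mult_distrib) (simp only: ac_simps)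
  qed
  finally have r2: "\<bar>L + P\<bar> \<le> a * d\<^sup>2 * ((2 + C) * (32 + 2 * M)\<^sup>2) * exp (X\<^sup>2 / (8 * d))" .
  have "\<bar>exp (L + P) - 1\<bar> \<le> \<bar>L + P\<bar> * exp \<bar>L + P\<bar>"
    by (rule abs_exp_minus_one_le)
  also have "\<dots> \<le> (a * d\<^sup>2 * ((2 + C) * (32 + 2 * M)\<^sup>2) * exp (X\<^sup>2 / (8 * d)))
      * exp (X\<^sup>2 / (8 * d) + (M / 10 + C / 20))"
    using r1 r2 by (intro mult_mono) auto
  also have "\<dots> = a * d\<^sup>2 * ((2 + C) * (32 + 2 * M)\<^sup>2 * exp (M / 10 + C / 20)) * exp (X\<^sup>2 / (4 * d))"
  proof -
    have "exp (X\<^sup>2 / (8 * d)) * exp (X\<^sup>2 / (8 * d)) = exp (X\<^sup>2 / (4 * d))"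
      using d by (simp add: field_simps flip: exp_add)
    then have "a * d\<^sup>2 * ((2 + C) * (32 + 2 * M)\<^sup>2) * (exp (X\<^sup>2 / (8 * d)) * exp (X\<^sup>2 / (8 * d))) * exp (M / 10 + C / 20)
        = a * d\<^sup>2 * ((2 + C) * (32 + 2 * M)\<^sup>2) * exp (X\<^sup>2 / (4 * d)) * exp (M / 10 + C / 20)"
      by simp
    then show ?thesis
      unfolding exp_add[of "X\<^sup>2 / (8 * d)"] by (simp only: ac_simps)
  qed
  finally show ?thesis .
qed

text \<open>Up to the noise, \<open>Z\<close> is at most \<open>K D\<close>, so the exponent
  contains the square of \<open>Z\<close> over \<open>4 K^2\<close> with a negative sign. One half
  of it yields Gaussian decay in \<open>X\<close>; the other half, because \<open>Z\<close> is large
  here, yields a term quadratic in \<open>d\<close> that outweighs the linear one.\<close>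

lemma far_bound:
  fixes d a M C K X H Z D Xi P :: real
  assumes d: "d \<ge> 1" and H: "H\<^sup>2 \<le> M * d" and nonneg: "X \<ge> 0" "H \<ge> 0" "Z \<ge> 0" "D \<ge> 0" "Xi \<ge> 0"
    and K: "K \<ge> 1" and a: "a > 0"
    and X: "X \<le> Z + H"
    and ZK: "Z \<le> K * Xi" and Xi: "Xi \<le> D + H"
    and P: "P \<le> C * d"
    and far: "20 * d * (a * Z) \<ge> 1"
  shows "- D\<^sup>2 / 2 + P \<le> - (1 / (8 * K\<^sup>2)) * X\<^sup>2 / 2 + ((M + C) * d - d\<^sup>2 / (3200 * K\<^sup>2 * (a * d\<^sup>2)\<^sup>2))"
proof -
  have M: "M * d \<ge> 0"
    using H by (smt (verit) zero_le_power2)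
  have "Z\<^sup>2 \<le> (K * (D + H))\<^sup>2"
    using order_trans[OF ZK mult_left_mono[OF Xi, of K]] K nonneg by (intro power_mono) auto
  also have "\<dots> = K\<^sup>2 * (D + H)\<^sup>2"
    by (simp add: power_mult_distrib)
  also have "\<dots> \<le> K\<^sup>2 * (2 * D\<^sup>2 + 2 * H\<^sup>2)"
    using sum_squares_bound[of D H] by (intro mult_left_mono) (auto simp: power2_sum)
  finally have 1: "Z\<^sup>2 / (4 * K\<^sup>2) \<le> D\<^sup>2 / 2 + H\<^sup>2 / 2"
    using K by (simp add: field_simps)
  have "X\<^sup>2 \<le> (Z + H)\<^sup>2"
    using X nonneg by (intro power_mono) auto
  also have "\<dots> \<le> 2 * Z\<^sup>2 + 2 * H\<^sup>2"
    using sum_squares_bound[of Z H] by (auto simp: power2_sum)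
  finally have "X\<^sup>2 / (16 * K\<^sup>2) \<le> (2 * Z\<^sup>2 + 2 * H\<^sup>2) / (16 * K\<^sup>2)"
    by (intro divide_right_mono) auto
  also have "\<dots> = Z\<^sup>2 / (8 * K\<^sup>2) + H\<^sup>2 / (8 * K\<^sup>2)"
    using K by (simp add: field_simps)
  also have "H\<^sup>2 / (8 * K\<^sup>2) \<le> H\<^sup>2 / (8 * 1)"
    using K by (intro divide_left_mono) auto
  finally have 2: "X\<^sup>2 / (16 * K\<^sup>2) \<le> Z\<^sup>2 / (8 * K\<^sup>2) + H\<^sup>2 / 8"
    by simp
  \<comment> \<open>With \<open>e = a d^2\<close> the assumption \<open>far\<close> reads
    \<open>Z >= d/(20 e)\<close>. Squaring and dividing by \<open>8 K^2\<close> produces the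
    constant 3200 = 8 * 400.\<close>
  have "1\<^sup>2 \<le> (20 * d * (a * Z))\<^sup>2"
    using far by (intro power_mono) auto
  then have "d\<^sup>2 / (3200 * K\<^sup>2 * (a * d\<^sup>2)\<^sup>2) \<le> d\<^sup>2 / (3200 * K\<^sup>2 * (a * d\<^sup>2)\<^sup>2) * (20 * d * (a * Z))\<^sup>2"
    using mult_left_mono[of 1 "(20 * d * (a * Z))\<^sup>2" "d\<^sup>2 / (3200 * K\<^sup>2 * (a * d\<^sup>2)\<^sup>2)"] by simp
  also have "\<dots> = Z\<^sup>2 / (8 * K\<^sup>2)"
    using d a K by (simp add: power_mult_distrib power2_eq_square field_simps)
  finally have 3: "d\<^sup>2 / (3200 * K\<^sup>2 * (a * d\<^sup>2)\<^sup>2) \<le> Z\<^sup>2 / (8 * K\<^sup>2)" .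
  have "Z\<^sup>2 / (4 * K\<^sup>2) = Z\<^sup>2 / (8 * K\<^sup>2) + Z\<^sup>2 / (8 * K\<^sup>2)"
    by simp
  then have "- D\<^sup>2 / 2 + P \<le> - (X\<^sup>2 / (16 * K\<^sup>2)) + H\<^sup>2 / 2 + H\<^sup>2 / 8 + C * d
      - d\<^sup>2 / (3200 * K\<^sup>2 * (a * d\<^sup>2)\<^sup>2)"
    using 1 2 3 P by linarith
  also have "\<dots> \<le> - (X\<^sup>2 / (16 * K\<^sup>2)) + M * d + C * d - d\<^sup>2 / (3200 * K\<^sup>2 * (a * d\<^sup>2)\<^sup>2)"
    using H M by linarith
  also have "\<dots> = - (1 / (8 * K\<^sup>2)) * X\<^sup>2 / 2 + ((M + C) * d - d\<^sup>2 / (3200 * K\<^sup>2 * (a * d\<^sup>2)\<^sup>2))"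
    by (simp add: algebra_simps)
  finally show ?thesis .
qed

lemma L2_set_power2: "(L2_set v A)\<^sup>2 = (\<Sum>i\<in>A. (v i)\<^sup>2)"
  by (simp add: L2_set_def sum_nonneg)

lemma L2_set_uminus: "L2_set (\<lambda>i. - v i) A = L2_set v A"
  by (simp add: L2_set_def)

lemma L2_set_diff_commute: "L2_set (\<lambda>i. u i - v i) A = L2_set (\<lambda>i. v i - u i) A"
  by (simp add: L2_set_def power2_commute)

lemma L2_set_le_add_diff: "L2_set u A \<le> L2_set v A + L2_set (\<lambda>i. u i - v i) A"
  using L2_set_triangle_ineq[of v "\<lambda>i. u i - v i" A] by simp

text \<open>The split is at \<open>20 d a Z = 1\<close>. Below it the ratio of the two densities is
  close to 1. Above it they are not compared at all: each is small for its own reason, which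
  accounts for the second summand of the constant and for the wide kernel.\<close>

lemma gauss_perturbation_inside:
  fixes \<eta> \<zeta> \<xi> :: "nat \<Rightarrow> real" and a M C K W P \<omega> :: real and d :: nat
  defines "z \<equiv> \<lambda>i. \<eta> i + \<zeta> i"
  defines "e \<equiv> a * (real d)\<^sup>2"
  defines "num \<equiv> exp (- (L2_set (\<lambda>i. \<eta> i - \<xi> i) {..<d})\<^sup>2 / 2 + P) / sqrt (2 * pi) ^ d"
  assumes d: "d \<ge> 1" and a: "a > 0" and K: "K \<ge> 1" and C: "C \<ge> 0"
    and \<eta>: "(L2_set \<eta> {..<d})\<^sup>2 \<le> M * real d"
    and \<xi>: "L2_set (\<lambda>i. \<xi> i - z i) {..<d} \<le> \<omega> * L2_set z {..<d}"
    and \<xi>K: "L2_set z {..<d} \<le> K * L2_set \<xi> {..<d}"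
    and \<omega>: "0 \<le> \<omega>" "\<omega> \<le> a * L2_set z {..<d}" "\<omega> \<le> W"
    and P: "\<bar>P\<bar> \<le> C * real d * \<omega>"
  shows "\<bar>num - gauss_kernel d 1 \<zeta>\<bar> \<le>
      e * ((2 + C) * (32 + 2 * M)\<^sup>2 * exp (M / 10 + C / 20) + 20 * (32 + 2 * M))
        * (gauss_kernel d 1 \<zeta> * exp ((\<Sum>i<d. (\<zeta> i)\<^sup>2) / (4 * real d)))
      + exp ((M + C * W) * real d - (real d)\<^sup>2 / (3200 * K\<^sup>2 * e\<^sup>2)) * gauss_kernel d (1 / (8 * K\<^sup>2)) \<zeta>"
proof -
  define X H Z \<rho> D where
    "X = L2_set \<zeta> {..<d}" and "H = L2_set \<eta> {..<d}" and "Z = L2_set z {..<d}"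
    and "\<rho> = L2_set (\<lambda>i. \<xi> i - z i) {..<d}" and "D = L2_set (\<lambda>i. \<eta> i - \<xi> i) {..<d}"
  note defs = X_def H_def Z_def \<rho>_def D_def
  have d1: "real d \<ge> 1"
    using d by simp
  have H: "H\<^sup>2 \<le> M * real d"
    using \<eta> by (simp add: H_def)
  have M: "M \<ge> 0"
    using H d1 by (smt (verit) mult_neg_pos zero_le_power2)
  have nonneg: "X \<ge> 0" "H \<ge> 0" "Z \<ge> 0" "\<rho> \<ge> 0" "D \<ge> 0" "L2_set \<xi> {..<d} \<ge> 0"
    by (simp_all add: defs)
  have Z: "Z \<le> X + H"
    unfolding defs z_def using L2_set_triangle_ineq[of \<eta> \<zeta>] by (simp add: add.commute)
  have X: "X \<le> Z + H"
    unfolding defs using L2_set_le_add_diff[of \<zeta> "{..<d}" z] by (simp add: z_def L2_set_uminus)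
  have Xi: "L2_set \<xi> {..<d} \<le> D + H"
    unfolding defs using L2_set_le_add_diff[of \<xi> "{..<d}" \<eta>] L2_set_diff_commute[of \<xi> \<eta>]
    by (simp add: add.commute)
  have X2: "X\<^sup>2 = (\<Sum>i<d. (\<zeta> i)\<^sup>2)"
    by (simp add: X_def L2_set_power2)
  define A where "A = (2 + C) * (32 + 2 * M)\<^sup>2 * exp (M / 10 + C / 20)"
  define B where "B = 20 * (32 + 2 * M)"
  define g where "g = gauss_kernel d 1 \<zeta>"
  define E where "E = exp (X\<^sup>2 / (4 * real d))"
  define F where "F = exp ((M + C * W) * real d - (real d)\<^sup>2 / (3200 * K\<^sup>2 * e\<^sup>2)) * gauss_kernel d (1 / (8 * K\<^sup>2)) \<zeta>"
  have AB: "A \<ge> 0" "B \<ge> 0" "e \<ge> 0" "g \<ge> 0" "E \<ge> 0" "F \<ge> 0"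
    using M C a by (simp_all add: A_def B_def e_def g_def E_def F_def gauss_kernel_nonneg)
  have "\<bar>num - g\<bar> \<le> e * (A + B) * (g * E) + F"
  proof (cases "20 * real d * (a * Z) \<le> 1")
    case True
    define L where "L = X\<^sup>2 / 2 - D\<^sup>2 / 2"
    have "num = g * exp (L + P)"
      by (simp add: num_def g_def gauss_kernel_def L_def X2 D_def flip: exp_add)
    then have "num - g = g * (exp (L + P) - 1)"
      by (simp add: algebra_simps)
    then have "\<bar>num - g\<bar> = g * \<bar>exp (L + P) - 1\<bar>"
      using AB by (simp add: abs_mult)
    also have "\<bar>exp (L + P) - 1\<bar> \<le> a * (real d)\<^sup>2 * A * exp (X\<^sup>2 / (4 * real d))"
      unfolding A_def
    proof (rule bulk_bound[OF d1 H])
      \<comment> \<open>Up to sign, \<open>\<eta> - \<xi>\<close> is \<zeta> plus the error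
        \<open>\<xi> - z\<close>. Expanding the square cancels the square of \<open>X\<close>,
        leaving a cross term for Cauchy-Schwarz and the square of \<rho>.\<close>
      have "L = - (\<Sum>i<d. \<zeta> i * (\<xi> i - z i)) - \<rho>\<^sup>2 / 2"
      proof -
        have "D\<^sup>2 = (\<Sum>i<d. (\<zeta> i)\<^sup>2 + 2 * (\<zeta> i * (\<xi> i - z i)) + (\<xi> i - z i)\<^sup>2)"
          unfolding D_def L2_set_power2
          by (intro sum.cong refl) (simp add: z_def power2_eq_square algebra_simps)
        then have "D\<^sup>2 = X\<^sup>2 + 2 * (\<Sum>i<d. \<zeta> i * (\<xi> i - z i)) + \<rho>\<^sup>2"
          by (simp add: sum.distrib sum_distrib_left X2 \<rho>_def L2_set_power2)
        then show ?thesis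
          unfolding L_def by linarith
      qed
      moreover have "\<bar>\<Sum>i<d. \<zeta> i * (\<xi> i - z i)\<bar> \<le> X * \<rho>"
        unfolding defs using L2_set_mult_ineq[of \<zeta> "\<lambda>i. \<xi> i - z i" "{..<d}"]
        by (intro order_trans[OF sum_abs]) (simp add: abs_mult)
      ultimately show "\<bar>L\<bar> \<le> X * \<rho> + \<rho>\<^sup>2 / 2"
        using zero_le_power2[of \<rho>] by linarith
    qed (use nonneg Z \<xi> \<omega> P True a C in \<open>auto simp: Z_def \<rho>_def\<close>)
    finally have "\<bar>num - g\<bar> \<le> g * (e * A * E)"
      using AB by (simp add: e_def E_def mult_left_mono)
    also have "\<dots> \<le> e * (A + B) * (g * E) + F"
      using AB by (simp add: algebra_simps)
    finally show ?thesis .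
  next
    case False
    \<comment> \<open>Far out, \<open>20 d a Z\<close> is at least 1 and may be inserted as a
      factor: it brings in the small \<open>a\<close>, and its growth in \<zeta> is paid for by the
      exponential moment.\<close>
    have "g * 1 \<le> g * (20 * real d * (a * Z))"
      using False AB by (intro mult_left_mono) auto
    also have "\<dots> \<le> g * (20 * real d * (a * (real d * ((32 + 2 * M) * E))))"
      unfolding E_def using AB a linear_growth_le[OF d1 H nonneg(1,2) Z]
      by (intro mult_left_mono) auto
    also have "\<dots> = e * B * (g * E)"
      by (simp add: e_def B_def power2_eq_square algebra_simps)
    finally have 1: "g \<le> e * B * (g * E)"
      by simp
    have "P \<le> C * real d * \<omega>"
      using P by linarith
    also have "\<dots> \<le> C * real d * W"
      using \<omega> C by (intro mult_left_mono) auto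
    finally have P': "P \<le> C * W * real d"
      by (simp add: mult_ac)
    have "- D\<^sup>2 / 2 + P \<le> - (1 / (8 * K\<^sup>2)) * X\<^sup>2 / 2
        + ((M + C * W) * real d - (real d)\<^sup>2 / (3200 * K\<^sup>2 * (a * (real d)\<^sup>2)\<^sup>2))"
      using False
      by (intro far_bound[OF d1 H nonneg(1,2,3,5,6) K a X _ Xi P']) (auto simp: Z_def intro: \<xi>K)
    then have "num \<le> exp (- (1 / (8 * K\<^sup>2)) * X\<^sup>2 / 2
        + ((M + C * W) * real d - (real d)\<^sup>2 / (3200 * K\<^sup>2 * e\<^sup>2))) / sqrt (2 * pi) ^ d"
      unfolding num_def e_def D_def[symmetric] by (intro divide_right_mono) auto
    also have "\<dots> = F"
      by (simp only: F_def gauss_kernel_def exp_add X2) (simp add: mult_ac)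
    finally have 2: "num \<le> F" .
    have "num \<ge> 0"
      by (simp add: num_def)
    then have "\<bar>num - g\<bar> \<le> g + num"
      using AB by linarith
    also have "\<dots> \<le> e * B * (g * E) + F"
      using 1 2 by linarith
    also have "\<dots> \<le> e * (A + B) * (g * E) + F"
      using AB by (simp add: algebra_simps)
    finally show ?thesis .
  qed
  then show ?thesis
    by (simp add: A_def B_def g_def E_def F_def X2)
qed

text \<open>Same device as in the far region: the quotient \<open>a Z / r\<close> is at least 1 and
  supplies the factor \<open>a\<close>. The extra power of \<open>d\<close> only aligns the bound
  with the one inside.\<close>

lemma gauss_outside:
  fixes \<eta> \<zeta> :: "nat \<Rightarrow> real" and a M r :: real and d :: nat
  assumes d: "d \<ge> 1" and a: "a > 0" and r: "r > 0"
    and \<eta>: "(L2_set \<eta> {..<d})\<^sup>2 \<le> M * real d"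
    and far: "r \<le> a * L2_set (\<lambda>i. \<eta> i + \<zeta> i) {..<d}"
  shows "gauss_kernel d 1 \<zeta> \<le> a * (real d)\<^sup>2 * ((32 + 2 * M) / r)
      * (gauss_kernel d 1 \<zeta> * exp ((\<Sum>i<d. (\<zeta> i)\<^sup>2) / (4 * real d)))"
proof -
  let ?Z = "L2_set (\<lambda>i. \<eta> i + \<zeta> i) {..<d}" and ?g = "gauss_kernel d 1 \<zeta>"
  let ?E = "exp ((\<Sum>i<d. (\<zeta> i)\<^sup>2) / (4 * real d))"
  have d1: "real d \<ge> 1"
    using d by simp
  have Z: "?Z \<le> L2_set \<zeta> {..<d} + L2_set \<eta> {..<d}"
    using L2_set_triangle_ineq[of \<eta> \<zeta>] by (simp add: add.commute)
  have "?Z \<le> real d * ((32 + 2 * M) * ?E)"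
    using linear_growth_le[OF d1 \<eta> _ _ Z] by (simp add: L2_set_power2)
  also have "\<dots> \<le> (real d)\<^sup>2 * ((32 + 2 * M) * ?E)"
  proof (intro mult_right_mono)
    show "real d \<le> (real d)\<^sup>2"
      using d1 by (simp add: power2_eq_square)
    show "0 \<le> (32 + 2 * M) * ?E"
      using \<open>?Z \<le> real d * ((32 + 2 * M) * ?E)\<close> d1
      by (smt (verit) L2_set_nonneg mult_pos_neg)
  qed
  finally have "a * ?Z \<le> a * ((real d)\<^sup>2 * ((32 + 2 * M) * ?E))"
    using a by (intro mult_left_mono) auto
  then have "1 \<le> a * ((real d)\<^sup>2 * ((32 + 2 * M) * ?E)) / r"
    using far r by (simp add: field_simps)
  from mult_left_mono[OF this gauss_kernel_nonneg[of d 1 \<zeta>]] show ?thesis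
    by (simp add: mult_ac)
qed

text \<open>The constants are obtained before \<open>d\<close>, \<open>a\<close>, the noise and the
  model are fixed, so one pair serves all dimensions. The predicate \<open>inside\<close> stands for
  membership in the box. The factor 2 anticipates the normalization of the posterior.\<close>

lemma gauss_perturbation_integral:
  fixes M C K W r :: real
  assumes M: "M \<ge> 0" and C: "C \<ge> 0" and K: "K \<ge> 1" and W: "W \<ge> 0" and r: "r > 0"
  obtains Ct e0 :: real where "Ct > 0" "e0 > 0"
    "\<And>d a \<eta> \<xi> inside num P \<omega>. d \<ge> 1 \<Longrightarrow> a > 0 \<Longrightarrow> a * (real d)\<^sup>2 \<le> e0 \<Longrightarrow>
      (L2_set \<eta> {..<d})\<^sup>2 \<le> M * real d \<Longrightarrow>
      (\<And>\<zeta>. inside \<zeta> \<Longrightarrow>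
         L2_set (\<lambda>i. \<xi> \<zeta> i - (\<eta> i + \<zeta> i)) {..<d} \<le> \<omega> \<zeta> * L2_set (\<lambda>i. \<eta> i + \<zeta> i) {..<d} \<and>
         L2_set (\<lambda>i. \<eta> i + \<zeta> i) {..<d} \<le> K * L2_set (\<xi> \<zeta>) {..<d} \<and>
         0 \<le> \<omega> \<zeta> \<and> \<omega> \<zeta> \<le> a * L2_set (\<lambda>i. \<eta> i + \<zeta> i) {..<d} \<and> \<omega> \<zeta> \<le> W \<and>
         \<bar>P \<zeta>\<bar> \<le> C * real d * \<omega> \<zeta> \<and>
         num \<zeta> = exp (- (L2_set (\<lambda>i. \<eta> i - \<xi> \<zeta> i) {..<d})\<^sup>2 / 2 + P \<zeta>) / sqrt (2 * pi) ^ d) \<Longrightarrow>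
      (\<And>\<zeta>. \<not> inside \<zeta> \<Longrightarrow> r \<le> a * L2_set (\<lambda>i. \<eta> i + \<zeta> i) {..<d}) \<Longrightarrow>
      2 * (\<integral>\<^sup>+\<zeta>. (if inside \<zeta> then ennreal \<bar>num \<zeta> - gauss_kernel d 1 \<zeta>\<bar> else 0) \<partial>lborel_d d)
      + (\<integral>\<^sup>+\<zeta>. (if inside \<zeta> then 0 else ennreal (gauss_kernel d 1 \<zeta>)) \<partial>lborel_d d)
      \<le> ennreal (Ct * (a * (real d)\<^sup>2))"
proof -
  define A where "A = (2 + C) * (32 + 2 * M)\<^sup>2 * exp (M / 10 + C / 20) + 20 * (32 + 2 * M)"
  define B where "B = (32 + 2 * M) / r"
  \<comment> \<open>Exponential growth per dimension in the far region: \<open>M + C * W\<close>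
    from noise and prior, and \<open>3 * K\<close> from the mass of the wide kernel, as
    \<open>sqrt 8 * K\<close> is at most \<open>exp (3 * K)\<close>.\<close>
  define c where "c = M + C * W + 3 * K"
  have A: "A \<ge> 0" and B: "B \<ge> 0" and c: "c \<ge> 1"
    using M C K W r by (simp_all add: A_def B_def c_def add_nonneg_nonneg add_increasing)
  \<comment> \<open>Makes \<open>c * 6400 * K^2 * e0^2\<close> equal to \<open>1 / c\<close>, hence
    at most 1.\<close>
  define e0 where "e0 = 1 / (80 * K * c)"
  define Ct where "Ct = 2 * (2 * A + 6400 * K\<^sup>2) + 2 * B"
  have e0: "e0 > 0" "e0 \<le> 1"
    using K c mult_mono[of 1 K 1 c] by (simp_all add: e0_def)
  have Ct: "Ct > 0"
    using A B K by (simp add: Ct_def add_nonneg_pos add_pos_nonneg)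
  show thesis
  proof (rule that[OF Ct e0(1)])
    fix d :: nat and a :: real and \<eta> :: "nat \<Rightarrow> real" and \<xi> :: "(nat \<Rightarrow> real) \<Rightarrow> nat \<Rightarrow> real"
      and inside :: "(nat \<Rightarrow> real) \<Rightarrow> bool" and num P \<omega> :: "(nat \<Rightarrow> real) \<Rightarrow> real"
    assume d: "d \<ge> 1" and a: "a > 0" and small: "a * (real d)\<^sup>2 \<le> e0"
      and \<eta>: "(L2_set \<eta> {..<d})\<^sup>2 \<le> M * real d"
      and inside: "\<And>\<zeta>. inside \<zeta> \<Longrightarrow>
         L2_set (\<lambda>i. \<xi> \<zeta> i - (\<eta> i + \<zeta> i)) {..<d} \<le> \<omega> \<zeta> * L2_set (\<lambda>i. \<eta> i + \<zeta> i) {..<d} \<and>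
         L2_set (\<lambda>i. \<eta> i + \<zeta> i) {..<d} \<le> K * L2_set (\<xi> \<zeta>) {..<d} \<and>
         0 \<le> \<omega> \<zeta> \<and> \<omega> \<zeta> \<le> a * L2_set (\<lambda>i. \<eta> i + \<zeta> i) {..<d} \<and> \<omega> \<zeta> \<le> W \<and>
         \<bar>P \<zeta>\<bar> \<le> C * real d * \<omega> \<zeta> \<and>
         num \<zeta> = exp (- (L2_set (\<lambda>i. \<eta> i - \<xi> \<zeta> i) {..<d})\<^sup>2 / 2 + P \<zeta>) / sqrt (2 * pi) ^ d"
      and outside: "\<And>\<zeta>. \<not> inside \<zeta> \<Longrightarrow> r \<le> a * L2_set (\<lambda>i. \<eta> i + \<zeta> i) {..<d}"
    define e where "e = a * (real d)\<^sup>2"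
    have e: "e > 0" "e \<le> e0"
      using a d small by (simp_all add: e_def)
    have d1: "real d \<ge> 1"
      using d by simp
    define g where "g = (\<lambda>\<zeta>. gauss_kernel d 1 \<zeta> * exp ((\<Sum>i<d. (\<zeta> i)\<^sup>2) / (4 * real d)))"
    define T where "T = exp ((M + C * W) * real d - (real d)\<^sup>2 / (3200 * K\<^sup>2 * e\<^sup>2))"
    define k where "k = gauss_kernel d (1 / (8 * K\<^sup>2))"
    have [measurable]: "g \<in> borel_measurable (lborel_d d)" "k \<in> borel_measurable (lborel_d d)"
      unfolding g_def k_def by measurable
    have g0: "g \<zeta> \<ge> 0" "k \<zeta> \<ge> 0" for \<zeta>
      by (simp_all add: g_def k_def gauss_kernel_nonneg)
    have gint: "(\<integral>\<^sup>+\<zeta>. ennreal (g \<zeta>) \<partial>lborel_d d) \<le> 2"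
      unfolding g_def by (rule nn_integral_gauss_exp_moment[OF d])
    have kint: "(\<integral>\<^sup>+\<zeta>. ennreal (k \<zeta>) \<partial>lborel_d d) \<le> ennreal (exp (3 * K * real d))"
    proof -
      have "1 / sqrt (1 / (8 * K\<^sup>2)) = sqrt 8 * K"
        using K by (simp add: real_sqrt_divide real_sqrt_mult)
      also have "\<dots> \<le> 3 * K"
        using K by (intro mult_right_mono real_le_lsqrt) auto
      also have "\<dots> \<le> exp (3 * K)"
        using exp_ge_add_one_self[of "3 * K"] by linarith
      finally have "(1 / sqrt (1 / (8 * K\<^sup>2))) ^ d \<le> exp (3 * K) ^ d"
        by (intro power_mono) auto
      then show ?thesis
        using K unfolding k_def
        by (subst nn_integral_gauss_kernel) (auto simp: exp_of_nat_mult[symmetric] mult_ac intro!: ennreal_leI)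
    qed
    \<comment> \<open>With \<open>x = 6400 K^2 e^2\<close> the negative exponent is two copies of
      \<open>d^2 / x\<close>. One absorbs \<open>c d\<close>; the other leaves at most
      \<open>exp (- 1 / x)\<close>, which is at most \<open>x\<close> and therefore of order
      \<open>e\<close>.\<close>
    have Tk: "T * exp (3 * K * real d) \<le> 6400 * K\<^sup>2 * e"
    proof -
      define x where "x = 6400 * K\<^sup>2 * e\<^sup>2"
      have x: "x > 0"
        using K e by (simp add: x_def)
      have "c * x \<le> 1"
      proof -
        have "e\<^sup>2 \<le> e0\<^sup>2"
          using e by (intro power_mono) auto
        then have "c * x \<le> c * (6400 * K\<^sup>2 * e0\<^sup>2)"
          unfolding x_def using c by (intro mult_left_mono) auto
        also have "\<dots> = 1 / c"
          using K c by (simp add: e0_def power2_eq_square)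
        finally show ?thesis
          using c by (smt (verit) divide_le_eq_1)
      qed
      then have "c \<le> 1 / x"
        using x by (simp add: field_simps)
      then have "c * real d \<le> 1 / x * (real d)\<^sup>2"
        using d1 c x by (intro mult_mono) (auto simp: power2_eq_square)
      then have "(M + C * W) * real d - (real d)\<^sup>2 / (3200 * K\<^sup>2 * e\<^sup>2) + 3 * K * real d \<le> - ((real d)\<^sup>2 / x)"
        by (simp add: c_def x_def field_simps)
      also have "\<dots> \<le> - (1 / x)"
        using x d1 by (simp add: divide_right_mono)
      finally have "T * exp (3 * K * real d) \<le> exp (- (1 / x))"
        by (simp add: T_def flip: exp_add)
      also have "\<dots> = 1 / exp (1 / x)"
        by (simp add: exp_minus inverse_eq_divide)
      also have "\<dots> \<le> 1 / (1 / x)"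
        using x order_trans[OF _ exp_ge_add_one_self[of "1 / x"], of "1 / x"] by (intro divide_left_mono) auto
      also have "\<dots> = 6400 * K\<^sup>2 * (e * e)"
        by (simp add: x_def power2_eq_square)
      also have "\<dots> \<le> 6400 * K\<^sup>2 * (e * 1)"
        using e e0 by (intro mult_left_mono) auto
      finally show ?thesis
        by simp
    qed
    have "(\<integral>\<^sup>+\<zeta>. (if inside \<zeta> then ennreal \<bar>num \<zeta> - gauss_kernel d 1 \<zeta>\<bar> else 0) \<partial>lborel_d d)
        \<le> (\<integral>\<^sup>+\<zeta>. ennreal (e * A) * ennreal (g \<zeta>) + ennreal T * ennreal (k \<zeta>) \<partial>lborel_d d)"
    proof (intro nn_integral_mono)
      fix \<zeta>
      have "\<bar>num \<zeta> - gauss_kernel d 1 \<zeta>\<bar> \<le> e * A * g \<zeta> + T * k \<zeta>" if "inside \<zeta>"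
        unfolding e_def A_def g_def T_def k_def
        using inside[OF that] gauss_perturbation_inside[OF d a K C \<eta>, of "\<xi> \<zeta>" \<zeta> "\<omega> \<zeta>" W "P \<zeta>"]
        by simp
      then show "(if inside \<zeta> then ennreal \<bar>num \<zeta> - gauss_kernel d 1 \<zeta>\<bar> else 0)
          \<le> ennreal (e * A) * ennreal (g \<zeta>) + ennreal T * ennreal (k \<zeta>)"
        using g0 A e
        by (auto simp: T_def simp flip: ennreal_mult' ennreal_plus intro!: ennreal_leI)
    qed
    also have "\<dots> = ennreal (e * A) * (\<integral>\<^sup>+\<zeta>. ennreal (g \<zeta>) \<partial>lborel_d d)
        + ennreal T * (\<integral>\<^sup>+\<zeta>. ennreal (k \<zeta>) \<partial>lborel_d d)"
      by (simp add: nn_integral_add nn_integral_cmult)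
    also have "\<dots> \<le> ennreal (e * A) * 2 + ennreal T * ennreal (exp (3 * K * real d))"
      using gint kint by (intro add_mono mult_left_mono) auto
    also have "\<dots> = ennreal (e * A * 2 + T * exp (3 * K * real d))"
      using A e by (simp add: T_def ennreal_mult' flip: ennreal_numeral)
    also have "\<dots> \<le> ennreal (e * (2 * A + 6400 * K\<^sup>2))"
      using Tk by (intro ennreal_leI) (simp add: algebra_simps)
    finally have 1: "(\<integral>\<^sup>+\<zeta>. (if inside \<zeta> then ennreal \<bar>num \<zeta> - gauss_kernel d 1 \<zeta>\<bar> else 0) \<partial>lborel_d d)
        \<le> ennreal (e * (2 * A + 6400 * K\<^sup>2))" .
    have "(\<integral>\<^sup>+\<zeta>. (if inside \<zeta> then 0 else ennreal (gauss_kernel d 1 \<zeta>)) \<partial>lborel_d d)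
        \<le> (\<integral>\<^sup>+\<zeta>. ennreal (e * B) * ennreal (g \<zeta>) \<partial>lborel_d d)"
    proof (intro nn_integral_mono)
      fix \<zeta>
      have "gauss_kernel d 1 \<zeta> \<le> e * B * g \<zeta>" if "\<not> inside \<zeta>"
        unfolding e_def B_def g_def by (rule gauss_outside[OF d a r \<eta> outside[OF that]])
      then show "(if inside \<zeta> then 0 else ennreal (gauss_kernel d 1 \<zeta>)) \<le> ennreal (e * B) * ennreal (g \<zeta>)"
        using g0 B e by (auto simp flip: ennreal_mult' intro!: ennreal_leI)
    qed
    also have "\<dots> = ennreal (e * B) * (\<integral>\<^sup>+\<zeta>. ennreal (g \<zeta>) \<partial>lborel_d d)"
      by (simp add: nn_integral_cmult)
    also have "\<dots> \<le> ennreal (e * B) * 2"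
      using gint by (intro mult_left_mono) auto
    finally have 2: "(\<integral>\<^sup>+\<zeta>. (if inside \<zeta> then 0 else ennreal (gauss_kernel d 1 \<zeta>)) \<partial>lborel_d d)
        \<le> ennreal (e * B) * 2" .
    have "2 * ennreal u + ennreal v * 2 = ennreal (2 * u + v * 2)" if "u \<ge> 0" "v \<ge> 0" for u v
      using that by (simp add: ennreal_mult)
    from this[of "e * (2 * A + 6400 * K\<^sup>2)" "e * B"]
    have "2 * ennreal (e * (2 * A + 6400 * K\<^sup>2)) + ennreal (e * B) * 2 = ennreal (Ct * e)"
      using A B e by (simp add: Ct_def algebra_simps)
    then show "2 * (\<integral>\<^sup>+\<zeta>. (if inside \<zeta> then ennreal \<bar>num \<zeta> - gauss_kernel d 1 \<zeta>\<bar> else 0) \<partial>lborel_d d)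
      + (\<integral>\<^sup>+\<zeta>. (if inside \<zeta> then 0 else ennreal (gauss_kernel d 1 \<zeta>)) \<partial>lborel_d d)
      \<le> ennreal (Ct * (a * (real d)\<^sup>2))"
      using add_mono[OF mult_left_mono[OF 1, of 2] 2] by (simp add: e_def)
  qed
qed

section \<open>Regression with Gaussian noise around a linearization point\<close>

lemma inv_mat_eqI:
  fixes A :: "real mat"
  assumes A: "A \<in> carrier_mat d d" and B: "B \<in> carrier_mat d d" and AB: "A * B = 1\<^sub>m d"
  shows "inv_mat A = B"
proof -
  have BA: "B * A = 1\<^sub>m d"
    by (rule mat_mult_left_right_inverse[OF A B AB])
  have "A \<in> Units (ring_mat TYPE(real) d ())"
    using A B AB BA by (auto simp: Units_def ring_mat_def)
  then obtain C where C: "mat_inverse A = Some C"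
    using mat_inverse(1)[OF A, of "()"] by (cases "mat_inverse A") auto
  from mat_inverse(2)[OF A C] have C': "C \<in> carrier_mat d d" "C * A = 1\<^sub>m d"
    by auto
  have "C = C * (A * B)"
    using C' AB by simp
  also have "\<dots> = C * A * B"
    using assoc_mult_mat[OF C'(1) A B] by simp
  also have "\<dots> = B"
    using B C' by simp
  finally show ?thesis
    using C by simp
qed

text \<open>No separate estimate of the normalizing constant \<open>Z\<close> is made. Replacing
  \<open>1 / Z\<close> by \<open>c\<close> costs at most \<open>|c Z - 1|\<close>, and
  \<open>c Z - 1\<close> is itself the integral of \<open>c f - \<phi>\<close>. This repeats the
  integral over \<open>F\<close> and adds the mass of \<phi> outside.\<close>

lemma L1_dist_normalized_le:
  fixes f \<phi> :: "'a \<Rightarrow> real"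
  assumes F [measurable]: "F \<in> sets M"
    and f: "integrable M f" "\<And>x. x \<in> space M \<Longrightarrow> f x \<ge> 0" "\<And>x. x \<in> space M \<Longrightarrow> x \<notin> F \<Longrightarrow> f x = 0"
    and \<phi>: "integrable M \<phi>" "\<And>x. x \<in> space M \<Longrightarrow> \<phi> x \<ge> 0" "(\<integral>x. \<phi> x \<partial>M) = 1"
  shows "ennreal (LINT x:F|M. \<bar>f x / (\<integral>x. f x \<partial>M) - \<phi> x\<bar>)
    \<le> 2 * (\<integral>\<^sup>+x. (if x \<in> F then ennreal \<bar>c * f x - \<phi> x\<bar> else 0) \<partial>M)
      + (\<integral>\<^sup>+x. (if x \<in> F then 0 else ennreal (\<phi> x)) \<partial>M)"
proof -
  define Z where "Z = (\<integral>x. f x \<partial>M)"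
  define A where "A = (\<integral>x. indicator F x * \<bar>c * f x - \<phi> x\<bar> \<partial>M)"
  define B where "B = (\<integral>x. indicator (space M - F) x * \<phi> x \<partial>M)"
  have iA: "integrable M (\<lambda>x. indicator F x * \<bar>c * f x - \<phi> x\<bar>)"
    using f \<phi> integrable_mult_indicator[of F M "\<lambda>x. \<bar>c * f x - \<phi> x\<bar>"] by simp
  have iB: "integrable M (\<lambda>x. indicator (space M - F) x * \<phi> x)"
    using \<phi> integrable_mult_indicator[of "space M - F" M \<phi>] by simp
  have iI: "integrable M (\<lambda>x. indicator F x * \<bar>f x / Z - \<phi> x\<bar>)"
    using f \<phi> integrable_mult_indicator[of F M "\<lambda>x. \<bar>f x / Z - \<phi> x\<bar>"] by simp
  have Z: "Z \<ge> 0"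
    unfolding Z_def using f by (intro integral_nonneg_AE) auto
  have "(LINT x:F|M. \<bar>f x / Z - \<phi> x\<bar>) \<le> (\<integral>x. \<bar>1 / Z - c\<bar> * f x + indicator F x * \<bar>c * f x - \<phi> x\<bar> \<partial>M)"
    unfolding set_lebesgue_integral_def real_scaleR_def
  proof (rule integral_mono[OF iI])
    fix x assume x: "x \<in> space M"
    have "f x / Z - \<phi> x = (1 / Z - c) * f x + (c * f x - \<phi> x)"
      by (simp add: algebra_simps)
    also have "\<bar>\<dots>\<bar> \<le> \<bar>1 / Z - c\<bar> * f x + \<bar>c * f x - \<phi> x\<bar>"
      using f(2)[OF x] by (simp add: abs_mult order_trans[OF abs_triangle_ineq])
    finally show "indicator F x * \<bar>f x / Z - \<phi> x\<bar> \<le> \<bar>1 / Z - c\<bar> * f x + indicator F x * \<bar>c * f x - \<phi> x\<bar>"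
      using f(2)[OF x] by (simp add: indicator_def)
  qed (use f iA in auto)
  also have "\<dots> = \<bar>1 / Z - c\<bar> * Z + A"
    using f iA by (simp add: A_def Z_def)
  \<comment> \<open>If \<open>Z = 0\<close>, the left side vanishes through its factor
    \<open>Z\<close>, whatever value \<open>1 / Z\<close> takes.\<close>
  also have "\<bar>1 / Z - c\<bar> * Z \<le> \<bar>c * Z - 1\<bar>"
  proof (cases "Z = 0")
    case False
    have "\<bar>1 / Z - c\<bar> * Z = \<bar>(1 / Z - c) * Z\<bar>"
      using Z by (simp add: abs_mult)
    also have "(1 / Z - c) * Z = 1 - c * Z"
      using False by (simp add: algebra_simps)
    finally show ?thesis
      by (simp add: abs_minus_commute)
  qed simp
  also have "c * Z - 1 = (\<integral>x. c * f x - \<phi> x \<partial>M)"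
    using f \<phi> by (simp add: Z_def)
  also have "\<bar>\<dots>\<bar> \<le> (\<integral>x. \<bar>c * f x - \<phi> x\<bar> \<partial>M)"
    by (rule integral_abs_bound)
  also have "\<dots> = (\<integral>x. indicator F x * \<bar>c * f x - \<phi> x\<bar> + indicator (space M - F) x * \<phi> x \<partial>M)"
    using f(3) \<phi>(2) by (intro Bochner_Integration.integral_cong refl) (auto simp: indicator_def)
  also have "\<dots> = A + B"
    using iA iB by (simp add: A_def B_def)
  finally have "(LINT x:F|M. \<bar>f x / Z - \<phi> x\<bar>) \<le> 2 * A + B"
    by simp
  moreover have "A \<ge> 0" "B \<ge> 0"
    unfolding A_def B_def using \<phi>(2) by (auto intro!: integral_nonneg_AE simp: indicator_def)
  ultimately have "ennreal (LINT x:F|M. \<bar>f x / Z - \<phi> x\<bar>) \<le> 2 * ennreal A + ennreal B"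
    using ennreal_leI[of "LINT x:F|M. \<bar>f x / Z - \<phi> x\<bar>" "2 * A + B"] by (simp add: ennreal_mult)
  also have "ennreal A = (\<integral>\<^sup>+x. ennreal (indicator F x * \<bar>c * f x - \<phi> x\<bar>) \<partial>M)"
    unfolding A_def by (rule nn_integral_eq_integral[symmetric, OF iA]) auto
  also have "\<dots> = (\<integral>\<^sup>+x. (if x \<in> F then ennreal \<bar>c * f x - \<phi> x\<bar> else 0) \<partial>M)"
    by (intro nn_integral_cong) (auto simp: indicator_def)
  also have "ennreal B = (\<integral>\<^sup>+x. ennreal (indicator (space M - F) x * \<phi> x) \<partial>M)"
    unfolding B_def using \<phi>(2) by (intro nn_integral_eq_integral[symmetric, OF iB]) (auto simp: indicator_def)
  also have "\<dots> = (\<integral>\<^sup>+x. (if x \<in> F then 0 else ennreal (\<phi> x)) \<partial>M)"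
    by (intro nn_integral_cong) (auto simp: indicator_def)
  finally show ?thesis
    by (simp add: Z_def)
qed

lemma scalar_prod_self_L2_set:
  fixes v :: "real vec"
  assumes "v \<in> carrier_vec d"
  shows "v \<bullet> v = (L2_set (\<lambda>i. v $ i) {..<d})\<^sup>2"
  unfolding L2_set_power2 using assms by (simp add: scalar_prod_def power2_eq_square lessThan_atLeast0)

lemma scalar_prod_self_eq_0:
  fixes v :: "real vec"
  assumes v: "v \<in> carrier_vec d" and "v \<bullet> v = 0"
  shows "v = 0\<^sub>v d"
proof -
  have "(\<Sum>i\<in>{..<d}. (v $ i)\<^sup>2) = 0"
    using assms scalar_prod_self_L2_set[OF v] unfolding L2_set_power2 by simp
  then have "v $ i = 0" if "i < d" for i
    using that by (simp add: sum_nonneg_eq_0_iff)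
  then show ?thesis
    using v by (intro eq_vecI) auto
qed

lemma smult_mat_mult_vec:
  fixes A :: "real mat"
  assumes "A \<in> carrier_mat nr nc" "v \<in> carrier_vec nc"
  shows "(s \<cdot>\<^sub>m A) *\<^sub>v v = s \<cdot>\<^sub>v (A *\<^sub>v v)"
  using assms by (intro eq_vecI) (auto simp: scalar_prod_def sum_distrib_left mult_ac)

lemma transforms_lborel_smult:
  assumes B: "B \<in> carrier_mat d d" "transforms_lborel d B" and s: "s \<noteq> 0"
  shows "transforms_lborel d (s \<cdot>\<^sub>m B)"
proof -
  have "transforms_lborel d (s \<cdot>\<^sub>m 1\<^sub>m d)"
  proof (rule transforms_lborel_definite)
    fix v :: "real vec" assume v: "v \<in> carrier_vec d" and "v \<bullet> (s \<cdot>\<^sub>m 1\<^sub>m d *\<^sub>v v) = 0"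
    then have "s * (v \<bullet> v) = 0"
      using v smult_mat_mult_vec[of "1\<^sub>m d" d d v s] by simp
    then show "v = 0\<^sub>v d"
      using s v scalar_prod_self_eq_0[OF v] by simp
  qed simp
  from transforms_lborel_mult[OF _ this B] show ?thesis
    using B(1) mult_smult_assoc_mat[of "1\<^sub>m d" d d B d s] by simp
qed

text \<open>Isolates what the asymptotics use of the forward map. \<open>b\<close> measures how
  badly \<open>J\<close> may contract, and \<open>r\<close> is the distance of the truth from the
  faces of the box. The substitution rule for \<open>Jinv\<close> is an assumption because
  \<open>Jinv\<close> need not be definite; it is supplied by a factorization.\<close>

locale gaussian_regression =
  fixes d n :: nat and J Jinv :: "real mat" and G :: "real vec \<Rightarrow> real vec" and q0 :: "real vec"
    and p :: "nat \<Rightarrow> real \<Rightarrow> real" and lo hi b C r :: real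
  assumes d: "d \<ge> 1" and n: "n \<ge> 1"
    and J: "J \<in> carrier_mat d d" and Jinv: "Jinv \<in> carrier_mat d d" and JJinv: "J * Jinv = 1\<^sub>m d"
    and jac: "jacobian d G q0 = J"
    and transf: "transforms_lborel d Jinv"
    and q0: "q0 \<in> carrier_vec d" and r: "r > 0"
    and q0_in: "\<And>i. i < d \<Longrightarrow> lo + r \<le> q0 $ i \<and> q0 $ i \<le> hi - r"
    and b: "b > 0" and C: "C \<ge> 0"
    and G_dim: "\<And>q. q \<in> carrier_vec d \<Longrightarrow> \<forall>i<d. lo \<le> q $ i \<and> q $ i \<le> hi \<Longrightarrow> G q \<in> carrier_vec d"
    and G_meas: "\<And>k. k < d \<Longrightarrow>
      (\<lambda>x. if x \<in> PiE {..<d} (\<lambda>_. {lo..hi}) then G (vec d x) $ k else 0) \<in> borel_measurable (lborel_d d)"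
    and approx: "\<And>q \<omega>. q \<in> carrier_vec d \<Longrightarrow> \<forall>i<d. lo \<le> q $ i \<and> q $ i \<le> hi \<Longrightarrow>
      \<forall>i<d. \<bar>q $ i - q0 $ i\<bar> \<le> \<omega> \<Longrightarrow>
      L2_set (\<lambda>i. G q $ i - G q0 $ i - (J *\<^sub>v (q - q0)) $ i) {..<d}
        \<le> \<omega> * L2_set (\<lambda>i. (J *\<^sub>v (q - q0)) $ i) {..<d} \<and>
      L2_set (\<lambda>i. (J *\<^sub>v (q - q0)) $ i) {..<d} \<le> (1 + \<omega>) * L2_set (\<lambda>i. G q $ i - G q0 $ i) {..<d}"
    and sup_bound: "\<And>w i. w \<in> carrier_vec d \<Longrightarrow> i < d \<Longrightarrow>
      \<bar>w $ i\<bar> \<le> b * L2_set (\<lambda>i. (J *\<^sub>v w) $ i) {..<d}"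
    and p_meas: "\<And>i. i < d \<Longrightarrow> p i \<in> borel_measurable borel"
    and p_prob: "\<And>i. i < d \<Longrightarrow> prob_space (density lborel (\<lambda>x. ennreal (p i x)))"
    and p_supp: "\<And>i x. i < d \<Longrightarrow> x \<notin> {lo..hi} \<Longrightarrow> p i x = 0"
    and p_pos: "\<And>i x. i < d \<Longrightarrow> x \<in> {lo..hi} \<Longrightarrow> p i x > 0"
    and p_lip: "\<And>i x y. i < d \<Longrightarrow> x \<in> {lo..hi} \<Longrightarrow> y \<in> {lo..hi} \<Longrightarrow>
      \<bar>ln (p i x) - ln (p i y)\<bar> \<le> C * \<bar>x - y\<bar>"
begin

text \<open>\<open>\<zeta>\<close> are the coordinates in which the limiting normal distribution is the standard one;
  \<open>\<kappa>\<close> is the volume factor of this change of coordinates.\<close>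

definition "F = PiE {..<d} (\<lambda>_. {lo..hi})"

definition "s = 1 / sqrt (real n)"

definition "\<kappa> = \<bar>det (s \<cdot>\<^sub>m Jinv)\<bar>"

definition "center \<eta> = Delta_vec d n G q0 (vec d \<eta>)"

definition "point \<eta> \<zeta> = (\<lambda>i\<in>{..<d}. center \<eta> $ i + lin_fun d (s \<cdot>\<^sub>m Jinv) \<zeta> i)"

definition "limit_pdf \<eta> x = gaussian_pdf d (center \<eta>) ((1 / real n) \<cdot>\<^sub>m Sigma_mat d G q0) (vec d x)"

definition "post_num \<eta> x = likelihood n G (data_vec n G q0 (vec d \<eta>)) (vec d x) * prior_pdf d p (vec d x)"

lemma s_pos: "s > 0" and s_sq: "s\<^sup>2 = 1 / real n" "real n * s\<^sup>2 = 1"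
  using n by (simp_all add: s_def power_divide)

lemma JinvJ: "Jinv * J = 1\<^sub>m d"
  by (rule mat_mult_left_right_inverse[OF J Jinv JJinv])

lemma J_Jinv_vec: "v \<in> carrier_vec d \<Longrightarrow> J *\<^sub>v (Jinv *\<^sub>v v) = v"
  using assoc_mult_mat_vec[OF J Jinv, of v] by (simp add: JJinv)

lemma det_Jinv: "det Jinv \<noteq> 0"
proof -
  have "det J * det Jinv = 1"
    using det_mult[OF J Jinv] by (simp add: JJinv)
  then show ?thesis
    by auto
qed

lemma kappa: "\<kappa> = s ^ d * \<bar>det Jinv\<bar>" "\<kappa> > 0"
  using det_Jinv s_pos Jinv by (simp_all add: \<kappa>_def abs_mult)

lemma Sigma_mat_eq: "Sigma_mat d G q0 = Jinv * transpose_mat Jinv"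
  unfolding Sigma_mat_def jac
proof (rule inv_mat_eqI)
  have JT: "transpose_mat J \<in> carrier_mat d d" and JiT: "transpose_mat Jinv \<in> carrier_mat d d"
    using J Jinv by auto
  have "transpose_mat J * J * (Jinv * transpose_mat Jinv) = transpose_mat J * (J * (Jinv * transpose_mat Jinv))"
    using J JT Jinv JiT by (intro assoc_mult_mat) auto
  also have "J * (Jinv * transpose_mat Jinv) = transpose_mat Jinv"
    using assoc_mult_mat[OF J Jinv JiT] JiT by (simp add: JJinv)
  also have "transpose_mat J * transpose_mat Jinv = transpose_mat (Jinv * J)"
    using transpose_mult[OF Jinv J] by simp
  finally show "transpose_mat J * J * (Jinv * transpose_mat Jinv) = 1\<^sub>m d"
    by (simp add: JinvJ)
qed (use J Jinv in auto)

text \<open>Because \<open>J\<close> is invertible, the covariance times the transpose of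
  \<open>J\<close> collapses to \<open>Jinv\<close>, and the centring solves the linearized equation
  exactly.\<close>

lemma center_eq: "center \<eta> = q0 + s \<cdot>\<^sub>v (Jinv *\<^sub>v vec d \<eta>)"
proof -
  have JT: "transpose_mat J \<in> carrier_mat d d" and JiT: "transpose_mat Jinv \<in> carrier_mat d d"
    using J Jinv by auto
  have "transpose_mat Jinv * transpose_mat J = 1\<^sub>m d"
    using transpose_mult[OF J Jinv] by (simp add: JJinv)
  then have "Jinv * transpose_mat Jinv * transpose_mat J = Jinv"
    using assoc_mult_mat[OF Jinv JiT JT] Jinv by simp
  then show ?thesis
    by (simp add: center_def Delta_vec_def Sigma_mat_eq jac s_def)
qed

lemma center_carrier: "center \<eta> \<in> carrier_vec d"
  using q0 Jinv by (simp add: center_eq)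

text \<open>The precision matrix is \<open>n\<close> times the transpose of \<open>J\<close> times
  \<open>J\<close>, so the quadratic form is a norm of \<open>J (x - m)\<close>; the determinant of
  the covariance is the square of the volume factor \<kappa>.\<close>

lemma gaussian_pdf_eq:
  assumes m: "m \<in> carrier_vec d" and x: "x \<in> carrier_vec d"
  shows "gaussian_pdf d m ((1 / real n) \<cdot>\<^sub>m Sigma_mat d G q0) x
    = exp (- (real n * (L2_set (\<lambda>i. (J *\<^sub>v (x - m)) $ i) {..<d})\<^sup>2) / 2) / (sqrt (2 * pi) ^ d * \<kappa>)"
proof -
  let ?S = "(1 / real n) \<cdot>\<^sub>m Sigma_mat d G q0" and ?v = "x - m"
  have JT: "transpose_mat J \<in> carrier_mat d d" and JiT: "transpose_mat Jinv \<in> carrier_mat d d"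
    using J Jinv by auto
  have v: "?v \<in> carrier_vec d"
    using m x by simp
  have JTJ: "transpose_mat J * J \<in> carrier_mat d d"
    using J by auto
  have Sig: "Sigma_mat d G q0 \<in> carrier_mat d d"
    unfolding Sigma_mat_eq using Jinv by auto
  have "inv_mat ?S = real n \<cdot>\<^sub>m (transpose_mat J * J)"
  proof (rule inv_mat_eqI)
    have "Jinv * transpose_mat Jinv * (transpose_mat J * J) = Jinv * (transpose_mat Jinv * (transpose_mat J * J))"
      using Jinv JiT JTJ by (intro assoc_mult_mat)
    also have "transpose_mat Jinv * (transpose_mat J * J) = transpose_mat Jinv * transpose_mat J * J"
      using assoc_mult_mat[OF JiT JT J] by simp
    also have "transpose_mat Jinv * transpose_mat J = 1\<^sub>m d"
      using transpose_mult[OF J Jinv] by (simp add: JJinv)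
    finally have "Sigma_mat d G q0 * (transpose_mat J * J) = 1\<^sub>m d"
      using J by (simp add: Sigma_mat_eq JinvJ)
    then show "?S * (real n \<cdot>\<^sub>m (transpose_mat J * J)) = 1\<^sub>m d"
      using n JTJ mult_smult_assoc_mat[OF Sig, of "real n \<cdot>\<^sub>m (transpose_mat J * J)" d "1 / real n"]
        mult_smult_distrib[OF Sig JTJ, of "real n"]
      by (auto intro!: eq_matI)
  qed (use Sig JTJ in auto)
  then have "?v \<bullet> (inv_mat ?S *\<^sub>v ?v) = ?v \<bullet> (real n \<cdot>\<^sub>v (transpose_mat J * J *\<^sub>v ?v))"
    using smult_mat_mult_vec[OF JTJ v] by simp
  also have "transpose_mat J * J *\<^sub>v ?v = transpose_mat J *\<^sub>v (J *\<^sub>v ?v)"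
    using assoc_mult_mat_vec[OF JT J v] .
  also have "?v \<bullet> (real n \<cdot>\<^sub>v (transpose_mat J *\<^sub>v (J *\<^sub>v ?v)))
      = real n * (?v \<bullet> (transpose_mat J *\<^sub>v (J *\<^sub>v ?v)))"
    using v J by simp
  also have "?v \<bullet> (transpose_mat J *\<^sub>v (J *\<^sub>v ?v)) = (J *\<^sub>v ?v) \<bullet> (J *\<^sub>v ?v)"
  proof -
    have "?v \<bullet> (transpose_mat J *\<^sub>v (J *\<^sub>v ?v)) = (transpose_mat J *\<^sub>v (J *\<^sub>v ?v)) \<bullet> ?v"
      using v J by (intro comm_scalar_prod[of _ d]) auto
    also have "\<dots> = (J *\<^sub>v ?v) \<bullet> (J *\<^sub>v ?v)"
      using v J by (intro transpose_vec_mult_scalar[of J d d]) auto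
    finally show ?thesis .
  qed
  also have "\<dots> = (L2_set (\<lambda>i. (J *\<^sub>v ?v) $ i) {..<d})\<^sup>2"
    using v J by (intro scalar_prod_self_L2_set) auto
  finally have quad: "?v \<bullet> (inv_mat ?S *\<^sub>v ?v) = real n * (L2_set (\<lambda>i. (J *\<^sub>v ?v) $ i) {..<d})\<^sup>2" .
  have "det ?S = (1 / real n) ^ d * (det Jinv)\<^sup>2"
    using Sig Jinv JiT det_mult[OF Jinv JiT] det_transpose[OF Jinv]
    by (simp add: Sigma_mat_eq power2_eq_square)
  also have "\<dots> = \<kappa>\<^sup>2"
    by (simp add: kappa power_mult_distrib s_sq flip: power_mult power2_eq_square)
      (simp add: s_sq mult.commute[of d] power_mult)
  finally have det: "det ?S = \<kappa>\<^sup>2" .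
  have "sqrt ((2 * pi) ^ d * det ?S) = sqrt (2 * pi) ^ d * \<kappa>"
    unfolding det real_sqrt_mult[of "(2 * pi) ^ d"] real_sqrt_power using kappa(2) by simp
  then show ?thesis
    unfolding gaussian_pdf_def quad by simp
qed

lemma vec_point: "vec d (point \<eta> \<zeta>) = q0 + s \<cdot>\<^sub>v (Jinv *\<^sub>v vec d (\<lambda>i. \<eta> i + \<zeta> i))"
proof -
  have "vec d (\<lambda>i. \<eta> i + \<zeta> i) = vec d \<eta> + vec d \<zeta>"
    by auto
  then have "Jinv *\<^sub>v vec d (\<lambda>i. \<eta> i + \<zeta> i) = Jinv *\<^sub>v vec d \<eta> + Jinv *\<^sub>v vec d \<zeta>"
    using mult_add_distrib_mat_vec[OF Jinv] by simp
  moreover have "vec d (point \<eta> \<zeta>) = center \<eta> + s \<cdot>\<^sub>v (Jinv *\<^sub>v vec d \<zeta>)"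
    using smult_mat_mult_vec[OF Jinv, of "vec d \<zeta>" s] center_carrier[of \<eta>] Jinv
    by (intro eq_vecI) (auto simp: point_def lin_fun_def)
  ultimately show ?thesis
    using Jinv q0 by (intro eq_vecI) (auto simp: center_eq algebra_simps simp del: index_mult_mat_vec)
qed

text \<open>The linearized displacement is the rescaled sum of noise and coordinate. Through this
  identity all bounds in terms of \<open>J w\<close> become bounds in
  \<open>\<eta> + \<zeta>\<close>.\<close>

lemma J_point: "i < d \<Longrightarrow> (J *\<^sub>v (vec d (point \<eta> \<zeta>) - q0)) $ i = s * (\<eta> i + \<zeta> i)"
proof -
  assume i: "i < d"
  have "vec d (point \<eta> \<zeta>) - q0 = s \<cdot>\<^sub>v (Jinv *\<^sub>v vec d (\<lambda>i. \<eta> i + \<zeta> i))"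
    using q0 Jinv by (intro eq_vecI) (auto simp: vec_point simp del: index_mult_mat_vec)
  also have "J *\<^sub>v \<dots> = s \<cdot>\<^sub>v vec d (\<lambda>i. \<eta> i + \<zeta> i)"
    using mult_mat_vec[OF J, of "Jinv *\<^sub>v vec d (\<lambda>i. \<eta> i + \<zeta> i)" s] Jinv by (simp add: J_Jinv_vec)
  finally show ?thesis
    using i by simp
qed

lemma limit_pdf_point: "limit_pdf \<eta> (point \<eta> \<zeta>) = gauss_kernel d 1 \<zeta> / \<kappa>"
proof -
  have "vec d (point \<eta> \<zeta>) - center \<eta> = s \<cdot>\<^sub>v (Jinv *\<^sub>v vec d \<zeta>)"
    using smult_mat_mult_vec[OF Jinv, of "vec d \<zeta>" s] center_carrier[of \<eta>] Jinv
    by (intro eq_vecI) (auto simp: point_def lin_fun_def)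
  then have "J *\<^sub>v (vec d (point \<eta> \<zeta>) - center \<eta>) = s \<cdot>\<^sub>v vec d \<zeta>"
    using mult_mat_vec[OF J, of "Jinv *\<^sub>v vec d \<zeta>" s] Jinv by (simp add: J_Jinv_vec)
  then have "(L2_set (\<lambda>i. (J *\<^sub>v (vec d (point \<eta> \<zeta>) - center \<eta>)) $ i) {..<d})\<^sup>2 = s\<^sup>2 * (\<Sum>i<d. (\<zeta> i)\<^sup>2)"
    unfolding L2_set_power2 by (simp add: power_mult_distrib sum_distrib_left)
  then show ?thesis
    using n unfolding limit_pdf_def
    by (simp add: gaussian_pdf_eq[OF center_carrier] gauss_kernel_def s_sq)
qed

lemma nn_integral_point:
  fixes f :: "(nat \<Rightarrow> real) \<Rightarrow> ennreal"
  assumes f [measurable]: "f \<in> borel_measurable (lborel_d d)"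
  shows "(\<integral>\<^sup>+x. f x \<partial>lborel_d d) = \<kappa> * (\<integral>\<^sup>+\<zeta>. f (point \<eta> \<zeta>) \<partial>lborel_d d)"
proof -
  have sJ: "s \<cdot>\<^sub>m Jinv \<in> carrier_mat d d"
    using Jinv by simp
  have "transforms_lborel d (s \<cdot>\<^sub>m Jinv)"
    using s_pos by (intro transforms_lborel_smult[OF Jinv transf]) auto
  note tr = this[unfolded transforms_lborel_def, THEN bspec]
  have "(\<lambda>x. f (\<lambda>i\<in>{..<d}. center \<eta> $ i + x i)) \<in> borel_measurable (lborel_d d)"
    by (rule measurable_compose[OF _ f], rule measurable_restrict) measurable
  from tr[OF this] show ?thesis
    unfolding nn_integral_lborel_d_translate[OF f, of "\<lambda>i. center \<eta> $ i"] \<kappa>_def point_def .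
qed

end

lemma measurable_component_borel:
  assumes "sets M = sets borel" "i \<in> I"
  shows "(\<lambda>x. x i) \<in> borel_measurable (PiM I (\<lambda>_. M))"
  using measurable_component_singleton[OF assms(2), of "\<lambda>_. M"] measurable_cong_sets[OF refl assms(1)] by blast

section \<open>Measurability and integrability of the two densities\<close>

context gaussian_regression
begin

text \<open>Nothing is assumed about \<open>G\<close> outside the box. Cutting it off there gives a
  measurable function and leaves the posterior numerator unchanged, since the prior vanishes
  outside.\<close>

definition "G_box x k = (if x \<in> F then G (vec d x) $ k else 0)"

lemma measurable_G_box [measurable]: "k < d \<Longrightarrow> (\<lambda>x. G_box x k) \<in> borel_measurable (lborel_d d)"
  using G_meas unfolding G_box_def F_def by simp

lemma F_sets [measurable]: "F \<in> sets (lborel_d d)"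
  unfolding F_def by (intro sets_PiM_I_finite) auto

lemma vec_F: "x \<in> F \<Longrightarrow> \<forall>i<d. lo \<le> vec d x $ i \<and> vec d x $ i \<le> hi"
  unfolding F_def by (auto simp: PiE_def Pi_def)

lemma q0_box: "\<forall>i<d. lo \<le> q0 $ i \<and> q0 $ i \<le> hi"
  using q0_in r by (meson add_increasing2 diff_le_eq le_add_same_cancel1 less_imp_le order_trans)

lemma G_q0: "G q0 \<in> carrier_vec d"
  using G_dim[OF q0 q0_box] .

lemma not_in_F:
  assumes "x \<in> space (lborel_d d)" "x \<notin> F"
  obtains i where "i < d" "x i \<notin> {lo..hi}"
  using assms by (auto simp: F_def space_PiM PiE_def Pi_def)

lemma p_nonneg: "i < d \<Longrightarrow> p i x \<ge> 0"
  using p_pos[of i x] p_supp[of i x] by (cases "x \<in> {lo..hi}") auto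

lemma post_num_eq:
  assumes x: "x \<in> space (lborel_d d)"
  shows "post_num \<eta> x =
    exp (- (real n / 2) * (\<Sum>k<d. (G q0 $ k + s * \<eta> k - G_box x k)\<^sup>2)) * (\<Prod>i<d. p i (x i))"
proof (cases "x \<in> F")
  case True
  have Gx: "G (vec d x) \<in> carrier_vec d"
    using G_dim[OF _ vec_F[OF True]] by simp
  let ?v = "data_vec n G q0 (vec d \<eta>) - G (vec d x)"
  have v: "?v \<in> carrier_vec d"
    using carrier_vecD[OF Gx] by (intro carrier_vecI) simp
  have "?v \<bullet> ?v = (\<Sum>k<d. (?v $ k)\<^sup>2)"
    using scalar_prod_self_L2_set[OF v] by (simp add: L2_set_power2)
  also have "\<dots> = (\<Sum>k<d. (G q0 $ k + s * \<eta> k - G_box x k)\<^sup>2)"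
    using Gx G_q0 True by (intro sum.cong refl) (auto simp: data_vec_def s_def G_box_def)
  finally show ?thesis
    by (simp add: post_num_def likelihood_def prior_pdf_def)
next
  case False
  then obtain i where "i < d" "x i \<notin> {lo..hi}"
    using not_in_F[OF x] by blast
  then have "(\<Prod>i<d. p i (x i)) = 0"
    using p_supp by (intro prod_zero) auto
  then show ?thesis
    by (simp add: post_num_def prior_pdf_def)
qed

text \<open>Written out in the coordinates of \<eta> and \<open>x\<close>, so that joint
  measurability follows from closure properties.\<close>

lemma limit_pdf_eq:
  "limit_pdf \<eta> x = exp (- (real n * (\<Sum>k<d. (\<Sum>j<d. J $$ (k, j) *
      (x j - (q0 $ j + s * (\<Sum>l<d. Jinv $$ (j, l) * \<eta> l))))\<^sup>2)) / 2) / (sqrt (2 * pi) ^ d * \<kappa>)"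
proof -
  have c: "center \<eta> $ j = q0 $ j + s * (\<Sum>l<d. Jinv $$ (j, l) * \<eta> l)" if "j < d" for j
    using that q0 Jinv by (simp add: center_eq scalar_prod_def lessThan_atLeast0)
  have "(J *\<^sub>v (vec d x - center \<eta>)) $ k
      = (\<Sum>j<d. J $$ (k, j) * (x j - (q0 $ j + s * (\<Sum>l<d. Jinv $$ (j, l) * \<eta> l))))" if "k < d" for k
    using that J center_carrier[of \<eta>] by (auto simp: scalar_prod_def lessThan_atLeast0 c intro!: sum.cong)
  then show ?thesis
    unfolding limit_pdf_def by (simp add: gaussian_pdf_eq[OF center_carrier] L2_set_power2)
qed

lemma measurable_post_num_pair:
  "(\<lambda>(\<eta>, x). post_num \<eta> x) \<in> borel_measurable (std_normal_d d \<Otimes>\<^sub>M lborel_d d)"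
proof -
  have [measurable]: "(\<lambda>z. p i (snd z i)) \<in> borel_measurable (std_normal_d d \<Otimes>\<^sub>M lborel_d d)" if "i < d" for i
  proof -
    have "(\<lambda>z. snd z i) \<in> borel_measurable (std_normal_d d \<Otimes>\<^sub>M lborel_d d)"
      by (rule measurable_compose[OF measurable_snd measurable_component_borel]) (use that in auto)
    then show ?thesis
      by (rule measurable_compose[OF _ p_meas[OF that]])
  qed
  have [measurable]: "(\<lambda>z. fst z i) \<in> borel_measurable (std_normal_d d \<Otimes>\<^sub>M lborel_d d)" if "i < d" for i
    by (rule measurable_compose[OF measurable_fst measurable_component_borel]) (use that in auto)
  have "(\<lambda>z. exp (- (real n / 2) * (\<Sum>k<d. (G q0 $ k + s * fst z k - G_box (snd z) k)\<^sup>2))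
      * (\<Prod>i<d. p i (snd z i))) \<in> borel_measurable (std_normal_d d \<Otimes>\<^sub>M lborel_d d)"
    by measurable
  moreover have "(\<lambda>(\<eta>, x). post_num \<eta> x) \<in> borel_measurable (std_normal_d d \<Otimes>\<^sub>M lborel_d d) \<longleftrightarrow>
    (\<lambda>z. exp (- (real n / 2) * (\<Sum>k<d. (G q0 $ k + s * fst z k - G_box (snd z) k)\<^sup>2))
      * (\<Prod>i<d. p i (snd z i))) \<in> borel_measurable (std_normal_d d \<Otimes>\<^sub>M lborel_d d)"
    by (rule measurable_cong) (auto simp: space_pair_measure post_num_eq)
  ultimately show ?thesis
    by blast
qed

lemma measurable_limit_pdf_pair:
  "(\<lambda>(\<eta>, x). limit_pdf \<eta> x) \<in> borel_measurable (std_normal_d d \<Otimes>\<^sub>M lborel_d d)"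
proof -
  have [measurable]: "(\<lambda>z. fst z i) \<in> borel_measurable (std_normal_d d \<Otimes>\<^sub>M lborel_d d)" if "i < d" for i
    by (rule measurable_compose[OF measurable_fst measurable_component_borel]) (use that in auto)
  have [measurable]: "(\<lambda>z. snd z i) \<in> borel_measurable (std_normal_d d \<Otimes>\<^sub>M lborel_d d)" if "i < d" for i
    by (rule measurable_compose[OF measurable_snd measurable_component_borel]) (use that in auto)
  show ?thesis
    unfolding limit_pdf_eq case_prod_beta' by measurable
qed

lemma measurable_post_num [measurable]: "post_num \<eta> \<in> borel_measurable (lborel_d d)"
proof -
  have [measurable]: "(\<lambda>x. p i (x i)) \<in> borel_measurable (lborel_d d)" if "i < d" for i
  proof -
    have "(\<lambda>x. x i) \<in> borel_measurable (lborel_d d)"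
      by (rule measurable_component_borel) (use that in auto)
    then show ?thesis
      by (rule measurable_compose[OF _ p_meas[OF that]])
  qed
  have "(\<lambda>x. exp (- (real n / 2) * (\<Sum>k<d. (G q0 $ k + s * \<eta> k - G_box x k)\<^sup>2))
      * (\<Prod>i<d. p i (x i))) \<in> borel_measurable (lborel_d d)"
    by measurable
  then show ?thesis
    by (subst measurable_cong) (auto simp: post_num_eq)
qed

lemma measurable_limit_pdf [measurable]: "limit_pdf \<eta> \<in> borel_measurable (lborel_d d)"
  unfolding limit_pdf_eq[abs_def] by measurable

lemma measurable_point [measurable]: "point \<eta> \<in> lborel_d d \<rightarrow>\<^sub>M lborel_d d"
  using Jinv unfolding point_def by (simp add: lin_fun_eq_sum)

definition "dTV \<eta> = dTV_box d lo hi (posterior_pdf d n G p (data_vec n G q0 (vec d \<eta>)))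
   (gaussian_pdf d (Delta_vec d n G q0 (vec d \<eta>)) ((1 / real n) \<cdot>\<^sub>m Sigma_mat d G q0))"

lemma dTV_eq:
  "dTV \<eta> = (LINT x:F|lborel_d d. \<bar>post_num \<eta> x / (\<integral>x. post_num \<eta> x \<partial>lborel_d d) - limit_pdf \<eta> x\<bar>)"
  by (simp add: dTV_def dTV_box_def posterior_pdf_def F_def post_num_def limit_pdf_def center_def)

text \<open>Needed because \<open>bigO_p\<close> asks for measurable events. Both densities are
  jointly measurable in noise and parameter, and so are the integrals with the noise as a
  parameter.\<close>

lemma measurable_dTV: "dTV \<in> borel_measurable (std_normal_d d)"
proof -
  interpret product_sigma_finite "\<lambda>_::nat. lborel :: real measure"
    by standard
  interpret L: sigma_finite_measure "lborel_d d"
    by (rule sigma_finite) simp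
  note [measurable] = measurable_post_num_pair measurable_limit_pdf_pair
  have [measurable]: "(\<lambda>\<eta>. \<integral>x. post_num \<eta> x \<partial>lborel_d d) \<in> borel_measurable (std_normal_d d)"
    by (rule L.borel_measurable_lebesgue_integral) measurable
  show ?thesis
    unfolding dTV_eq[abs_def] set_lebesgue_integral_def
    by (rule L.borel_measurable_lebesgue_integral) measurable
qed

lemma post_num_nonneg: "x \<in> space (lborel_d d) \<Longrightarrow> post_num \<eta> x \<ge> 0"
  using p_nonneg by (auto simp: post_num_eq intro!: mult_nonneg_nonneg prod_nonneg)

lemma post_num_outside: "x \<in> space (lborel_d d) \<Longrightarrow> x \<notin> F \<Longrightarrow> post_num \<eta> x = 0"
proof -
  assume x: "x \<in> space (lborel_d d)" "x \<notin> F"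
  then obtain i where "i < d" "x i \<notin> {lo..hi}"
    by (rule not_in_F)
  then have "(\<Prod>i<d. p i (x i)) = 0"
    using p_supp by (intro prod_zero) auto
  then show "post_num \<eta> x = 0"
    by (simp add: post_num_eq[OF x(1)])
qed

lemma integrable_post_num: "integrable (lborel_d d) (post_num \<eta>)"
proof (rule Bochner_Integration.integrable_bound)
  interpret product_sigma_finite "\<lambda>_::nat. lborel :: real measure"
    by standard
  have "integrable lborel (p i)" if i: "i < d" for i
  proof (rule integrableI_nonneg)
    interpret prob_space "density lborel (\<lambda>x. ennreal (p i x))"
      by (rule p_prob[OF i])
    show "(\<integral>\<^sup>+x. ennreal (p i x) \<partial>lborel) < \<infinity>"
      using emeasure_space_1 p_meas[OF i] by (simp add: emeasure_density)
  qed (use p_nonneg[OF i] p_meas[OF i] in auto)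
  then show "integrable (lborel_d d) (\<lambda>x. \<Prod>i<d. p i (x i))"
    by (intro product_integrable_prod) auto
  show "AE x in lborel_d d. norm (post_num \<eta> x) \<le> norm (\<Prod>i<d. p i (x i))"
  proof (rule AE_I2)
    fix x assume x: "x \<in> space (lborel_d d)"
    have "exp (- (real n / 2) * (\<Sum>k<d. (G q0 $ k + s * \<eta> k - G_box x k)\<^sup>2)) \<le> 1"
      by (simp add: sum_nonneg mult_nonneg_nonneg)
    then have "exp (- (real n / 2) * (\<Sum>k<d. (G q0 $ k + s * \<eta> k - G_box x k)\<^sup>2)) * \<bar>\<Prod>i<d. p i (x i)\<bar>
        \<le> 1 * \<bar>\<Prod>i<d. p i (x i)\<bar>"
      by (rule mult_right_mono) simp
    then show "norm (post_num \<eta> x) \<le> norm (\<Prod>i<d. p i (x i))"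
      by (simp add: post_num_eq[OF x] abs_mult)
  qed
qed measurable

lemma limit_pdf_nonneg: "limit_pdf \<eta> x \<ge> 0"
  using kappa by (simp add: limit_pdf_eq)

lemma limit_pdf_density:
  "integrable (lborel_d d) (limit_pdf \<eta>)" "(\<integral>x. limit_pdf \<eta> x \<partial>lborel_d d) = 1"
proof -
  have "(\<integral>\<^sup>+x. ennreal (limit_pdf \<eta> x) \<partial>lborel_d d)
      = \<kappa> * (\<integral>\<^sup>+\<zeta>. ennreal (gauss_kernel d 1 \<zeta> / \<kappa>) \<partial>lborel_d d)"
    by (subst nn_integral_point[of _ \<eta>]) (simp_all add: limit_pdf_point cong: if_cong)
  also have "\<dots> = (\<integral>\<^sup>+\<zeta>. ennreal \<kappa> * ennreal (gauss_kernel d 1 \<zeta> / \<kappa>) \<partial>lborel_d d)"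
    by (subst nn_integral_cmult) auto
  also have "\<dots> = (\<integral>\<^sup>+\<zeta>. ennreal (gauss_kernel d 1 \<zeta>) \<partial>lborel_d d)"
    using kappa(2) by (simp add: gauss_kernel_nonneg flip: ennreal_mult)
  also have "\<dots> = 1"
    by (simp add: nn_integral_gauss_kernel)
  finally have 1: "(\<integral>\<^sup>+x. ennreal (limit_pdf \<eta> x) \<partial>lborel_d d) = 1" .
  show "integrable (lborel_d d) (limit_pdf \<eta>)"
    using 1 limit_pdf_nonneg by (intro integrableI_nonneg) auto
  show "(\<integral>x. limit_pdf \<eta> x \<partial>lborel_d d) = 1"
    using 1 limit_pdf_nonneg by (subst integral_eq_nn_integral) auto
qed

definition "num c \<eta> \<zeta> = \<kappa> * c * post_num \<eta> (point \<eta> \<zeta>)"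

text \<open>Valid for any \<open>c\<close>. The volume factor of the substitution cancels the
  \<open>1 / \<kappa>\<close> in the limiting density.\<close>

lemma dTV_le_integrals:
  "ennreal (dTV \<eta>) \<le>
    2 * (\<integral>\<^sup>+\<zeta>. (if point \<eta> \<zeta> \<in> F then ennreal \<bar>num c \<eta> \<zeta> - gauss_kernel d 1 \<zeta>\<bar> else 0) \<partial>lborel_d d)
    + (\<integral>\<^sup>+\<zeta>. (if point \<eta> \<zeta> \<in> F then 0 else ennreal (gauss_kernel d 1 \<zeta>)) \<partial>lborel_d d)"
proof -
  have "(\<integral>\<^sup>+x. (if x \<in> F then ennreal \<bar>c * post_num \<eta> x - limit_pdf \<eta> x\<bar> else 0) \<partial>lborel_d d)
      = \<kappa> * (\<integral>\<^sup>+\<zeta>. (if point \<eta> \<zeta> \<in> F then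
          ennreal \<bar>c * post_num \<eta> (point \<eta> \<zeta>) - gauss_kernel d 1 \<zeta> / \<kappa>\<bar> else 0) \<partial>lborel_d d)"
    by (subst nn_integral_point[of _ \<eta>]) (simp_all add: limit_pdf_point cong: if_cong)
  also have "\<dots> = (\<integral>\<^sup>+\<zeta>. ennreal \<kappa> * (if point \<eta> \<zeta> \<in> F then
          ennreal \<bar>c * post_num \<eta> (point \<eta> \<zeta>) - gauss_kernel d 1 \<zeta> / \<kappa>\<bar> else 0) \<partial>lborel_d d)"
    by (rule nn_integral_cmult[symmetric]) measurable
  also have "\<dots> = (\<integral>\<^sup>+\<zeta>. (if point \<eta> \<zeta> \<in> F then ennreal \<bar>num c \<eta> \<zeta> - gauss_kernel d 1 \<zeta>\<bar> else 0) \<partial>lborel_d d)"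
  proof (intro nn_integral_cong)
    fix \<zeta>
    have "\<kappa> * \<bar>c * post_num \<eta> (point \<eta> \<zeta>) - gauss_kernel d 1 \<zeta> / \<kappa>\<bar>
        = \<bar>\<kappa> * (c * post_num \<eta> (point \<eta> \<zeta>) - gauss_kernel d 1 \<zeta> / \<kappa>)\<bar>"
      using kappa(2) by (simp add: abs_mult)
    also have "\<kappa> * (c * post_num \<eta> (point \<eta> \<zeta>) - gauss_kernel d 1 \<zeta> / \<kappa>) = num c \<eta> \<zeta> - gauss_kernel d 1 \<zeta>"
      using kappa(2) by (simp add: num_def right_diff_distrib)
    finally show "ennreal \<kappa> * (if point \<eta> \<zeta> \<in> F then
          ennreal \<bar>c * post_num \<eta> (point \<eta> \<zeta>) - gauss_kernel d 1 \<zeta> / \<kappa>\<bar> else 0)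
        = (if point \<eta> \<zeta> \<in> F then ennreal \<bar>num c \<eta> \<zeta> - gauss_kernel d 1 \<zeta>\<bar> else 0)"
      using kappa(2) by (simp flip: ennreal_mult)
  qed
  finally have 1: "(\<integral>\<^sup>+x. (if x \<in> F then ennreal \<bar>c * post_num \<eta> x - limit_pdf \<eta> x\<bar> else 0) \<partial>lborel_d d)
    = (\<integral>\<^sup>+\<zeta>. (if point \<eta> \<zeta> \<in> F then ennreal \<bar>num c \<eta> \<zeta> - gauss_kernel d 1 \<zeta>\<bar> else 0) \<partial>lborel_d d)" .
  have "(\<integral>\<^sup>+x. (if x \<in> F then 0 else ennreal (limit_pdf \<eta> x)) \<partial>lborel_d d)
      = \<kappa> * (\<integral>\<^sup>+\<zeta>. (if point \<eta> \<zeta> \<in> F then 0 else ennreal (gauss_kernel d 1 \<zeta> / \<kappa>)) \<partial>lborel_d d)"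
    by (subst nn_integral_point[of _ \<eta>]) (simp_all add: limit_pdf_point cong: if_cong)
  also have "\<dots> = (\<integral>\<^sup>+\<zeta>. ennreal \<kappa> * (if point \<eta> \<zeta> \<in> F then 0 else ennreal (gauss_kernel d 1 \<zeta> / \<kappa>)) \<partial>lborel_d d)"
    by (rule nn_integral_cmult[symmetric]) measurable
  also have "\<dots> = (\<integral>\<^sup>+\<zeta>. (if point \<eta> \<zeta> \<in> F then 0 else ennreal (gauss_kernel d 1 \<zeta>)) \<partial>lborel_d d)"
    using kappa(2) by (intro nn_integral_cong) (simp add: gauss_kernel_nonneg flip: ennreal_mult)
  finally have 2: "(\<integral>\<^sup>+x. (if x \<in> F then 0 else ennreal (limit_pdf \<eta> x)) \<partial>lborel_d d)
    = (\<integral>\<^sup>+\<zeta>. (if point \<eta> \<zeta> \<in> F then 0 else ennreal (gauss_kernel d 1 \<zeta>)) \<partial>lborel_d d)" .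
  have "ennreal (dTV \<eta>) \<le>
      2 * (\<integral>\<^sup>+x. (if x \<in> F then ennreal \<bar>c * post_num \<eta> x - limit_pdf \<eta> x\<bar> else 0) \<partial>lborel_d d)
      + (\<integral>\<^sup>+x. (if x \<in> F then 0 else ennreal (limit_pdf \<eta> x)) \<partial>lborel_d d)"
    unfolding dTV_eq
    by (rule L1_dist_normalized_le)
      (auto intro: F_sets integrable_post_num post_num_nonneg post_num_outside limit_pdf_density limit_pdf_nonneg)
  then show ?thesis
    by (simp only: 1 2)
qed

text \<open>The rescaled increment of \<open>G\<close>; for a linear \<open>G\<close> it would be
  exactly \<open>\<eta> + \<zeta>\<close>.\<close>

definition "\<xi> \<eta> \<zeta> k = (G (vec d (point \<eta> \<zeta>)) $ k - G q0 $ k) / s"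

definition "\<omega> \<eta> \<zeta> = Max ((\<lambda>i. \<bar>point \<eta> \<zeta> i - q0 $ i\<bar>) ` {..<d})"

definition "log_prior \<eta> \<zeta> = (\<Sum>i<d. ln (p i (point \<eta> \<zeta> i)) - ln (p i (q0 $ i)))"

text \<open>The choice of \<open>c\<close> that removes the volume factor and the prior density at
  the truth, so that only the relative log-prior, zero at \<open>q0\<close>, and the Gaussian
  prefactor remain.\<close>

definition "norm_const = 1 / (\<kappa> * (\<Prod>i<d. p i (q0 $ i)) * sqrt (2 * pi) ^ d)"

lemma point_space: "point \<eta> \<zeta> \<in> space (lborel_d d)"
  by (auto simp: point_def space_PiM)

lemma le_omega: "i < d \<Longrightarrow> \<bar>point \<eta> \<zeta> i - q0 $ i\<bar> \<le> \<omega> \<eta> \<zeta>"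
  unfolding \<omega>_def by (intro Max_ge) auto

lemma omega_attained:
  obtains i where "i < d" "\<omega> \<eta> \<zeta> = \<bar>point \<eta> \<zeta> i - q0 $ i\<bar>"
proof -
  have "\<omega> \<eta> \<zeta> \<in> (\<lambda>i. \<bar>point \<eta> \<zeta> i - q0 $ i\<bar>) ` {..<d}"
    unfolding \<omega>_def using d by (intro Max_in) (auto simp: lessThan_empty_iff)
  then show ?thesis
    using that by auto
qed

lemma L2_set_J_point:
  "L2_set (\<lambda>i. (J *\<^sub>v (vec d (point \<eta> \<zeta>) - q0)) $ i) {..<d} = s * L2_set (\<lambda>i. \<eta> i + \<zeta> i) {..<d}"
proof -
  have "L2_set (\<lambda>i. (J *\<^sub>v (vec d (point \<eta> \<zeta>) - q0)) $ i) {..<d} = L2_set (\<lambda>i. s * (\<eta> i + \<zeta> i)) {..<d}"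
    by (rule L2_set_cong) (auto simp: J_point)
  then show ?thesis
    using s_pos L2_set_right_distrib[of s "\<lambda>i. \<eta> i + \<zeta> i" "{..<d}"] by simp
qed

lemma coord_le: "i < d \<Longrightarrow> \<bar>point \<eta> \<zeta> i - q0 $ i\<bar> \<le> b * s * L2_set (\<lambda>i. \<eta> i + \<zeta> i) {..<d}"
  using sup_bound[of "vec d (point \<eta> \<zeta>) - q0" i] q0 by (simp add: L2_set_J_point)

lemma inside_conditions:
  assumes in_F: "point \<eta> \<zeta> \<in> F"
  shows "L2_set (\<lambda>i. \<xi> \<eta> \<zeta> i - (\<eta> i + \<zeta> i)) {..<d} \<le> \<omega> \<eta> \<zeta> * L2_set (\<lambda>i. \<eta> i + \<zeta> i) {..<d}"
    and "L2_set (\<lambda>i. \<eta> i + \<zeta> i) {..<d} \<le> (1 + (hi - lo)) * L2_set (\<xi> \<eta> \<zeta>) {..<d}"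
    and "0 \<le> \<omega> \<eta> \<zeta>"
    and "\<omega> \<eta> \<zeta> \<le> b * s * L2_set (\<lambda>i. \<eta> i + \<zeta> i) {..<d}"
    and "\<omega> \<eta> \<zeta> \<le> hi - lo"
    and "\<bar>log_prior \<eta> \<zeta>\<bar> \<le> C * real d * \<omega> \<eta> \<zeta>"
    and "num norm_const \<eta> \<zeta>
      = exp (- (L2_set (\<lambda>i. \<eta> i - \<xi> \<eta> \<zeta> i) {..<d})\<^sup>2 / 2 + log_prior \<eta> \<zeta>) / sqrt (2 * pi) ^ d"
proof -
  let ?q = "vec d (point \<eta> \<zeta>)" and ?z = "\<lambda>i. \<eta> i + \<zeta> i"
  note q = vec_F[OF in_F]
  have pt: "lo \<le> point \<eta> \<zeta> i" "point \<eta> \<zeta> i \<le> hi" if "i < d" for i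
    using q that by auto
  have w: "\<forall>i<d. \<bar>?q $ i - q0 $ i\<bar> \<le> \<omega> \<eta> \<zeta>"
    using le_omega by simp
  note ap = approx[OF vec_carrier q w]
  have "L2_set (\<lambda>i. G ?q $ i - G q0 $ i - (J *\<^sub>v (?q - q0)) $ i) {..<d}
      = L2_set (\<lambda>i. s * (\<xi> \<eta> \<zeta> i - ?z i)) {..<d}"
    using s_pos by (intro L2_set_cong) (auto simp: J_point \<xi>_def field_simps)
  also have "\<dots> = s * L2_set (\<lambda>i. \<xi> \<eta> \<zeta> i - ?z i) {..<d}"
    using s_pos by (simp add: L2_set_right_distrib)
  finally have "s * L2_set (\<lambda>i. \<xi> \<eta> \<zeta> i - ?z i) {..<d} \<le> s * (\<omega> \<eta> \<zeta> * L2_set ?z {..<d})"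
    using ap unfolding L2_set_J_point by (simp add: mult.left_commute)
  then show "L2_set (\<lambda>i. \<xi> \<eta> \<zeta> i - ?z i) {..<d} \<le> \<omega> \<eta> \<zeta> * L2_set ?z {..<d}"
    using s_pos by simp
  obtain i where i: "i < d" "\<omega> \<eta> \<zeta> = \<bar>point \<eta> \<zeta> i - q0 $ i\<bar>"
    by (rule omega_attained)
  show \<omega>0: "0 \<le> \<omega> \<eta> \<zeta>"
    using i by simp
  show "\<omega> \<eta> \<zeta> \<le> b * s * L2_set ?z {..<d}"
    using i coord_le by simp
  show \<omega>W: "\<omega> \<eta> \<zeta> \<le> hi - lo"
    using i pt[of i] q0_box by (auto simp: abs_le_iff)
  have "L2_set (\<lambda>i. G ?q $ i - G q0 $ i) {..<d} = L2_set (\<lambda>i. s * \<xi> \<eta> \<zeta> i) {..<d}"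
    using s_pos by (intro L2_set_cong) (auto simp: \<xi>_def)
  also have "\<dots> = s * L2_set (\<xi> \<eta> \<zeta>) {..<d}"
    using s_pos by (simp add: L2_set_right_distrib)
  finally have "s * L2_set ?z {..<d} \<le> s * ((1 + \<omega> \<eta> \<zeta>) * L2_set (\<xi> \<eta> \<zeta>) {..<d})"
    using ap unfolding L2_set_J_point by (simp add: mult.left_commute)
  then have "L2_set ?z {..<d} \<le> (1 + \<omega> \<eta> \<zeta>) * L2_set (\<xi> \<eta> \<zeta>) {..<d}"
    using s_pos by simp
  \<comment> \<open>On the box \<omega> is at most the side length, so the lower bound on the
    increment of \<open>G\<close> holds with the fixed constant \<open>1 + (hi - lo)\<close>, with
    no smallness of the displacement. The far region needs this.\<close>
  also have "\<dots> \<le> (1 + (hi - lo)) * L2_set (\<xi> \<eta> \<zeta>) {..<d}"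
    using \<omega>W by (intro mult_right_mono) auto
  finally show "L2_set ?z {..<d} \<le> (1 + (hi - lo)) * L2_set (\<xi> \<eta> \<zeta>) {..<d}" .
  have "\<bar>log_prior \<eta> \<zeta>\<bar> \<le> (\<Sum>i<d. \<bar>ln (p i (point \<eta> \<zeta> i)) - ln (p i (q0 $ i))\<bar>)"
    unfolding log_prior_def by (rule sum_abs)
  also have "\<dots> \<le> (\<Sum>i<d. C * \<omega> \<eta> \<zeta>)"
  proof (intro sum_mono)
    fix i assume "i \<in> {..<d}"
    then have i: "i < d"
      by simp
    have "\<bar>ln (p i (point \<eta> \<zeta> i)) - ln (p i (q0 $ i))\<bar> \<le> C * \<bar>point \<eta> \<zeta> i - q0 $ i\<bar>"
      using i pt q0_box by (intro p_lip) auto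
    also have "\<dots> \<le> C * \<omega> \<eta> \<zeta>"
      using le_omega[OF i] C by (intro mult_left_mono)
    finally show "\<bar>ln (p i (point \<eta> \<zeta> i)) - ln (p i (q0 $ i))\<bar> \<le> C * \<omega> \<eta> \<zeta>" .
  qed
  finally show "\<bar>log_prior \<eta> \<zeta>\<bar> \<le> C * real d * \<omega> \<eta> \<zeta>"
    by (simp add: mult_ac)
  have prior: "(\<Prod>i<d. p i (point \<eta> \<zeta> i)) = (\<Prod>i<d. p i (q0 $ i)) * exp (log_prior \<eta> \<zeta>)"
  proof -
    have "p i (point \<eta> \<zeta> i) = p i (q0 $ i) * exp (ln (p i (point \<eta> \<zeta> i)) - ln (p i (q0 $ i)))"
      if "i < d" for i
    proof -
      have "p i (point \<eta> \<zeta> i) > 0" "p i (q0 $ i) > 0"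
        using that pt q0_box by (auto intro!: p_pos)
      then show ?thesis
        by (simp add: exp_diff)
    qed
    then show ?thesis
      unfolding log_prior_def by (simp add: exp_sum flip: prod.distrib)
  qed
  have "real n * (\<Sum>k<d. (G q0 $ k + s * \<eta> k - G_box (point \<eta> \<zeta>) k)\<^sup>2)
      = (\<Sum>k<d. real n * s\<^sup>2 * (\<eta> k - \<xi> \<eta> \<zeta> k)\<^sup>2)"
    unfolding sum_distrib_left
  proof (intro sum.cong refl)
    fix k
    have "G q0 $ k + s * \<eta> k - G_box (point \<eta> \<zeta>) k = s * (\<eta> k - \<xi> \<eta> \<zeta> k)"
    proof -
      have "s * \<xi> \<eta> \<zeta> k = G ?q $ k - G q0 $ k"
        using s_pos by (simp add: \<xi>_def)
      then show ?thesis
        using in_F by (simp add: G_box_def right_diff_distrib)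
    qed
    then show "real n * (G q0 $ k + s * \<eta> k - G_box (point \<eta> \<zeta>) k)\<^sup>2 = real n * s\<^sup>2 * (\<eta> k - \<xi> \<eta> \<zeta> k)\<^sup>2"
      by (simp add: power_mult_distrib)
  qed
  also have "\<dots> = (L2_set (\<lambda>i. \<eta> i - \<xi> \<eta> \<zeta> i) {..<d})\<^sup>2"
    by (simp only: s_sq(2) L2_set_power2 mult_1)
  finally have quad: "- (real n / 2) * (\<Sum>k<d. (G q0 $ k + s * \<eta> k - G_box (point \<eta> \<zeta>) k)\<^sup>2)
      = - (L2_set (\<lambda>i. \<eta> i - \<xi> \<eta> \<zeta> i) {..<d})\<^sup>2 / 2"
    by simp
  have cancel: "\<kappa> * (1 / (\<kappa> * Q * S)) * (u * (Q * v)) = u * v / S" if "Q > 0" for Q S u v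
    using that kappa(2) by simp
  have "(\<Prod>i<d. p i (q0 $ i)) > 0"
    using q0_box by (intro prod_pos) (auto intro!: p_pos)
  then show "num norm_const \<eta> \<zeta>
      = exp (- (L2_set (\<lambda>i. \<eta> i - \<xi> \<eta> \<zeta> i) {..<d})\<^sup>2 / 2 + log_prior \<eta> \<zeta>) / sqrt (2 * pi) ^ d"
    unfolding num_def norm_const_def post_num_eq[OF point_space] quad prior exp_add by (rule cancel)
qed

lemma outside_condition:
  assumes "point \<eta> \<zeta> \<notin> F"
  shows "r \<le> b * s * L2_set (\<lambda>i. \<eta> i + \<zeta> i) {..<d}"
proof -
  obtain i where i: "i < d" "point \<eta> \<zeta> i \<notin> {lo..hi}"
    by (rule not_in_F[OF point_space assms])
  then have "r \<le> \<bar>point \<eta> \<zeta> i - q0 $ i\<bar>"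
    using q0_in[OF i(1)] by (auto simp: abs_if)
  then show ?thesis
    using coord_le[OF i(1), of \<eta> \<zeta>] by linarith
qed

end

section \<open>Linearization of an elliptic scheme\<close>

lemma gaussian_regression_dTV_bound:
  fixes M C lo hi r :: real
  assumes "M \<ge> 0" "C \<ge> 0" "lo \<le> hi" "r > 0"
  obtains Ct e0 :: real where "Ct > 0" "e0 > 0"
    "\<And>d n J Jinv G q0 p b \<eta>. gaussian_regression d n J Jinv G q0 p lo hi b C r \<Longrightarrow>
      b * (real d)\<^sup>2 / sqrt (real n) \<le> e0 \<Longrightarrow> (L2_set \<eta> {..<d})\<^sup>2 \<le> M * real d \<Longrightarrow>
      dTV_box d lo hi (posterior_pdf d n G p (data_vec n G q0 (vec d \<eta>)))
        (gaussian_pdf d (Delta_vec d n G q0 (vec d \<eta>)) ((1 / real n) \<cdot>\<^sub>m Sigma_mat d G q0))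
      \<le> Ct * (b * (real d)\<^sup>2 / sqrt (real n))"
proof -
  have K: "1 + (hi - lo) \<ge> 1" "hi - lo \<ge> 0"
    using assms by simp_all
  show thesis
  proof (rule gauss_perturbation_integral[OF assms(1,2) K assms(4)], goal_cases)
    case (1 Ct e0)
    note Ct = 1(1,2) and bound = 1(3)
    show thesis
    proof (rule that[OF Ct])
      fix d n J Jinv G q0 p b and \<eta> :: "nat \<Rightarrow> real"
      assume "gaussian_regression d n J Jinv G q0 p lo hi b C r"
        and small: "b * (real d)\<^sup>2 / sqrt (real n) \<le> e0" and \<eta>: "(L2_set \<eta> {..<d})\<^sup>2 \<le> M * real d"
      then interpret gaussian_regression d n J Jinv G q0 p lo hi b C r
        by simp
      have e: "b * (real d)\<^sup>2 / sqrt (real n) = b * s * (real d)\<^sup>2"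
        by (simp add: s_def)
      have "ennreal (dTV \<eta>) \<le> ennreal (Ct * (b * s * (real d)\<^sup>2))"
      proof (rule order_trans[OF dTV_le_integrals[of \<eta> norm_const]],
          rule bound[where \<eta> = \<eta> and \<xi> = "\<xi> \<eta>" and \<omega> = "\<omega> \<eta>" and P = "log_prior \<eta>"])
        show "b * s * (real d)\<^sup>2 \<le> e0"
          using small by (simp only: e)
        show "b * s > 0"
          using b s_pos by simp
      qed (intro conjI inside_conditions outside_condition d \<eta> | assumption)+
      moreover have "Ct * (b * s * (real d)\<^sup>2) \<ge> 0"
        using Ct b s_pos by simp
      ultimately show "dTV_box d lo hi (posterior_pdf d n G p (data_vec n G q0 (vec d \<eta>)))
          (gaussian_pdf d (Delta_vec d n G q0 (vec d \<eta>)) ((1 / real n) \<cdot>\<^sub>m Sigma_mat d G q0))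
        \<le> Ct * (b * (real d)\<^sup>2 / sqrt (real n))"
        unfolding e dTV_def[symmetric] by (simp add: ennreal_le_iff)
    qed
  qed
qed

text \<open>Leibniz formula: the determinant is a polynomial in the entries.\<close>

lemma det_mat_measurable:
  assumes "\<And>i j. i < d \<Longrightarrow> j < d \<Longrightarrow> (\<lambda>x. E x i j) \<in> borel_measurable M"
  shows "(\<lambda>x. det (mat d d (\<lambda>(i, j). E x i j :: real))) \<in> borel_measurable M"
proof -
  have "det (mat d d (\<lambda>(i, j). E x i j))
      = (\<Sum>p\<in>{p. p permutes {0..<d}}. signof p * (\<Prod>i = 0..<d. E x i (p i)))" for x
    by (subst det_def'[of _ d])
      (auto intro!: sum.cong prod.cong arg_cong2[of _ _ _ _ "(*)"] dest: permutes_in_image)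
  moreover have "(\<lambda>x. \<Prod>i = 0..<d. E x i (p i)) \<in> borel_measurable M" if "p permutes {0..<d}" for p
    using permutes_in_image[OF that] by (intro borel_measurable_prod assms) auto
  ultimately show ?thesis
    by (auto intro!: borel_measurable_sum borel_measurable_times)
qed

text \<open>Links the quantitative linearization bound to \<open>deriv\<close>, in terms of which
  \<open>jacobian\<close> is defined.\<close>

lemma has_field_derivative_of_quadratic_error:
  fixes f :: "real \<Rightarrow> real"
  assumes "\<forall>\<^sub>F t in at x. \<bar>f t - f x - (t - x) * D\<bar> \<le> c * (t - x)\<^sup>2"
  shows "(f has_field_derivative D) (at x)"
  unfolding has_field_derivative_iff
proof (rule LIM_zero_cancel, rule Lim_null_comparison)
  show "\<forall>\<^sub>F t in at x. norm ((f t - f x) / (t - x) - D) \<le> c * \<bar>t - x\<bar>"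
    using assms eventually_neq_at_within[of x x UNIV]
  proof eventually_elim
    case (elim t)
    have "(f t - f x) / (t - x) - D = (f t - f x - (t - x) * D) / (t - x)"
      using elim by (simp add: field_simps)
    then have "norm ((f t - f x) / (t - x) - D) = \<bar>f t - f x - (t - x) * D\<bar> / \<bar>t - x\<bar>"
      by simp
    also have "\<dots> \<le> c * (t - x)\<^sup>2 / \<bar>t - x\<bar>"
      using elim by (intro divide_right_mono) auto
    also have "\<dots> = c * \<bar>t - x\<bar>"
    proof -
      have "c * h\<^sup>2 / h = c * h" if "h \<noteq> 0" for h :: real
        using that by (simp add: power2_eq_square)
      from this[of "\<bar>t - x\<bar>"] show ?thesis
        using elim by simp
    qed
    finally show ?case .
  qed
  show "((\<lambda>t. c * \<bar>t - x\<bar>) \<longlongrightarrow> 0) (at x)"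
    by (auto intro!: tendsto_eq_intros)
qed

definition diag :: "nat \<Rightarrow> (nat \<Rightarrow> real) \<Rightarrow> real mat" where
  "diag d x = mat d d (\<lambda>(i, j). if i = j then x i else 0)"

lemma diag_carrier [simp]: "diag d x \<in> carrier_mat d d"
  by (simp add: diag_def)

lemma diag_dim [simp]: "dim_row (diag d x) = d" "dim_col (diag d x) = d"
  by (simp_all add: diag_def)

lemma diag_mult_vec:
  assumes "v \<in> carrier_vec d" "i < d"
  shows "(diag d x *\<^sub>v v) $ i = x i * v $ i"
proof -
  have "(diag d x *\<^sub>v v) $ i = (\<Sum>j\<in>{0..<d}. (if i = j then x i else 0) * v $ j)"
    using assms by (simp add: diag_def scalar_prod_def)
  also have "\<dots> = (\<Sum>j\<in>{0..<d}. if i = j then x i * v $ j else 0)"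
    by (intro sum.cong) auto
  finally show ?thesis
    using assms by simp
qed

lemma diag_mult_inverse:
  assumes "\<And>i. i < d \<Longrightarrow> x i * y i = 1"
  shows "diag d x * diag d y = 1\<^sub>m d"
proof (rule eq_matI)
  fix i j assume ij: "i < dim_row (1\<^sub>m d :: real mat)" "j < dim_col (1\<^sub>m d :: real mat)"
  then have "(diag d x * diag d y) $$ (i, j) = (diag d x *\<^sub>v col (diag d y) j) $ i"
    by (simp add: diag_def)
  also have "\<dots> = x i * col (diag d y) j $ i"
    using ij by (intro diag_mult_vec) (auto simp: diag_def)
  finally show "(diag d x * diag d y) $$ (i, j) = 1\<^sub>m d $$ (i, j)"
    using ij assms by (auto simp: diag_def)
qed (simp_all add: diag_def)

text \<open>The coercivity constant is normalized to 1, which the discrete Laplacian on the unit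
  square attains for every mesh size. \<open>G\<close> is described only for nonnegative
  coefficients, where the equation is uniquely solvable.\<close>

locale elliptic_scheme =
  fixes d :: nat and A :: "real mat" and f :: "real vec" and G :: "real vec \<Rightarrow> real vec"
  assumes A: "A \<in> carrier_mat d d" and f: "f \<in> carrier_vec d"
    and coercive: "\<And>v. v \<in> carrier_vec d \<Longrightarrow>
      (\<Sum>i<d. (v $ i)\<^sup>2) \<le> (\<Sum>i<d. v $ i * (A *\<^sub>v v) $ i)"
    and G: "\<And>q. q \<in> carrier_vec d \<Longrightarrow> \<forall>i<d. q $ i \<ge> 0 \<Longrightarrow>
      G q = (THE u. u \<in> carrier_vec d \<and> (A + diag d (\<lambda>i. q $ i)) *\<^sub>v u = f)"
begin

definition "L q = A + diag d (\<lambda>i. q $ i)"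

lemma L_carrier [simp]: "L q \<in> carrier_mat d d"
  using A by (simp add: L_def)

lemma L_dim [simp]: "dim_row (L q) = d" "dim_col (L q) = d"
  by (simp_all add: L_def)

lemma L_mult_vec:
  assumes "v \<in> carrier_vec d" "i < d"
  shows "(L q *\<^sub>v v) $ i = (A *\<^sub>v v) $ i + q $ i * v $ i"
proof -
  have "L q *\<^sub>v v = A *\<^sub>v v + diag d (\<lambda>i. q $ i) *\<^sub>v v"
    using A assms unfolding L_def by (intro add_mult_distrib_mat_vec) auto
  then show ?thesis
    using assms by (simp add: diag_mult_vec del: index_mult_mat_vec)
qed

lemma L_coercive:
  assumes v: "v \<in> carrier_vec d" and q: "\<forall>i<d. q $ i \<ge> 0"
  shows "(\<Sum>i<d. (v $ i)\<^sup>2) \<le> (\<Sum>i<d. v $ i * (L q *\<^sub>v v) $ i)"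
proof -
  have "(\<Sum>i<d. v $ i * (L q *\<^sub>v v) $ i) = (\<Sum>i<d. v $ i * (A *\<^sub>v v) $ i) + (\<Sum>i<d. q $ i * (v $ i)\<^sup>2)"
    using v by (simp add: L_mult_vec distrib_left sum.distrib power2_eq_square mult_ac del: index_mult_mat_vec)
  moreover have "(\<Sum>i<d. q $ i * (v $ i)\<^sup>2) \<ge> 0"
    using q by (intro sum_nonneg) auto
  ultimately show ?thesis
    using coercive[OF v] by linarith
qed

text \<open>Energy estimate: coercivity and Cauchy-Schwarz, then division by the norm of
  \<open>v\<close>.\<close>

lemma L2_set_le_L:
  assumes v: "v \<in> carrier_vec d" and q: "\<forall>i<d. q $ i \<ge> 0"
  shows "L2_set (\<lambda>i. v $ i) {..<d} \<le> L2_set (\<lambda>i. (L q *\<^sub>v v) $ i) {..<d}"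
proof -
  let ?a = "L2_set (\<lambda>i. v $ i) {..<d}" and ?b = "L2_set (\<lambda>i. (L q *\<^sub>v v) $ i) {..<d}"
  have "?a\<^sup>2 \<le> (\<Sum>i<d. v $ i * (L q *\<^sub>v v) $ i)"
    using L_coercive[OF assms] by (simp only: L2_set_power2)
  also have "\<dots> \<le> (\<Sum>i<d. \<bar>v $ i\<bar> * \<bar>(L q *\<^sub>v v) $ i\<bar>)"
    by (intro sum_mono) (simp flip: abs_mult)
  also have "\<dots> \<le> ?a * ?b"
    by (rule L2_set_mult_ineq)
  finally have "?a * ?a \<le> ?a * ?b"
    by (simp only: power2_eq_square)
  then show ?thesis
    using L2_set_nonneg[of "\<lambda>i. v $ i" "{..<d}"] by (cases "?a = 0") (simp_all add: less_le)
qed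

lemma L_definite:
  assumes v: "v \<in> carrier_vec d" and q: "\<forall>i<d. q $ i \<ge> 0" and 0: "v \<bullet> (L q *\<^sub>v v) = 0"
  shows "v = 0\<^sub>v d"
proof (rule scalar_prod_self_eq_0[OF v])
  have "v \<bullet> (L q *\<^sub>v v) = (\<Sum>i<d. v $ i * (L q *\<^sub>v v) $ i)"
    by (simp add: scalar_prod_def[of v] lessThan_atLeast0 del: index_mult_mat_vec)
  then have "(\<Sum>i<d. (v $ i)\<^sup>2) \<le> 0"
    using L_coercive[OF v q] 0 by simp
  then show "v \<bullet> v = 0"
    using scalar_prod_self_L2_set[OF v] sum_nonneg[of "{..<d}" "\<lambda>i. (v $ i)\<^sup>2"] by (simp add: L2_set_power2)
qed

lemma L_inverse:
  assumes q: "\<forall>i<d. q $ i \<ge> 0"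
  obtains C where "C \<in> carrier_mat d d" "L q * C = 1\<^sub>m d" "C * L q = 1\<^sub>m d" "det (L q) \<noteq> 0"
proof (rule ex_inverse_of_injective[OF L_carrier])
  fix v assume v: "v \<in> carrier_vec d" and "L q *\<^sub>v v = 0\<^sub>v d"
  then show "v = 0\<^sub>v d"
    by (intro L_definite[OF v q]) simp
qed

lemma G_solves:
  assumes q: "q \<in> carrier_vec d" "\<forall>i<d. q $ i \<ge> 0"
  shows "G q \<in> carrier_vec d" "L q *\<^sub>v G q = f"
proof -
  obtain C where C: "C \<in> carrier_mat d d" "L q * C = 1\<^sub>m d" "C * L q = 1\<^sub>m d"
    using L_inverse[OF q(2)] by metis
  have "\<exists>!u. u \<in> carrier_vec d \<and> L q *\<^sub>v u = f"
  proof (intro ex1I[of _ "C *\<^sub>v f"] conjI)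
    show "C *\<^sub>v f \<in> carrier_vec d"
      using C f by simp
    show "L q *\<^sub>v (C *\<^sub>v f) = f"
      using C(2) f assoc_mult_mat_vec[OF L_carrier C(1) f, of q] by simp
    fix u assume u: "u \<in> carrier_vec d \<and> L q *\<^sub>v u = f"
    then show "u = C *\<^sub>v f"
      using C(3) assoc_mult_mat_vec[OF C(1) L_carrier, of u q] by auto
  qed
  from theI'[OF this] show "G q \<in> carrier_vec d" "L q *\<^sub>v G q = f"
    unfolding G[OF q] L_def by auto
qed

text \<open>Both solutions have the same right-hand side \<open>f\<close>, and the two operators
  differ by a diagonal matrix.\<close>

lemma L_G_diff:
  assumes q: "q \<in> carrier_vec d" "\<forall>i<d. q $ i \<ge> 0" and q': "q' \<in> carrier_vec d" "\<forall>i<d. q' $ i \<ge> 0"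
    and i: "i < d"
  shows "(L q *\<^sub>v (G q - G q')) $ i = - ((q $ i - q' $ i) * G q' $ i)"
proof -
  note G = G_solves[OF q] and G' = G_solves[OF q']
  have "L q *\<^sub>v (G q - G q') = L q *\<^sub>v G q - L q *\<^sub>v G q'"
    using G G' by (intro mult_minus_distrib_mat_vec[of _ d d]) auto
  then have "(L q *\<^sub>v (G q - G q')) $ i = f $ i - (L q *\<^sub>v G q') $ i"
    using G(2) i L_carrier[of q] by (simp del: index_mult_mat_vec)
  also have "f $ i = (A *\<^sub>v G q') $ i + q' $ i * G q' $ i"
    using G'(2) L_mult_vec[OF G'(1) i, of q'] by simp
  finally show ?thesis
    using L_mult_vec[OF G'(1) i, of q] by (simp add: algebra_simps)
qed

text \<open>By Cramer's rule each component is a quotient of determinants that are polynomials in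
  the coefficients; coercivity keeps the denominator away from zero on the box.\<close>

lemma measurable_G:
  assumes lo: "lo \<ge> 0" and k: "k < d"
  shows "(\<lambda>x. if x \<in> PiE {..<d} (\<lambda>_. {lo..hi}) then G (vec d x) $ k else 0) \<in> borel_measurable (lborel_d d)"
proof -
  let ?F = "PiE {..<d} (\<lambda>_. {lo..hi})"
  have F [measurable]: "?F \<in> sets (lborel_d d)"
    by (intro sets_PiM_I_finite) auto
  define E where "E x i j = A $$ (i, j) + (if i = j then x i else 0)" for x :: "nat \<Rightarrow> real" and i j
  define E' where "E' x i j = (if j = k then f $ i else E x i j)" for x :: "nat \<Rightarrow> real" and i j
  have comp: "(\<lambda>x. x i) \<in> borel_measurable (lborel_d d)" if "i < d" for i
    by (rule measurable_component_borel) (use that in auto)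
  have E: "(\<lambda>x. E x i j) \<in> borel_measurable (lborel_d d)" if "i < d" for i j
    using comp[OF that] by (cases "i = j") (simp_all add: E_def)
  then have E': "(\<lambda>x. E' x i j) \<in> borel_measurable (lborel_d d)" if "i < d" for i j
    using that by (cases "j = k") (simp_all add: E'_def)
  note [measurable] = det_mat_measurable[of d E "lborel_d d", OF E] det_mat_measurable[of d E' "lborel_d d", OF E']
  have "(\<lambda>x. if x \<in> ?F then det (mat d d (\<lambda>(i, j). E' x i j)) / det (mat d d (\<lambda>(i, j). E x i j)) else 0)
      \<in> borel_measurable (lborel_d d)"
    by measurable
  moreover have "G (vec d x) $ k = det (mat d d (\<lambda>(i, j). E' x i j)) / det (mat d d (\<lambda>(i, j). E x i j))"
    if x: "x \<in> ?F" for x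
  proof -
    have q: "vec d x \<in> carrier_vec d" "\<forall>i<d. vec d x $ i \<ge> 0"
      using x lo by (auto simp: PiE_def Pi_def intro: order_trans)
    have Lx: "L (vec d x) = mat d d (\<lambda>(i, j). E x i j)"
      using A by (intro eq_matI) (auto simp: L_def diag_def E_def)
    have "replace_col (L (vec d x)) f k = mat d d (\<lambda>(i, j). E' x i j)"
      unfolding Lx by (intro eq_matI) (auto simp: replace_col_def E'_def)
    moreover have "det (L (vec d x)) \<noteq> 0"
      using L_inverse[OF q(2)] by metis
    ultimately show ?thesis
      using cramer_lemma_mat[OF L_carrier G_solves(1)[OF q] k, of "vec d x"] G_solves(2)[OF q]
      by (simp add: Lx)
  qed
  ultimately show ?thesis
    by (simp cong: if_cong)
qed

end

lemma L2_set_mult_le: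
  assumes "\<And>i. i \<in> A \<Longrightarrow> \<bar>w i\<bar> \<le> \<omega>" "\<omega> \<ge> 0"
  shows "L2_set (\<lambda>i. w i * y i) A \<le> \<omega> * L2_set y A"
proof -
  have "L2_set (\<lambda>i. w i * y i) A = L2_set (\<lambda>i. \<bar>w i * y i\<bar>) A"
    by (simp add: L2_set_def)
  also have "\<dots> \<le> L2_set (\<lambda>i. \<omega> * \<bar>y i\<bar>) A"
    using assms by (intro L2_set_mono) (auto simp: abs_mult intro: mult_right_mono)
  also have "\<dots> = \<omega> * L2_set y A"
    using L2_set_right_distrib[OF assms(2), of "\<lambda>i. \<bar>y i\<bar>" A] by (simp add: L2_set_def)
  finally show ?thesis .
qed

lemma (in elliptic_scheme) linearization:
  fixes q0 :: "real vec" and c R Q :: real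
  assumes q0: "q0 \<in> carrier_vec d" and q0_pos: "\<And>i. i < d \<Longrightarrow> q0 $ i > 0"
    and q0_Q: "\<And>i. i < d \<Longrightarrow> q0 $ i \<le> Q"
    and c: "c > 0" and G_ge: "\<And>i. i < d \<Longrightarrow> G q0 $ i \<ge> c"
    and R: "\<And>v i. v \<in> carrier_vec d \<Longrightarrow> i < d \<Longrightarrow> \<bar>(A *\<^sub>v v) $ i\<bar> \<le> R * L2_set (\<lambda>i. v $ i) {..<d}"
  obtains J Jinv where
    "J \<in> carrier_mat d d" "Jinv \<in> carrier_mat d d" "J * Jinv = 1\<^sub>m d" "jacobian d G q0 = J"
    "transforms_lborel d Jinv"
    "\<And>q \<omega>. q \<in> carrier_vec d \<Longrightarrow> \<forall>i<d. 0 \<le> q $ i \<Longrightarrow> \<forall>i<d. \<bar>q $ i - q0 $ i\<bar> \<le> \<omega> \<Longrightarrow> \<omega> \<ge> 0 \<Longrightarrow>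
      L2_set (\<lambda>i. G q $ i - G q0 $ i - (J *\<^sub>v (q - q0)) $ i) {..<d}
        \<le> \<omega> * L2_set (\<lambda>i. (J *\<^sub>v (q - q0)) $ i) {..<d}"
    "\<And>q \<omega>. q \<in> carrier_vec d \<Longrightarrow> \<forall>i<d. 0 \<le> q $ i \<Longrightarrow> \<forall>i<d. \<bar>q $ i - q0 $ i\<bar> \<le> \<omega> \<Longrightarrow> \<omega> \<ge> 0 \<Longrightarrow>
      L2_set (\<lambda>i. (J *\<^sub>v (q - q0)) $ i) {..<d} \<le> (1 + \<omega>) * L2_set (\<lambda>i. G q $ i - G q0 $ i) {..<d}"
    "\<And>w i. w \<in> carrier_vec d \<Longrightarrow> i < d \<Longrightarrow> \<bar>w $ i\<bar> \<le> (R + Q) / c * L2_set (\<lambda>i. (J *\<^sub>v w) $ i) {..<d}"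
proof -
  have q0_nn: "\<forall>i<d. q0 $ i \<ge> 0"
    using q0_pos by (auto intro: less_imp_le)
  note G0 = G_solves[OF q0 q0_nn]
  have u_pos: "G q0 $ i > 0" if "i < d" for i
    using G_ge[OF that] c by linarith
  obtain C where C: "C \<in> carrier_mat d d" "L q0 * C = 1\<^sub>m d" "C * L q0 = 1\<^sub>m d"
    by (rule L_inverse[OF q0_nn])
  \<comment> \<open>Differentiating the equation in \<open>q\<close> along \<open>w\<close> gives
    \<open>L q0 (J w) = - w G(q0)\<close> componentwise, hence these explicit factors. The lower
    bound on \<open>G q0\<close> makes the diagonal one invertible.\<close>
  define Du where "Du = diag d (\<lambda>i. - G q0 $ i)"
  define Di where "Di = diag d (\<lambda>i. - 1 / G q0 $ i)"
  define J where "J = C * Du"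
  define Jinv where "Jinv = Di * L q0"
  have Du [simp]: "Du \<in> carrier_mat d d" and Di [simp]: "Di \<in> carrier_mat d d"
    by (simp_all add: Du_def Di_def)
  have J: "J \<in> carrier_mat d d" and Jinv: "Jinv \<in> carrier_mat d d"
    unfolding J_def Jinv_def by (rule mult_carrier_mat[OF C(1) Du], rule mult_carrier_mat[OF Di L_carrier])
  have "Du * Di = 1\<^sub>m d"
    unfolding Du_def Di_def by (rule diag_mult_inverse) (use u_pos in \<open>auto simp: less_imp_neq[symmetric]\<close>)
  then have "Du * Jinv = L q0"
    unfolding Jinv_def using assoc_mult_mat[OF Du Di L_carrier, of q0] left_mult_one_mat[OF L_carrier, of q0] by simp
  then have JJinv: "J * Jinv = 1\<^sub>m d"
    unfolding J_def using assoc_mult_mat[OF C(1) Du Jinv] C(3) by simp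
  have JinvJ: "Jinv * J = 1\<^sub>m d"
    by (rule mat_mult_left_right_inverse[OF J Jinv JJinv])
  \<comment> \<open>The diagonal factor is negative definite; the substitution rule only asks that
    its quadratic form vanish nowhere but at zero.\<close>
  have "transforms_lborel d Di"
  proof (rule transforms_lborel_definite[OF Di])
    fix v assume v: "v \<in> carrier_vec d" and 0: "v \<bullet> (Di *\<^sub>v v) = 0"
    have "v \<bullet> (Di *\<^sub>v v) = (\<Sum>i<d. v $ i * (Di *\<^sub>v v) $ i)"
      using carrier_matD[OF Di] by (simp add: scalar_prod_def[of v] lessThan_atLeast0 del: index_mult_mat_vec)
    also have "\<dots> = (\<Sum>i<d. - ((v $ i)\<^sup>2 / G q0 $ i))"
      using v by (intro sum.cong refl) (simp add: Di_def diag_mult_vec power2_eq_square del: index_mult_mat_vec)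
    finally have "(\<Sum>i<d. (v $ i)\<^sup>2 / G q0 $ i) = 0"
      using 0 by (simp add: sum_negf)
    then have "\<forall>i\<in>{..<d}. (v $ i)\<^sup>2 / G q0 $ i = 0"
      by (subst (asm) sum_nonneg_eq_0_iff) (auto intro!: divide_nonneg_pos u_pos)
    then have "v $ i = 0" if "i < d" for i
      using that u_pos[OF that] by auto
    then show "v = 0\<^sub>v d"
      using v by (intro eq_vecI) auto
  qed
  moreover have "transforms_lborel d (L q0)"
    by (rule transforms_lborel_definite[OF L_carrier]) (rule L_definite[OF _ q0_nn])
  ultimately have transf: "transforms_lborel d Jinv"
    unfolding Jinv_def by (intro transforms_lborel_mult) auto
  have Jw: "J *\<^sub>v w \<in> carrier_vec d" if "w \<in> carrier_vec d" for w
    by (rule mult_mat_vec_carrier[OF J that])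
  have LJ: "(L q0 *\<^sub>v (J *\<^sub>v w)) $ i = - (w $ i * G q0 $ i)" if w: "w \<in> carrier_vec d" and i: "i < d" for w i
  proof -
    have Dw: "Du *\<^sub>v w \<in> carrier_vec d"
      by (rule mult_mat_vec_carrier[OF Du w])
    have "L q0 *\<^sub>v (J *\<^sub>v w) = L q0 *\<^sub>v (C *\<^sub>v (Du *\<^sub>v w))"
      unfolding J_def using assoc_mult_mat_vec[OF C(1) Du w] by simp
    also have "\<dots> = Du *\<^sub>v w"
      using assoc_mult_mat_vec[OF L_carrier C(1) Dw, of q0] C(2) Dw by simp
    finally show ?thesis
      using w i by (simp add: Du_def diag_mult_vec del: index_mult_mat_vec)
  qed

  have err1: "L2_set (\<lambda>i. G q $ i - G q0 $ i - (J *\<^sub>v (q - q0)) $ i) {..<d}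
        \<le> \<omega> * L2_set (\<lambda>i. (J *\<^sub>v (q - q0)) $ i) {..<d}"
    and err2: "L2_set (\<lambda>i. (J *\<^sub>v (q - q0)) $ i) {..<d} \<le> (1 + \<omega>) * L2_set (\<lambda>i. G q $ i - G q0 $ i) {..<d}"
    if q: "q \<in> carrier_vec d" "\<forall>i<d. 0 \<le> q $ i" and w: "\<forall>i<d. \<bar>q $ i - q0 $ i\<bar> \<le> \<omega>" and \<omega>: "\<omega> \<ge> 0" for q \<omega>
  proof -
    note Gq = G_solves[OF q]
    define y where "y = J *\<^sub>v (q - q0)"
    define D where "D = G q - G q0"
    have y: "y \<in> carrier_vec d" and D: "D \<in> carrier_vec d"
      using Jw[of "q - q0"] q q0 Gq G0 by (auto simp: y_def D_def)
    have Ly: "(L q0 *\<^sub>v y) $ i = - ((q $ i - q0 $ i) * G q0 $ i)" if "i < d" for i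
      unfolding y_def using LJ[of "q - q0" i] that q q0 by simp
    have LD: "(L q *\<^sub>v D) $ i = - ((q $ i - q0 $ i) * G q0 $ i)" if "i < d" for i
      unfolding D_def by (rule L_G_diff[OF q q0 q0_nn that])
    have "(L q *\<^sub>v (D - y)) $ i = - ((q $ i - q0 $ i) * y $ i)" if i: "i < d" for i
    proof -
      have "(L q *\<^sub>v (D - y)) $ i = (L q *\<^sub>v D) $ i - (L q *\<^sub>v y) $ i"
        using mult_minus_distrib_mat_vec[OF L_carrier D y, of q] i by (simp del: index_mult_mat_vec)
      then show ?thesis
        using LD[OF i] Ly[OF i] L_mult_vec[OF y i, of q] L_mult_vec[OF y i, of q0] by (simp add: algebra_simps)
    qed
    then have "L2_set (\<lambda>i. (L q *\<^sub>v (D - y)) $ i) {..<d} = L2_set (\<lambda>i. (q $ i - q0 $ i) * y $ i) {..<d}"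
      by (subst L2_set_uminus[symmetric]) (intro L2_set_cong, auto)
    also have "\<dots> \<le> \<omega> * L2_set (\<lambda>i. y $ i) {..<d}"
      using w \<omega> by (intro L2_set_mult_le) auto
    finally have "L2_set (\<lambda>i. (D - y) $ i) {..<d} \<le> \<omega> * L2_set (\<lambda>i. y $ i) {..<d}"
      using L2_set_le_L[OF _ q(2), of "D - y"] D y by simp
    moreover have "L2_set (\<lambda>i. (D - y) $ i) {..<d} = L2_set (\<lambda>i. G q $ i - G q0 $ i - y $ i) {..<d}"
      using D y G0 by (intro L2_set_cong) (auto simp: D_def)
    ultimately show "L2_set (\<lambda>i. G q $ i - G q0 $ i - (J *\<^sub>v (q - q0)) $ i) {..<d}
        \<le> \<omega> * L2_set (\<lambda>i. (J *\<^sub>v (q - q0)) $ i) {..<d}"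
      by (simp only: y_def)
    \<comment> \<open>Testing with \<open>L q0\<close> instead of \<open>L q\<close> puts
      \<open>D\<close> rather than \<open>y\<close> on the right. The first estimate alone would
      give \<open>|y| <= |D| + \<omega> |y|\<close>, which is void once \<omega> reaches 1.\<close>
    have "(L q0 *\<^sub>v (y - D)) $ i = (q $ i - q0 $ i) * D $ i" if i: "i < d" for i
    proof -
      have "(L q0 *\<^sub>v (y - D)) $ i = (L q0 *\<^sub>v y) $ i - (L q0 *\<^sub>v D) $ i"
        using mult_minus_distrib_mat_vec[OF L_carrier y D, of q0] i by (simp del: index_mult_mat_vec)
      then show ?thesis
        using LD[OF i] Ly[OF i] L_mult_vec[OF D i, of q] L_mult_vec[OF D i, of q0] by (simp add: algebra_simps)
    qed
    then have "L2_set (\<lambda>i. (L q0 *\<^sub>v (y - D)) $ i) {..<d} = L2_set (\<lambda>i. (q $ i - q0 $ i) * D $ i) {..<d}"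
      by (intro L2_set_cong) auto
    also have "\<dots> \<le> \<omega> * L2_set (\<lambda>i. D $ i) {..<d}"
      using w \<omega> by (intro L2_set_mult_le) auto
    finally have "L2_set (\<lambda>i. (y - D) $ i) {..<d} \<le> \<omega> * L2_set (\<lambda>i. D $ i) {..<d}"
      using L2_set_le_L[OF _ q0_nn, of "y - D"] D y by simp
    moreover have "L2_set (\<lambda>i. (y - D) $ i) {..<d} = L2_set (\<lambda>i. y $ i - D $ i) {..<d}"
      using D y by (intro L2_set_cong) auto
    ultimately have "L2_set (\<lambda>i. y $ i) {..<d} \<le> (1 + \<omega>) * L2_set (\<lambda>i. D $ i) {..<d}"
      using L2_set_le_add_diff[of "\<lambda>i. y $ i" "{..<d}" "\<lambda>i. D $ i"] by (simp add: distrib_right)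
    moreover have "L2_set (\<lambda>i. D $ i) {..<d} = L2_set (\<lambda>i. G q $ i - G q0 $ i) {..<d}"
      using G0 by (intro L2_set_cong) (auto simp: D_def)
    ultimately show "L2_set (\<lambda>i. (J *\<^sub>v (q - q0)) $ i) {..<d} \<le> (1 + \<omega>) * L2_set (\<lambda>i. G q $ i - G q0 $ i) {..<d}"
      by (simp only: y_def)
  qed

  \<comment> \<open>Read backwards, the linearized equation recovers \<open>w\<close> by dividing by
    \<open>G q0\<close>. Applying \<open>L q0\<close> costs the factor \<open>R + Q\<close>, which
    is where the large constant arises.\<close>
  have sup: "\<bar>w $ i\<bar> \<le> (R + Q) / c * L2_set (\<lambda>i. (J *\<^sub>v w) $ i) {..<d}"
    if w: "w \<in> carrier_vec d" and i: "i < d" for w i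
  proof -
    define y where "y = J *\<^sub>v w"
    have y: "y \<in> carrier_vec d"
      using Jw[OF w] by (simp add: y_def)
    have "\<bar>y $ i\<bar> \<le> L2_set (\<lambda>i. y $ i) {..<d}"
      using member_le_L2_set[of "{..<d}" i "\<lambda>i. \<bar>y $ i\<bar>"] i by (simp add: L2_set_def)
    then have "q0 $ i * \<bar>y $ i\<bar> \<le> Q * L2_set (\<lambda>i. y $ i) {..<d}"
      using q0_Q[OF i] q0_pos[OF i] by (intro mult_mono) auto
    moreover have "\<bar>(L q0 *\<^sub>v y) $ i\<bar> \<le> \<bar>(A *\<^sub>v y) $ i\<bar> + q0 $ i * \<bar>y $ i\<bar>"
      using q0_pos[OF i] abs_triangle_ineq[of "(A *\<^sub>v y) $ i" "q0 $ i * y $ i"]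
      unfolding L_mult_vec[OF y i] by (simp add: abs_mult)
    ultimately have "\<bar>(L q0 *\<^sub>v y) $ i\<bar> \<le> (R + Q) * L2_set (\<lambda>i. y $ i) {..<d}"
      using R[OF y i] by (simp only: distrib_right)
    moreover have "\<bar>(L q0 *\<^sub>v y) $ i\<bar> = \<bar>w $ i\<bar> * G q0 $ i"
      unfolding y_def LJ[OF w i] using u_pos[OF i] by (simp add: abs_mult)
    moreover have "\<bar>w $ i\<bar> * c \<le> \<bar>w $ i\<bar> * G q0 $ i"
      using G_ge[OF i] by (intro mult_left_mono) auto
    ultimately have "\<bar>w $ i\<bar> * c \<le> (R + Q) * L2_set (\<lambda>i. y $ i) {..<d}"
      by linarith
    then show ?thesis
      using c unfolding y_def by (simp add: field_simps)
  qed

  \<comment> \<open>Moving one coefficient by \<open>t - q0 $ l\<close> allows \<omega> to be the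
    size of this move, and \<open>J w\<close> is proportional to it, so the first estimate is
    quadratic in the move. Since \<open>q0\<close> is positive, coefficients near it stay
    admissible.\<close>
  have jac: "jacobian d G q0 = J"
  proof (rule eq_matI)
    fix k l assume "k < dim_row J" "l < dim_col J"
    then have k: "k < d" and l: "l < d"
      using J by auto
    define q where "q t = q0 |\<^sub>v l \<mapsto> t" for t
    have q_carrier: "q t \<in> carrier_vec d" for t
      using carrier_vecD[OF q0] by (intro carrier_vecI) (simp add: q_def)
    have q_nth: "q t $ i = (if i = l then t else q0 $ i)" if "i < d" for t i
      using q0 that l by (simp add: q_def)
    have q_same: "q (q0 $ l) = q0"
      using carrier_vecD[OF q0] carrier_vecD[OF q_carrier] by (intro eq_vecI) (auto simp: q_nth)
    have J_q: "(J *\<^sub>v (q t - q0)) $ i = (t - q0 $ l) * J $$ (i, l)" if "i < d" for t i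
    proof -
      have "(J *\<^sub>v (q t - q0)) $ i = (\<Sum>j\<in>{0..<d}. J $$ (i, j) * (q t $ j - q0 $ j))"
        using J q0 that carrier_vecD[OF q_carrier] by (simp add: scalar_prod_def)
      also have "\<dots> = (\<Sum>j\<in>{0..<d}. if j = l then (t - q0 $ l) * J $$ (i, l) else 0)"
        by (intro sum.cong) (auto simp: q_nth)
      finally show ?thesis
        using l by simp
    qed
    have "((\<lambda>t. G (q t) $ k) has_field_derivative J $$ (k, l)) (at (q0 $ l))"
    proof (rule has_field_derivative_of_quadratic_error)
      have "\<forall>\<^sub>F t in at (q0 $ l). t > 0"
        using q0_pos[OF l] by (intro order_tendstoD[OF tendsto_ident_at])
      then show "\<forall>\<^sub>F t in at (q0 $ l). \<bar>G (q t) $ k - G (q (q0 $ l)) $ k - (t - q0 $ l) * J $$ (k, l)\<bar>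
          \<le> L2_set (\<lambda>i. J $$ (i, l)) {..<d} * (t - q0 $ l)\<^sup>2"
      proof eventually_elim
        case (elim t)
        let ?e = "\<lambda>i. G (q t) $ i - G q0 $ i - (J *\<^sub>v (q t - q0)) $ i"
        have "\<bar>?e k\<bar> \<le> L2_set ?e {..<d}"
          using member_le_L2_set[of "{..<d}" k "\<lambda>i. \<bar>?e i\<bar>"] k by (simp add: L2_set_def)
        also have "\<dots> \<le> \<bar>t - q0 $ l\<bar> * L2_set (\<lambda>i. (J *\<^sub>v (q t - q0)) $ i) {..<d}"
          using elim q0_nn by (intro err1 q_carrier) (auto simp: q_nth)
        also have "L2_set (\<lambda>i. (J *\<^sub>v (q t - q0)) $ i) {..<d} = L2_set (\<lambda>i. (t - q0 $ l) * J $$ (i, l)) {..<d}"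
          by (intro L2_set_cong) (auto simp: J_q)
        also have "\<dots> \<le> \<bar>t - q0 $ l\<bar> * L2_set (\<lambda>i. J $$ (i, l)) {..<d}"
          by (rule L2_set_mult_le) auto
        also have "\<bar>t - q0 $ l\<bar> * (\<bar>t - q0 $ l\<bar> * L2_set (\<lambda>i. J $$ (i, l)) {..<d})
            = L2_set (\<lambda>i. J $$ (i, l)) {..<d} * (t - q0 $ l)\<^sup>2"
          by (simp add: power2_eq_square flip: mult.assoc)
        finally show ?case
          using J_q[OF k] q_same by (simp add: mult_left_mono)
      qed
    qed
    then show "jacobian d G q0 $$ (k, l) = J $$ (k, l)"
      using k l by (simp add: jacobian_def q_def DERIV_imp_deriv)
  qed (use J in \<open>auto simp: jacobian_def\<close>)
  show thesis
    by (rule that[OF J Jinv JJinv jac transf err1 err2 sup])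
qed

section \<open>The discrete Laplacian and the main theorem\<close>

lemma sum_second_difference:
  fixes a :: "nat \<Rightarrow> real"
  shows "(\<Sum>i<Suc m. (a (Suc i) - a i)\<^sup>2)
    = (\<Sum>i=1..m. a i * (2 * a i - a (i - 1) - a (Suc i))) + a (Suc m) * (a (Suc m) - a m) - a 0 * (a 1 - a 0)"
proof (induction m)
  case 0
  show ?case
    by (simp add: power2_eq_square algebra_simps)
next
  case (Suc m)
  have "(\<Sum>i<Suc (Suc m). (a (Suc i) - a i)\<^sup>2) = (\<Sum>i<Suc m. (a (Suc i) - a i)\<^sup>2) + (a (Suc (Suc m)) - a (Suc m))\<^sup>2"
    by simp
  then show ?case
    unfolding Suc.IH by (simp add: power2_eq_square algebra_simps)
qed

text \<open>Summation by parts turns the right side into the energy of the differences. Telescoping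
  from the zero boundary value and Cauchy-Schwarz bound each value by the energy. The crude constant
  suffices: it is exactly the inverse square of the mesh size.\<close>

lemma discrete_poincare:
  fixes a :: "nat \<Rightarrow> real"
  assumes a: "a 0 = 0" "a (Suc m) = 0"
  shows "(\<Sum>i=1..m. (a i)\<^sup>2) \<le> (real (Suc m))\<^sup>2 * (\<Sum>i=1..m. a i * (2 * a i - a (i - 1) - a (Suc i)))"
    and "0 \<le> (\<Sum>i=1..m. a i * (2 * a i - a (i - 1) - a (Suc i)))"
proof -
  let ?E = "\<Sum>i<Suc m. (a (Suc i) - a i)\<^sup>2"
  have E: "(\<Sum>i=1..m. a i * (2 * a i - a (i - 1) - a (Suc i))) = ?E"
    using sum_second_difference[of a m] a by simp
  have E0: "?E \<ge> 0"
    by (intro sum_nonneg) auto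
  show "0 \<le> (\<Sum>i=1..m. a i * (2 * a i - a (i - 1) - a (Suc i)))"
    unfolding E by (rule E0)
  have "(a k)\<^sup>2 \<le> real (Suc m) * ?E" if k: "k \<in> {1..m}" for k
  proof -
    have "a k = (\<Sum>i<k. a (Suc i) - a i)"
      using sum_lessThan_telescope[of a k] a by simp
    then have "(a k)\<^sup>2 \<le> (\<Sum>i<k. (a (Suc i) - a i)\<^sup>2) * real k"
      using sum_squared_le_sum_of_squares[of "\<lambda>i. a (Suc i) - a i" "{..<k}"] by simp
    also have "\<dots> \<le> ?E * real (Suc m)"
      using k E0 by (intro mult_mono sum_mono2) auto
    finally show ?thesis
      by (simp add: mult.commute)
  qed
  then have "(\<Sum>k=1..m. (a k)\<^sup>2) \<le> (\<Sum>k=1..m. real (Suc m) * ?E)"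
    by (rule sum_mono)
  also have "\<dots> = real m * (real (Suc m) * ?E)"
    by simp
  also have "\<dots> \<le> real (Suc m) * (real (Suc m) * ?E)"
    using E0 by (intro mult_right_mono) auto
  finally show "(\<Sum>i=1..m. (a i)\<^sup>2) \<le> (real (Suc m))\<^sup>2 * (\<Sum>i=1..m. a i * (2 * a i - a (i - 1) - a (Suc i)))"
    unfolding E by (simp only: power2_eq_square mult.assoc)
qed

definition neg_laplacian :: "nat \<Rightarrow> (nat \<Rightarrow> nat \<Rightarrow> real) \<Rightarrow> nat \<Rightarrow> nat \<Rightarrow> real" where
  "neg_laplacian N V i j =
     - (V (i - 1) j + V (i + 1) j - 4 * V i j + V i (j - 1) + V i (j + 1)) * (real N)\<^sup>2"

text \<open>The one-dimensional inequality in the first direction already gives constant 1 after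
  scaling; the second direction contributes a nonnegative term.\<close>

lemma neg_laplacian_coercive:
  fixes V :: "nat \<Rightarrow> nat \<Rightarrow> real"
  assumes "\<And>j. V 0 j = 0" "\<And>j. V (Suc m) j = 0" "\<And>i. V i 0 = 0" "\<And>i. V i (Suc m) = 0"
  shows "(\<Sum>j=1..m. \<Sum>i=1..m. (V i j)\<^sup>2) \<le> (\<Sum>j=1..m. \<Sum>i=1..m. V i j * neg_laplacian (Suc m) V i j)"
proof -
  define X where "X i j = V i j * (2 * V i j - V (i - 1) j - V (Suc i) j)" for i j
  define Y where "Y i j = V i j * (2 * V i j - V i (j - 1) - V i (Suc j))" for i j
  have split: "v * (- (a + b - 4 * v + c + e) * n) = n * (v * (2 * v - a - b)) + n * (v * (2 * v - c - e))"
    for v a b c e n :: real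
    by (simp add: algebra_simps)
  have "V i j * neg_laplacian (Suc m) V i j = (real (Suc m))\<^sup>2 * X i j + (real (Suc m))\<^sup>2 * Y i j" for i j
    unfolding neg_laplacian_def X_def Y_def Suc_eq_plus1[symmetric] by (rule split)
  then have "(\<Sum>j=1..m. \<Sum>i=1..m. V i j * neg_laplacian (Suc m) V i j)
      = (\<Sum>j=1..m. (real (Suc m))\<^sup>2 * (\<Sum>i=1..m. X i j)) + (\<Sum>j=1..m. \<Sum>i=1..m. (real (Suc m))\<^sup>2 * Y i j)"
    by (simp only: sum.distrib sum_distrib_left)
  moreover have "(\<Sum>j=1..m. \<Sum>i=1..m. (V i j)\<^sup>2) \<le> (\<Sum>j=1..m. (real (Suc m))\<^sup>2 * (\<Sum>i=1..m. X i j))"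
    unfolding X_def using discrete_poincare(1)[of "\<lambda>i. V i j" m for j] assms by (intro sum_mono) simp
  moreover have "0 \<le> (\<Sum>j=1..m. \<Sum>i=1..m. (real (Suc m))\<^sup>2 * Y i j)"
  proof -
    have "(\<Sum>j=1..m. \<Sum>i=1..m. (real (Suc m))\<^sup>2 * Y i j) = (\<Sum>i=1..m. (real (Suc m))\<^sup>2 * (\<Sum>j=1..m. Y i j))"
      by (subst sum.swap) (simp only: sum_distrib_left)
    moreover have "0 \<le> (\<Sum>j=1..m. Y i j)" for i
      unfolding Y_def by (rule discrete_poincare(2)) (simp_all add: assms)
    then have "0 \<le> (\<Sum>i=1..m. (real (Suc m))\<^sup>2 * (\<Sum>j=1..m. Y i j))"
      by (intro sum_nonneg[of "{1..m}" "\<lambda>i. (real (Suc m))\<^sup>2 * (\<Sum>j=1..m. Y i j)"] mult_nonneg_nonneg) auto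
    ultimately show ?thesis
      by simp
  qed
  ultimately show ?thesis
    by linarith
qed

section \<open>Row-wise numbering of the grid and matrix form of the scheme\<close>

definition col_of :: "nat \<Rightarrow> nat \<Rightarrow> nat" where
  "col_of N k = k mod (N - 1) + 1"

definition row_of :: "nat \<Rightarrow> nat \<Rightarrow> nat" where
  "row_of N k = k div (N - 1) + 1"

lemma col_row_range:
  assumes "N \<ge> 2" "k < (N - 1)\<^sup>2"
  shows "col_of N k \<in> {1..N - 1}" "row_of N k \<in> {1..N - 1}"
proof -
  have m: "0 < N - 1"
    using assms by simp
  have "k mod (N - 1) < N - 1"
    using m by (rule mod_less_divisor)
  then show "col_of N k \<in> {1..N - 1}"
    by (simp add: col_of_def Suc_le_eq)
  have "k div (N - 1) < N - 1"
    using assms m by (simp add: div_less_iff_less_mult power2_eq_square)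
  then show "row_of N k \<in> {1..N - 1}"
    by (simp add: row_of_def Suc_le_eq)
qed

lemma grid_pos_col_row: "grid_pos N (col_of N k) (row_of N k) = k"
  by (simp add: grid_pos_def col_of_def row_of_def div_mult_mod_eq)

lemma col_row_grid_pos:
  assumes "i \<in> {1..N - 1}" "j \<in> {1..N - 1}"
  shows "grid_pos N i j < (N - 1)\<^sup>2" "col_of N (grid_pos N i j) = i" "row_of N (grid_pos N i j) = j"
proof -
  have "i - 1 < N - 1"
    using assms by auto
  obtain a b where ab: "i = Suc a" "j = Suc b"
    using assms by (metis atLeastAtMost_iff not_one_le_zero not0_implies_Suc)
  then show "col_of N (grid_pos N i j) = i" "row_of N (grid_pos N i j) = j"
    using \<open>i - 1 < N - 1\<close> by (simp_all add: grid_pos_def col_of_def row_of_def)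
  have "(j - 1) * (N - 1) + (i - 1) < (j - 1) * (N - 1) + (N - 1)"
    using \<open>i - 1 < N - 1\<close> by simp
  also have "\<dots> = (j - 1 + 1) * (N - 1)"
    by (simp only: add_mult_distrib mult_1)
  also have "\<dots> \<le> (N - 1) * (N - 1)"
    using assms by (intro mult_right_mono) auto
  finally show "grid_pos N i j < (N - 1)\<^sup>2"
    by (simp add: grid_pos_def power2_eq_square)
qed

lemma sum_grid:
  fixes h :: "nat \<Rightarrow> nat \<Rightarrow> real"
  assumes "N \<ge> 2"
  shows "(\<Sum>k<(N - 1)\<^sup>2. h (col_of N k) (row_of N k)) = (\<Sum>j=1..N - 1. \<Sum>i=1..N - 1. h i j)"
proof -
  have "(\<Sum>k<(N - 1)\<^sup>2. h (col_of N k) (row_of N k)) = (\<Sum>(j, i)\<in>{1..N - 1} \<times> {1..N - 1}. h i j)"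
    using col_row_range[OF assms] col_row_grid_pos
    by (intro sum.reindex_bij_witness[of _ "\<lambda>(j, i). grid_pos N i j" "\<lambda>k. (row_of N k, col_of N k)"])
      (auto simp: grid_pos_col_row)
  then show ?thesis
    by (simp add: sum.cartesian_product)
qed

abbreviation (input) grid0 :: "nat \<Rightarrow> real vec \<Rightarrow> nat \<Rightarrow> nat \<Rightarrow> real" where
  "grid0 N v \<equiv> grid_fun (\<lambda>_. 0) N v"

lemma grid_fun_at_pos:
  assumes "N \<ge> 2" "k < (N - 1)\<^sup>2"
  shows "grid_fun g N u (col_of N k) (row_of N k) = u $ k"
  using col_row_range[OF assms] by (simp add: grid_fun_def grid_pos_col_row)

text \<open>This is \<open>h^-2\<close> times the block tridiagonal matrix, given column by column
  as the operator on unit grid functions with zero boundary values, which avoids a case distinction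
  along the blocks.\<close>

definition laplace_mat :: "nat \<Rightarrow> real mat" where
  "laplace_mat N = mat ((N - 1)\<^sup>2) ((N - 1)\<^sup>2)
     (\<lambda>(k, l). neg_laplacian N (grid0 N (unit_vec ((N - 1)\<^sup>2) l)) (col_of N k) (row_of N k))"

text \<open>The grid function in the subtracted term is zero inside and equals \<open>g\<close> on
  the boundary, so its Laplacian collects the boundary neighbours and the result is the usual
  right-hand side with the boundary data moved over.\<close>

definition scheme_rhs :: "(real \<times> real \<Rightarrow> real) \<Rightarrow> (real \<times> real \<Rightarrow> real) \<Rightarrow> nat \<Rightarrow> real vec" where
  "scheme_rhs f g N = vec ((N - 1)\<^sup>2) (\<lambda>k. f (real (col_of N k) / real N, real (row_of N k) / real N)
     - neg_laplacian N (grid_fun g N (0\<^sub>v ((N - 1)\<^sup>2))) (col_of N k) (row_of N k))"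

lemma laplace_mat_carrier: "laplace_mat N \<in> carrier_mat ((N - 1)\<^sup>2) ((N - 1)\<^sup>2)"
  by (simp add: laplace_mat_def)

lemma grid0_eq_sum:
  assumes v: "v \<in> carrier_vec ((N - 1)\<^sup>2)"
  shows "grid0 N v i j = (\<Sum>l<(N - 1)\<^sup>2. grid0 N (unit_vec ((N - 1)\<^sup>2) l) i j * v $ l)"
proof (cases "i \<in> {1..N - 1} \<and> j \<in> {1..N - 1}")
  case True
  then have p: "grid_pos N i j < (N - 1)\<^sup>2"
    using col_row_grid_pos by blast
  have "(\<Sum>l<(N - 1)\<^sup>2. grid0 N (unit_vec ((N - 1)\<^sup>2) l) i j * v $ l)
      = (\<Sum>l<(N - 1)\<^sup>2. if grid_pos N i j = l then v $ l else 0)"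
    using True p by (intro sum.cong) (auto simp: grid_fun_def unit_vec_def)
  then show ?thesis
    using True p by (simp add: grid_fun_def)
next
  case False
  then show ?thesis
    by (auto simp: grid_fun_def)
qed

lemma laplace_mat_mult_vec:
  assumes v: "v \<in> carrier_vec ((N - 1)\<^sup>2)" and k: "k < (N - 1)\<^sup>2"
  shows "(laplace_mat N *\<^sub>v v) $ k = neg_laplacian N (grid0 N v) (col_of N k) (row_of N k)"
proof -
  have "(laplace_mat N *\<^sub>v v) $ k = (\<Sum>l<(N - 1)\<^sup>2.
      neg_laplacian N (grid0 N (unit_vec ((N - 1)\<^sup>2) l)) (col_of N k) (row_of N k) * v $ l)"
    using v k by (simp add: laplace_mat_def scalar_prod_def lessThan_atLeast0)
  also have "\<dots> = neg_laplacian N (grid0 N v) (col_of N k) (row_of N k)"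
    unfolding neg_laplacian_def grid0_eq_sum[OF v]
    by (simp add: sum_distrib_left sum_distrib_right sum_subtractf sum.distrib sum_negf algebra_simps)
  finally show ?thesis .
qed

lemma laplace_mat_coercive:
  assumes N: "N \<ge> 2" and v: "v \<in> carrier_vec ((N - 1)\<^sup>2)"
  shows "(\<Sum>k<(N - 1)\<^sup>2. (v $ k)\<^sup>2) \<le> (\<Sum>k<(N - 1)\<^sup>2. v $ k * (laplace_mat N *\<^sub>v v) $ k)"
proof -
  let ?V = "grid0 N v"
  have "(\<Sum>k<(N - 1)\<^sup>2. (v $ k)\<^sup>2) = (\<Sum>k<(N - 1)\<^sup>2. (?V (col_of N k) (row_of N k))\<^sup>2)"
    using N by (simp add: grid_fun_at_pos)
  also have "\<dots> = (\<Sum>j=1..N - 1. \<Sum>i=1..N - 1. (?V i j)\<^sup>2)"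
    by (rule sum_grid[OF N])
  also have "\<dots> \<le> (\<Sum>j=1..N - 1. \<Sum>i=1..N - 1. ?V i j * neg_laplacian (Suc (N - 1)) ?V i j)"
    by (rule neg_laplacian_coercive) (auto simp: grid_fun_def)
  also have "\<dots> = (\<Sum>k<(N - 1)\<^sup>2. ?V (col_of N k) (row_of N k) * neg_laplacian N ?V (col_of N k) (row_of N k))"
    using N by (subst sum_grid[OF N, symmetric]) simp
  also have "\<dots> = (\<Sum>k<(N - 1)\<^sup>2. v $ k * (laplace_mat N *\<^sub>v v) $ k)"
    using N v by (simp add: grid_fun_at_pos laplace_mat_mult_vec del: index_mult_mat_vec)
  finally show ?thesis .
qed

text \<open>Five stencil values with weights of total size 8, times \<open>N^2\<close>, which is at
  most four times the dimension because \<open>N <= 2 (N - 1)\<close>. This is the source of the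
  extra factor \<open>d\<close> in the sup-norm bound.\<close>

lemma laplace_mat_bound:
  assumes N: "N \<ge> 2" and v: "v \<in> carrier_vec ((N - 1)\<^sup>2)" and k: "k < (N - 1)\<^sup>2"
  shows "\<bar>(laplace_mat N *\<^sub>v v) $ k\<bar> \<le> 32 * real ((N - 1)\<^sup>2) * L2_set (\<lambda>i. v $ i) {..<(N - 1)\<^sup>2}"
proof -
  let ?S = "L2_set (\<lambda>i. v $ i) {..<(N - 1)\<^sup>2}"
  have V: "\<bar>grid0 N v i j\<bar> \<le> ?S" for i j
  proof (cases "i \<in> {1..N - 1} \<and> j \<in> {1..N - 1}")
    case True
    then have "grid_pos N i j < (N - 1)\<^sup>2"
      using col_row_grid_pos by blast
    then show ?thesis
      using True member_le_L2_set[of "{..<(N - 1)\<^sup>2}" "grid_pos N i j" "\<lambda>i. \<bar>v $ i\<bar>"]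
      by (simp add: grid_fun_def L2_set_def)
  next
    case False
    then show ?thesis
      by (auto simp: grid_fun_def)
  qed
  have "\<bar>- (a + b - 4 * c + e + f)\<bar> \<le> 8 * S"
    if "\<bar>a\<bar> \<le> S" "\<bar>b\<bar> \<le> S" "\<bar>c\<bar> \<le> S" "\<bar>e\<bar> \<le> S" "\<bar>f\<bar> \<le> S" for a b c e f S :: real
    using that by linarith
  from this[OF V V V V V]
  have "\<bar>(laplace_mat N *\<^sub>v v) $ k\<bar> \<le> 8 * ?S * (real N)\<^sup>2"
    unfolding laplace_mat_mult_vec[OF v k] neg_laplacian_def abs_mult
    by (subst abs_of_nonneg[of "(real N)\<^sup>2"]) (auto intro!: mult_right_mono)
  also have "\<dots> \<le> 8 * ?S * (4 * real ((N - 1)\<^sup>2))"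
  proof (rule mult_left_mono)
    have "real N \<le> 2 * real (N - 1)"
      using N by simp
    then have "(real N)\<^sup>2 \<le> (2 * real (N - 1))\<^sup>2"
      by (intro power_mono) auto
    then show "(real N)\<^sup>2 \<le> 4 * real ((N - 1)\<^sup>2)"
      by (simp add: power_mult_distrib)
  qed simp
  finally show ?thesis
    by (simp add: mult_ac)
qed

lemma neg_laplacian_grid_fun:
  assumes u: "u \<in> carrier_vec ((N - 1)\<^sup>2)"
  shows "neg_laplacian N (grid_fun g N u) i j
    = neg_laplacian N (grid0 N u) i j + neg_laplacian N (grid_fun g N (0\<^sub>v ((N - 1)\<^sup>2))) i j"
proof -
  have "grid_fun g N u i j = grid0 N u i j + grid_fun g N (0\<^sub>v ((N - 1)\<^sup>2)) i j" for i j
    using col_row_grid_pos(1)[of i N j] by (auto simp: grid_fun_def)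
  then show ?thesis
    by (simp add: neg_laplacian_def algebra_simps)
qed

lemma solves_scheme_iff:
  assumes N: "N \<ge> 2"
  shows "solves_scheme f g N q u \<longleftrightarrow> u \<in> carrier_vec ((N - 1)\<^sup>2) \<and>
    (\<forall>k<(N - 1)\<^sup>2. neg_laplacian N (grid_fun g N u) (col_of N k) (row_of N k) + q $ k * u $ k
      = f (real (col_of N k) / real N, real (row_of N k) / real N))"
proof -
  have eq: "(let U = grid_fun g N u; h = 1 / real N in
          - (U (i - 1) j + U (i + 1) j - 4 * U i j + U i (j - 1) + U i (j + 1)) / h\<^sup>2
            + q $ grid_pos N i j * U i j = f (real i * h, real j * h)) \<longleftrightarrow>
      neg_laplacian N (grid_fun g N u) i j + q $ grid_pos N i j * grid_fun g N u i j
        = f (real i / real N, real j / real N)" for i j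
    by (simp add: neg_laplacian_def Let_def power_divide)
  have "(\<forall>i\<in>{1..N - 1}. \<forall>j\<in>{1..N - 1}. P i j) \<longleftrightarrow> (\<forall>k<(N - 1)\<^sup>2. P (col_of N k) (row_of N k))" for P
    using col_row_range[OF N] col_row_grid_pos by (metis (no_types, lifting))
  then show ?thesis
    unfolding solves_scheme_def eq using N by (simp add: grid_pos_col_row grid_fun_at_pos)
qed

lemma solves_scheme_iff_mat:
  assumes N: "N \<ge> 2"
  shows "solves_scheme f g N q u \<longleftrightarrow> u \<in> carrier_vec ((N - 1)\<^sup>2) \<and>
    (laplace_mat N + diag ((N - 1)\<^sup>2) (\<lambda>i. q $ i)) *\<^sub>v u = scheme_rhs f g N"
proof (cases "u \<in> carrier_vec ((N - 1)\<^sup>2)")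
  case True
  let ?L = "laplace_mat N + diag ((N - 1)\<^sup>2) (\<lambda>i. q $ i)"
  have "?L *\<^sub>v u = laplace_mat N *\<^sub>v u + diag ((N - 1)\<^sup>2) (\<lambda>i. q $ i) *\<^sub>v u"
    by (rule add_mult_distrib_mat_vec[OF laplace_mat_carrier diag_carrier True])
  then have L: "(?L *\<^sub>v u) $ k = neg_laplacian N (grid0 N u) (col_of N k) (row_of N k) + q $ k * u $ k"
    if "k < (N - 1)\<^sup>2" for k
    using that True by (simp add: diag_mult_vec laplace_mat_mult_vec del: index_mult_mat_vec)
  have "?L *\<^sub>v u = scheme_rhs f g N \<longleftrightarrow> (\<forall>k<(N - 1)\<^sup>2. (?L *\<^sub>v u) $ k = scheme_rhs f g N $ k)"
    by (auto simp: scheme_rhs_def vec_eq_iff simp del: index_mult_mat_vec)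
  also have "\<dots> \<longleftrightarrow> (\<forall>k<(N - 1)\<^sup>2. neg_laplacian N (grid_fun g N u) (col_of N k) (row_of N k) + q $ k * u $ k
      = f (real (col_of N k) / real N, real (row_of N k) / real N))"
  proof -
    have "(?L *\<^sub>v u) $ k = scheme_rhs f g N $ k \<longleftrightarrow>
        neg_laplacian N (grid_fun g N u) (col_of N k) (row_of N k) + q $ k * u $ k
        = f (real (col_of N k) / real N, real (row_of N k) / real N)" if "k < (N - 1)\<^sup>2" for k
      unfolding L[OF that] neg_laplacian_grid_fun[OF True, of g]
      using that by (auto simp: scheme_rhs_def algebra_simps)
    then show ?thesis
      by blast
  qed
  finally show ?thesis
    using True by (simp add: solves_scheme_iff[OF N])
qed (simp add: solves_scheme_iff[OF N])

lemma elliptic_scheme_forward_map: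
  assumes N: "N \<ge> 2"
  shows "elliptic_scheme ((N - 1)\<^sup>2) (laplace_mat N) (scheme_rhs f g N) (forward_map f g N)"
proof
  show "laplace_mat N \<in> carrier_mat ((N - 1)\<^sup>2) ((N - 1)\<^sup>2)"
    by (rule laplace_mat_carrier)
  show "scheme_rhs f g N \<in> carrier_vec ((N - 1)\<^sup>2)"
    by (simp add: scheme_rhs_def)
qed (use N in \<open>simp_all only: laplace_mat_coercive forward_map_def solves_scheme_iff_mat\<close>)

section \<open>Lower bound for the solution\<close>

lemma grid_frontier:
  assumes N: "N \<ge> 2" and ij: "i \<le> N" "j \<le> N" and bd: "\<not> (i \<in> {1..N - 1} \<and> j \<in> {1..N - 1})"
  shows "(real i / real N, real j / real N) \<in> frontier ({0..1} \<times> {0..1})"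
proof -
  have "i = 0 \<or> i = N \<or> j = 0 \<or> j = N"
    using ij bd by auto
  then have "(real i / real N, real j / real N) \<notin> {0<..<1} \<times> {0<..<1}"
    using N by auto
  moreover have "(real i / real N, real j / real N) \<in> {0..1} \<times> {0..1}"
    using N ij by auto
  ultimately show ?thesis
    by (simp add: frontier_def closure_Times interior_Times interior_atLeastAtMost_real)
qed

text \<open>At a minimum lying below the boundary data the negative Laplacian is at most zero, so
  the reaction term alone must balance \<open>f\<close>; this forces the value up to
  \<open>f0 / Q\<close>. The bound does not depend on the mesh.\<close>

lemma minimum_principle:
  fixes u :: "real vec"
  assumes N: "N \<ge> 2" and u: "solves_scheme f g N q u"
    and f: "\<forall>z\<in>{0..1} \<times> {0..1}. f z \<ge> f0" and f0: "f0 > 0"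
    and g: "\<forall>z\<in>frontier ({0..1} \<times> {0..1}). g z \<ge> g0"
    and q: "\<forall>k<(N - 1)\<^sup>2. 0 \<le> q $ k \<and> q $ k \<le> Q" and Q: "Q > 0"
    and l: "l < (N - 1)\<^sup>2"
  shows "u $ l \<ge> min g0 (f0 / Q)"
proof -
  define c where "c = min g0 (f0 / Q)"
  have "Q * c \<le> Q * (f0 / Q)"
    using Q by (intro mult_left_mono) (auto simp: c_def)
  then have Qc: "Q * c \<le> f0"
    using Q by simp
  have "Min ((\<lambda>i. u $ i) ` {..<(N - 1)\<^sup>2}) \<in> (\<lambda>i. u $ i) ` {..<(N - 1)\<^sup>2}"
    using l by (intro Min_in) auto
  then obtain k where k: "k < (N - 1)\<^sup>2" and "u $ k = Min ((\<lambda>i. u $ i) ` {..<(N - 1)\<^sup>2})"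
    by auto
  then have kmin: "u $ k \<le> u $ i" if "i < (N - 1)\<^sup>2" for i
    using that by simp
  have "u $ k \<ge> c"
  proof (rule ccontr)
    assume "\<not> u $ k \<ge> c"
    then have uk: "u $ k < c"
      by simp
    define V where "V = grid_fun g N u"
    have V: "V i j \<ge> u $ k" if "i \<le> N" "j \<le> N" for i j
    proof (cases "i \<in> {1..N - 1} \<and> j \<in> {1..N - 1}")
      case True
      then show ?thesis
        using kmin[OF col_row_grid_pos(1)[of i N j]] by (simp add: V_def grid_fun_def)
    next
      case False
      have "g (real i / real N, real j / real N) \<ge> g0"
        using g grid_frontier[OF N that False] by blast
      moreover have "V i j = g (real i / real N, real j / real N)"
        unfolding V_def grid_fun_def by (rule if_not_P[OF False])
      ultimately show ?thesis
        using uk unfolding c_def by linarith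
    qed
    let ?i = "col_of N k" and ?j = "row_of N k"
    have ij: "?i \<le> N - 1" "?j \<le> N - 1"
      using col_row_range[OF N k] by auto
    have "V (?i - 1) ?j \<ge> u $ k" "V (?i + 1) ?j \<ge> u $ k" "V ?i (?j - 1) \<ge> u $ k" "V ?i (?j + 1) \<ge> u $ k"
      using ij N by (auto intro!: V)
    moreover have "V ?i ?j = u $ k"
      unfolding V_def by (rule grid_fun_at_pos[OF N k])
    ultimately have "neg_laplacian N V ?i ?j \<le> 0"
      unfolding neg_laplacian_def by (intro mult_nonpos_nonneg) auto
    moreover have "neg_laplacian N V ?i ?j + q $ k * u $ k = f (real ?i / real N, real ?j / real N)"
      using u k by (simp add: solves_scheme_iff[OF N] V_def)
    moreover have "f (real ?i / real N, real ?j / real N) \<ge> f0"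
      using f ij N by (auto simp: divide_le_eq)
    ultimately have qu: "q $ k * u $ k \<ge> f0"
      by linarith
    \<comment> \<open>Positivity must come first: only then may \<open>q $ k\<close> be replaced by
      its upper bound \<open>Q\<close>.\<close>
    then have "u $ k > 0"
      using f0 q k by (smt (verit) mult_nonneg_nonpos)
    then have "q $ k * u $ k \<le> Q * u $ k"
      using q k by (intro mult_right_mono) auto
    also have "\<dots> < Q * c"
      using uk Q by simp
    finally show False
      using qu Qc by linarith
  qed
  then show ?thesis
    using kmin[OF l] unfolding c_def by linarith
qed

lemma prob_space_std_normal_d: "prob_space (std_normal_d d)"
  by (intro prob_space_PiM prob_space_normal_density) simp

text \<open>Markov's inequality for the squared norm, whose mean is \<open>d\<close>. It justifies
  the choice \<open>M = 1 / \<epsilon>\<close> for the good event.\<close>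

lemma std_normal_d_tail:
  assumes \<epsilon>: "\<epsilon> > 0" and d: "d \<ge> 1"
  shows "measure (std_normal_d d) {\<eta> \<in> space (std_normal_d d). 1 / \<epsilon> * real d < (L2_set \<eta> {..<d})\<^sup>2} \<le> \<epsilon>"
proof -
  let ?N = "density lborel (\<lambda>x. ennreal (std_normal_density x))"
  interpret P: prob_space "std_normal_d d"
    by (rule prob_space_std_normal_d)
  have N: "prob_space ?N"
    by (rule prob_space_normal_density) simp
  have comp [measurable]: "(\<lambda>\<eta>. \<eta> i) \<in> borel_measurable (std_normal_d d)" if "i < d" for i
    by (rule measurable_component_borel) (use that in auto)
  have m1: "(\<integral>\<^sup>+x. ennreal (x\<^sup>2) \<partial>?N) = 1"
  proof -
    have "has_bochner_integral lborel (\<lambda>x. std_normal_density x * x ^ (2 * 1)) (fact (2 * 1) / (2 ^ 1 * fact 1))"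
      by (rule std_normal_moment_even)
    then have "(\<integral>\<^sup>+x. ennreal (std_normal_density x * x\<^sup>2) \<partial>lborel) = 1"
      by (subst nn_integral_eq_integral) (auto simp: has_bochner_integral_iff fact_2)
    then show ?thesis
      by (simp add: nn_integral_density ennreal_mult)
  qed
  have "(\<integral>\<^sup>+\<eta>. ennreal ((L2_set \<eta> {..<d})\<^sup>2) \<partial>std_normal_d d)
      = (\<integral>\<^sup>+\<eta>. (\<Sum>i<d. ennreal ((\<eta> i)\<^sup>2)) \<partial>std_normal_d d)"
    by (simp add: L2_set_power2 sum_ennreal)
  also have "\<dots> = (\<Sum>i<d. \<integral>\<^sup>+\<eta>. ennreal ((\<eta> i)\<^sup>2) \<partial>std_normal_d d)"
    by (intro nn_integral_sum) measurable
  also have "\<dots> = (\<Sum>i<d. 1)"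
  proof (intro sum.cong refl)
    fix i assume i: "i \<in> {..<d}"
    have "?N = distr (std_normal_d d) ?N (\<lambda>\<eta>. \<eta> i)"
      using distr_PiM_component[of "{..<d}" "\<lambda>_. ?N" i] N i by simp
    then have "(\<integral>\<^sup>+x. ennreal (x\<^sup>2) \<partial>?N) = (\<integral>\<^sup>+x. ennreal (x\<^sup>2) \<partial>distr (std_normal_d d) ?N (\<lambda>\<eta>. \<eta> i))"
      by (rule arg_cong)
    also have "\<dots> = (\<integral>\<^sup>+\<eta>. ennreal ((\<eta> i)\<^sup>2) \<partial>std_normal_d d)"
      using i by (intro nn_integral_distr measurable_component_singleton) auto
    finally show "(\<integral>\<^sup>+\<eta>. ennreal ((\<eta> i)\<^sup>2) \<partial>std_normal_d d) = 1"
      by (simp add: m1)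
  qed
  finally have int: "(\<integral>\<^sup>+\<eta>. ennreal ((L2_set \<eta> {..<d})\<^sup>2) \<partial>std_normal_d d) = ennreal (real d)"
    by (simp add: ennreal_of_nat_eq_real_of_nat)
  have meas: "(\<lambda>\<eta>. (L2_set \<eta> {..<d})\<^sup>2) \<in> borel_measurable (std_normal_d d)"
    unfolding L2_set_power2 by measurable
  have integrable: "integrable (std_normal_d d) (\<lambda>\<eta>. (L2_set \<eta> {..<d})\<^sup>2)"
    using meas by (intro integrableI_nonneg) (auto simp: int)
  have E: "P.expectation (\<lambda>\<eta>. (L2_set \<eta> {..<d})\<^sup>2) = real d"
    using meas by (subst integral_eq_nn_integral) (auto simp: int)
  have "P.prob {\<eta> \<in> space (std_normal_d d). 1 / \<epsilon> * real d < (L2_set \<eta> {..<d})\<^sup>2}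
      \<le> P.prob {\<eta> \<in> space (std_normal_d d). 1 / \<epsilon> * real d \<le> (L2_set \<eta> {..<d})\<^sup>2}"
    using meas by (intro P.finite_measure_mono) auto
  also have "\<dots> \<le> real d / (1 / \<epsilon> * real d)"
    using integral_Markov_inequality_measure[OF integrable, of "space (std_normal_d d)" "1 / \<epsilon> * real d"] \<epsilon> d
    by (simp add: E)
  also have "\<dots> = \<epsilon>"
    using \<epsilon> d by simp
  finally show ?thesis .
qed

text \<open>In the value of \<open>b\<close>, \<open>32 d\<close> bounds the discrete Laplacian,
  \<open>hi\<close> the coefficient, and the denominator is the lower bound from the minimum
  principle.\<close>

lemma forward_map_regression:
  fixes f g :: "real \<times> real \<Rightarrow> real" and q0 :: "real vec" and N n :: nat
  assumes N: "N \<ge> 2" and n: "n \<ge> 1"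
    and f_ge: "\<forall>z\<in>{0..1} \<times> {0..1}. f z \<ge> f0" and f0: "f0 > 0"
    and g_ge: "\<forall>z\<in>frontier ({0..1} \<times> {0..1}). g z \<ge> g0" and g0: "g0 > 0"
    and lo: "lo \<ge> 0" and lohi: "lo < hi" and r: "r > 0" and C: "C \<ge> 0"
    and q0: "q0 \<in> carrier_vec ((N - 1)\<^sup>2)"
    and q0_in: "\<And>i. i < (N - 1)\<^sup>2 \<Longrightarrow> lo + r \<le> q0 $ i \<and> q0 $ i \<le> hi - r"
    and p: "\<And>i. i < (N - 1)\<^sup>2 \<Longrightarrow> p i \<in> borel_measurable borel"
      "\<And>i. i < (N - 1)\<^sup>2 \<Longrightarrow> prob_space (density lborel (\<lambda>x. ennreal (p i x)))"
      "\<And>i x. i < (N - 1)\<^sup>2 \<Longrightarrow> x \<notin> {lo..hi} \<Longrightarrow> p i x = 0"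
      "\<And>i x. i < (N - 1)\<^sup>2 \<Longrightarrow> x \<in> {lo..hi} \<Longrightarrow> p i x > 0"
      "\<And>i x y. i < (N - 1)\<^sup>2 \<Longrightarrow> x \<in> {lo..hi} \<Longrightarrow> y \<in> {lo..hi} \<Longrightarrow>
        \<bar>ln (p i x) - ln (p i y)\<bar> \<le> C * \<bar>x - y\<bar>"
  obtains J Jinv where "gaussian_regression ((N - 1)\<^sup>2) n J Jinv (forward_map f g N) q0 p lo hi
    ((32 * real ((N - 1)\<^sup>2) + hi) / min g0 (f0 / hi)) C r"
proof -
  let ?d = "(N - 1)\<^sup>2" and ?G = "forward_map f g N" and ?c = "min g0 (f0 / hi)"
  interpret elliptic_scheme ?d "laplace_mat N" "scheme_rhs f g N" ?G
    by (rule elliptic_scheme_forward_map[OF N])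
  have hi: "hi > 0"
    using lo lohi by simp
  have c: "?c > 0"
    using f0 g0 hi by simp
  have d: "?d \<ge> 1"
    using N by (simp add: Suc_le_eq)
  have q0_pos: "q0 $ i > 0" and q0_hi: "q0 $ i \<le> hi" if "i < ?d" for i
    using q0_in[OF that] lo r by linarith+
  have q0_nn: "\<forall>i<?d. q0 $ i \<ge> 0"
    using q0_pos by (auto intro: less_imp_le)
  have solves: "solves_scheme f g N q0 (?G q0)"
    using G_solves[OF q0 q0_nn] unfolding solves_scheme_iff_mat[OF N] L_def by blast
  have G_ge: "?G q0 $ i \<ge> ?c" if "i < ?d" for i
    using q0_nn q0_hi by (intro minimum_principle[OF N solves f_ge f0 g_ge _ hi that]) auto
  obtain J Jinv where J: "J \<in> carrier_mat ?d ?d" "Jinv \<in> carrier_mat ?d ?d" "J * Jinv = 1\<^sub>m ?d"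
      "jacobian ?d ?G q0 = J" "transforms_lborel ?d Jinv"
    and err1: "\<And>q \<omega>. q \<in> carrier_vec ?d \<Longrightarrow> \<forall>i<?d. 0 \<le> q $ i \<Longrightarrow> \<forall>i<?d. \<bar>q $ i - q0 $ i\<bar> \<le> \<omega> \<Longrightarrow> \<omega> \<ge> 0 \<Longrightarrow>
      L2_set (\<lambda>i. ?G q $ i - ?G q0 $ i - (J *\<^sub>v (q - q0)) $ i) {..<?d}
        \<le> \<omega> * L2_set (\<lambda>i. (J *\<^sub>v (q - q0)) $ i) {..<?d}"
    and err2: "\<And>q \<omega>. q \<in> carrier_vec ?d \<Longrightarrow> \<forall>i<?d. 0 \<le> q $ i \<Longrightarrow> \<forall>i<?d. \<bar>q $ i - q0 $ i\<bar> \<le> \<omega> \<Longrightarrow> \<omega> \<ge> 0 \<Longrightarrow>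
      L2_set (\<lambda>i. (J *\<^sub>v (q - q0)) $ i) {..<?d} \<le> (1 + \<omega>) * L2_set (\<lambda>i. ?G q $ i - ?G q0 $ i) {..<?d}"
    and sup: "\<And>w i. w \<in> carrier_vec ?d \<Longrightarrow> i < ?d \<Longrightarrow>
      \<bar>w $ i\<bar> \<le> (32 * real ?d + hi) / ?c * L2_set (\<lambda>i. (J *\<^sub>v w) $ i) {..<?d}"
    by (rule linearization[OF q0 q0_pos q0_hi c G_ge laplace_mat_bound[OF N]]) blast+
  have nn: "\<forall>i<?d. 0 \<le> q $ i" if "\<forall>i<?d. lo \<le> q $ i \<and> q $ i \<le> hi" for q :: "real vec"
    using that lo by (auto intro: order_trans)
  have "gaussian_regression ?d n J Jinv ?G q0 p lo hi ((32 * real ?d + hi) / ?c) C r"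
  proof (rule gaussian_regression.intro, goal_cases)
    case (13 q)
    then show ?case
      using G_solves(1)[OF _ nn] by blast
  next
    case (14 k)
    then show ?case
      by (rule measurable_G[OF lo])
  next
    case (15 q \<omega>)
    \<comment> \<open>Nonnegativity of \<omega> is read off coordinate 0, which exists because the
      dimension is positive.\<close>
    have "\<bar>q $ 0 - q0 $ 0\<bar> \<le> \<omega>"
      using 15(3)[rule_format, of 0] less_le_trans[OF _ d] by blast
    then have "\<omega> \<ge> 0"
      by linarith
    then show ?case
      using 15 err1[OF _ nn] err2[OF _ nn] by blast
  next
    case (16 w i)
    then show ?case
      by (rule sup)
  qed (use d n J q0 r q0_in c hi C p in \<open>simp_all add: add_pos_nonneg add_nonneg_pos\<close>)
  then show thesis
    by (rule that)
qed

theorem theorem4p4: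
  fixes f g :: "real \<times> real \<Rightarrow> real"
    and qmin qmax r :: real
    and N d :: "nat \<Rightarrow> nat"
    and q0 :: "nat \<Rightarrow> real vec"
    and \<pi> :: "nat \<Rightarrow> nat \<Rightarrow> real \<Rightarrow> real"
    and G :: "nat \<Rightarrow> real vec \<Rightarrow> real vec"
    and \<delta> :: "nat \<Rightarrow> real"
  assumes f_cont: "continuous_on ({0..1} \<times> {0..1}) f"
    and f_pos: "\<forall>z\<in>{0..1} \<times> {0..1}. f z > 0"
    and g_cont: "continuous_on (frontier ({0..1} \<times> {0..1})) g"
    and g_pos: "\<forall>z\<in>frontier ({0..1} \<times> {0..1}). g z > 0"
    and q_bounds: "0 \<le> qmin" "qmin < qmax"
    and N_ge: "\<forall>n. N n \<ge> 2"
    and N_lim: "filterlim N at_top sequentially"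
    and d_def: "\<forall>n. d n = (N n - 1)\<^sup>2"
    and G_def: "\<forall>n. G n = forward_map f g (N n)"
    and q0_dim: "\<forall>n. q0 n \<in> carrier_vec (d n)"
    and r_pos: "r > 0"
    and q0_inside: "\<forall>n. \<forall>i<d n. qmin + r \<le> q0 n $ i \<and> q0 n $ i \<le> qmax - r"
    and prior_meas: "\<forall>n. \<forall>i<d n. \<pi> n i \<in> borel_measurable borel"
    and prior_pdf: "\<forall>n. \<forall>i<d n. prob_space (density lborel (\<lambda>x. ennreal (\<pi> n i x)))"
    and prior_supp: "\<forall>n. \<forall>i<d n. \<forall>x. x \<notin> {qmin..qmax} \<longrightarrow> \<pi> n i x = 0"
    and prior_pos: "\<forall>n. \<forall>i<d n. \<forall>x\<in>{qmin..qmax}. \<pi> n i x > 0"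
    and prior_bdd: "\<exists>C>0. \<forall>n. \<forall>i<d n. \<forall>x\<in>{qmin..qmax}. \<forall>y\<in>{qmin..qmax}.
          \<bar>ln (\<pi> n i x) - ln (\<pi> n i y)\<bar> \<le> C"
    and prior_lip: "\<forall>\<rho>>0. \<exists>C>0. \<forall>n. \<forall>i<d n. \<forall>x\<in>{qmin..qmax}. \<forall>y\<in>{qmin..qmax}.
          \<bar>x - y\<bar> \<le> \<rho> \<longrightarrow> \<bar>ln (\<pi> n i x) - ln (\<pi> n i y)\<bar> \<le> C * \<bar>x - y\<bar>"
    and \<delta>_def: "\<forall>n. \<delta> n = real (d n) ^ 3 * ln (real (d n)) / sqrt (real n)"
    and \<delta>_lim: "\<delta> \<longlonglongrightarrow> 0"
  shows "bigO_p (\<lambda>n. std_normal_d (d n))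
           (\<lambda>n \<eta>. dTV_box (d n) qmin qmax
              (posterior_pdf (d n) n (G n) (\<pi> n) (data_vec n (G n) (q0 n) (vec (d n) \<eta>)))
              (gaussian_pdf (d n) (Delta_vec (d n) n (G n) (q0 n) (vec (d n) \<eta>))
                 ((1 / real n) \<cdot>\<^sub>m Sigma_mat (d n) (G n) (q0 n))))
           \<delta>"
proof -
  have square: "compact ({0..1} \<times> {0..1} :: (real \<times> real) set)"
    by (intro compact_Times) auto
  then have bdry: "compact (frontier ({0..1} \<times> {0..1} :: (real \<times> real) set))"
    by (rule compact_frontier)
  have "(0, 0) \<in> frontier ({0..1} \<times> {0..1} :: (real \<times> real) set)"
    using grid_frontier[of 2 0 0] by simp
  then have bdry_ne: "frontier ({0..1} \<times> {0..1} :: (real \<times> real) set) \<noteq> {}"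
    by blast
  obtain zf where zf: "zf \<in> {0..1} \<times> {0..1}" and f_ge: "\<forall>z\<in>{0..1} \<times> {0..1}. f zf \<le> f z"
    using continuous_attains_inf[OF square _ f_cont] by auto
  obtain zg where zg: "zg \<in> frontier ({0..1} \<times> {0..1})" and g_ge: "\<forall>z\<in>frontier ({0..1} \<times> {0..1}). g zg \<le> g z"
    using continuous_attains_inf[OF bdry bdry_ne g_cont] by auto
  have f0: "f zf > 0" and g0: "g zg > 0"
    using f_pos g_pos zf zg by auto
  have qmax: "qmax > 0"
    using q_bounds by simp
  \<comment> \<open>Taking the full width of the interval as the radius makes the Lipschitz
    condition global.\<close>
  obtain C where C: "C > 0" and lip: "\<forall>n. \<forall>i<d n. \<forall>x\<in>{qmin..qmax}. \<forall>y\<in>{qmin..qmax}.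
      \<bar>x - y\<bar> \<le> qmax - qmin \<longrightarrow> \<bar>ln (\<pi> n i x) - ln (\<pi> n i y)\<bar> \<le> C * \<bar>x - y\<bar>"
    using prior_lip[rule_format, of "qmax - qmin"] q_bounds by auto
  define c where "c = min (g zg) (f zf / qmax)"
  have c: "c > 0"
    using f0 g0 qmax by (simp add: c_def)
  define b where "b n = (32 * real (d n) + qmax) / c" for n
  define B where "B = (32 + qmax) / c"
  have B: "B > 0"
    using c qmax by (simp add: B_def)
  have d_ge: "d n \<ge> 1" for n
    using N_ge[rule_format, of n] by (simp add: d_def Suc_le_eq)
  have regression: "\<exists>J Jinv. gaussian_regression (d n) n J Jinv (G n) (q0 n) (\<pi> n) qmin qmax (b n) C r"
    if n: "n \<ge> 1" for n
  proof -
    have dn: "d n = (N n - 1)\<^sup>2"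
      using d_def by simp
    have q0n: "q0 n \<in> carrier_vec ((N n - 1)\<^sup>2)"
      using q0_dim dn by metis
    show ?thesis
      unfolding b_def c_def G_def[rule_format] dn
    proof (rule forward_map_regression[OF N_ge[rule_format] n f_ge f0 g_ge g0 q_bounds r_pos less_imp_le[OF C] q0n,
          where p = "\<pi> n"])
      fix i x y assume i: "i < (N n - 1)\<^sup>2"
      note i' = i[folded dn]
      show "qmin + r \<le> q0 n $ i \<and> q0 n $ i \<le> qmax - r"
        using q0_inside i' by blast
      show "\<pi> n i \<in> borel_measurable borel"
        using prior_meas i' by blast
      show "prob_space (density lborel (\<lambda>x. ennreal (\<pi> n i x)))"
        using prior_pdf i' by blast
      show "x \<notin> {qmin..qmax} \<Longrightarrow> \<pi> n i x = 0"
        using prior_supp i' by blast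
      show "x \<in> {qmin..qmax} \<Longrightarrow> \<pi> n i x > 0"
        using prior_pos i' by blast
      assume xy: "x \<in> {qmin..qmax}" "y \<in> {qmin..qmax}"
      then have "\<bar>x - y\<bar> \<le> qmax - qmin"
        by auto
      then show "\<bar>ln (\<pi> n i x) - ln (\<pi> n i y)\<bar> \<le> C * \<bar>x - y\<bar>"
        using lip i' xy by blast
    qed blast
  qed
  \<comment> \<open>From \<open>N >= 3\<close> on, the dimension exceeds \<open>exp 1\<close>, so
    the logarithm in \<delta> is at least 1. For \<open>N = 2\<close> it would be zero.\<close>
  have "\<forall>\<^sub>F n in sequentially. N n \<ge> 3"
    using N_lim by (simp add: filterlim_at_top)
  then have small: "\<forall>\<^sub>F n in sequentially. b n * (real (d n))\<^sup>2 / sqrt (real n) \<le> B * \<delta> n"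
  proof eventually_elim
    case (elim n)
    have "3 \<le> d n"
    proof -
      have "(2::nat)\<^sup>2 \<le> (N n - 1)\<^sup>2"
        using elim by (intro power_mono) auto
      then show ?thesis
        using d_def by simp
    qed
    then have "exp 1 \<le> real (d n)"
      using exp_le by linarith
    then have ln: "1 \<le> ln (real (d n))"
      using d_ge[of n] by (subst ln_ge_iff) auto
    have "32 * real (d n) + qmax \<le> (32 + qmax) * real (d n)"
      using d_ge[of n] qmax by (simp add: distrib_right)
    then have "b n \<le> B * real (d n)"
      using c by (simp add: b_def B_def divide_right_mono)
    then have "b n * (real (d n))\<^sup>2 \<le> B * real (d n) * (real (d n))\<^sup>2"
      by (rule mult_right_mono) simp
    also have "\<dots> = B * (real (d n) ^ 3 * 1)"
      by (simp add: power2_eq_square power3_eq_cube)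
    also have "\<dots> \<le> B * (real (d n) ^ 3 * ln (real (d n)))"
      using ln B by (intro mult_left_mono) auto
    finally have "b n * (real (d n))\<^sup>2 / sqrt (real n) \<le> B * (real (d n) ^ 3 * ln (real (d n))) / sqrt (real n)"
      by (rule divide_right_mono) simp
    then show ?case
      using \<delta>_def by simp
  qed
  define X where "X n \<eta> = dTV_box (d n) qmin qmax
      (posterior_pdf (d n) n (G n) (\<pi> n) (data_vec n (G n) (q0 n) (vec (d n) \<eta>)))
      (gaussian_pdf (d n) (Delta_vec (d n) n (G n) (q0 n) (vec (d n) \<eta>))
         ((1 / real n) \<cdot>\<^sub>m Sigma_mat (d n) (G n) (q0 n)))" for n \<eta>
  have X_nonneg: "X n \<eta> \<ge> 0" for n \<eta>
    unfolding X_def dTV_box_def set_lebesgue_integral_def by (intro integral_nonneg_AE) auto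
  have X_meas: "X n \<in> borel_measurable (std_normal_d (d n))" if n: "n \<ge> 1" for n
  proof -
    obtain J Jinv where "gaussian_regression (d n) n J Jinv (G n) (q0 n) (\<pi> n) qmin qmax (b n) C r"
      using regression[OF n] by blast
    then interpret gaussian_regression "d n" n J Jinv "G n" "q0 n" "\<pi> n" qmin qmax "b n" C r .
    show ?thesis
      using measurable_dTV unfolding dTV_def[abs_def] X_def[abs_def] .
  qed
  have "bigO_p (\<lambda>n. std_normal_d (d n)) X \<delta>"
    unfolding bigO_p_def
  proof (intro allI impI)
    fix \<epsilon> :: real assume \<epsilon>: "\<epsilon> > 0"
    then have M: "1 / \<epsilon> \<ge> 0"
      by simp
    have C': "C \<ge> 0" "qmin \<le> qmax"
      using C q_bounds by auto
    obtain Ct e0 where Ct: "Ct > 0" "e0 > 0"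
      and bound: "\<And>n J Jinv \<eta>.
        gaussian_regression (d n) n J Jinv (G n) (q0 n) (\<pi> n) qmin qmax (b n) C r \<Longrightarrow>
        b n * (real (d n))\<^sup>2 / sqrt (real n) \<le> e0 \<Longrightarrow> (L2_set \<eta> {..<d n})\<^sup>2 \<le> 1 / \<epsilon> * real (d n) \<Longrightarrow>
        X n \<eta> \<le> Ct * (b n * (real (d n))\<^sup>2 / sqrt (real n))"
      unfolding X_def by (rule gaussian_regression_dTV_bound[OF M C' r_pos]) blast
    show "\<exists>M. \<forall>\<^sub>F n in sequentially.
        {\<omega> \<in> space (std_normal_d (d n)). \<bar>X n \<omega>\<bar> > M * \<delta> n} \<in> sets (std_normal_d (d n)) \<and>
        measure (std_normal_d (d n)) {\<omega> \<in> space (std_normal_d (d n)). \<bar>X n \<omega>\<bar> > M * \<delta> n} \<le> \<epsilon>"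
    proof -
      have "(\<lambda>n. B * \<delta> n) \<longlonglongrightarrow> B * 0"
        by (intro tendsto_intros \<delta>_lim)
      then have ev: "\<forall>\<^sub>F n in sequentially. B * \<delta> n < e0"
        using Ct by (intro order_tendstoD) auto
      show ?thesis
      \<comment> \<open>\<open>Ct\<close> comes from the total variation bound, and \<open>B\<close>
        converts its error parameter into \<delta>.\<close>
      proof (rule exI[of _ "Ct * B"])
        show "\<forall>\<^sub>F n in sequentially.
          {\<omega> \<in> space (std_normal_d (d n)). \<bar>X n \<omega>\<bar> > Ct * B * \<delta> n} \<in> sets (std_normal_d (d n)) \<and>
          measure (std_normal_d (d n)) {\<omega> \<in> space (std_normal_d (d n)). \<bar>X n \<omega>\<bar> > Ct * B * \<delta> n} \<le> \<epsilon>"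
          using small eventually_ge_at_top[of "1 :: nat"] ev
        proof eventually_elim
          case (elim n)
          have meas: "{\<omega> \<in> space (std_normal_d (d n)). \<bar>X n \<omega>\<bar> > Ct * B * \<delta> n} \<in> sets (std_normal_d (d n))"
            using X_meas[OF elim(2)] by measurable
          obtain J Jinv where reg: "gaussian_regression (d n) n J Jinv (G n) (q0 n) (\<pi> n) qmin qmax (b n) C r"
            using regression[OF elim(2)] by blast
          interpret P: prob_space "std_normal_d (d n)"
            by (rule prob_space_std_normal_d)
          \<comment> \<open>By contraposition, a large distance forces the noise out of the good
            event, whose complement has probability at most \<epsilon>.\<close>
          have "1 / \<epsilon> * real (d n) < (L2_set \<eta> {..<d n})\<^sup>2" if "\<bar>X n \<eta>\<bar> > Ct * B * \<delta> n" for \<eta>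
          proof (rule ccontr)
            assume "\<not> 1 / \<epsilon> * real (d n) < (L2_set \<eta> {..<d n})\<^sup>2"
            then have "X n \<eta> \<le> Ct * (b n * (real (d n))\<^sup>2 / sqrt (real n))"
              using elim by (intro bound[OF reg]) auto
            also have "\<dots> \<le> Ct * (B * \<delta> n)"
              using elim Ct by (intro mult_left_mono) auto
            finally show False
              using that X_nonneg[of n \<eta>] by simp
          qed
          then have "P.prob {\<omega> \<in> space (std_normal_d (d n)). \<bar>X n \<omega>\<bar> > Ct * B * \<delta> n}
              \<le> P.prob {\<omega> \<in> space (std_normal_d (d n)). 1 / \<epsilon> * real (d n) < (L2_set \<omega> {..<d n})\<^sup>2}"
          proof (intro P.finite_measure_mono)
            have [measurable]: "(\<lambda>\<eta>. \<eta> i) \<in> borel_measurable (std_normal_d (d n))" if "i < d n" for i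
              by (rule measurable_component_borel) (use that in auto)
            show "{\<omega> \<in> space (std_normal_d (d n)). 1 / \<epsilon> * real (d n) < (L2_set \<omega> {..<d n})\<^sup>2}
                \<in> sets (std_normal_d (d n))"
              unfolding L2_set_power2 by measurable
          qed auto
          also have "\<dots> \<le> \<epsilon>"
            by (rule std_normal_d_tail[OF \<epsilon> d_ge])
          finally show ?case
            using meas by simp
        qed
      qed
    qed
  qed
  then show ?thesis
    unfolding X_def[abs_def] .
qed

end
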